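(* Consider an $N$-agent sequential dynamic team problem such that: (a) for each fixed $\omega\in\Omega$ the map $(\mathbf y,\mathbf u)\mapsto c(\omega,\mathbf y,\mathbf u)$ is continuous, and $c$ is bounded on every compact subset of $\Omega\times\mathsf Y\times\mathsf U$; (b) each $\mathsf U^i$ is a closed and convex subset of a completely metrizable locally convex vector space; (c) each $\mathsf Y^i$ is locally compact; (e) for every $\underline\gamma\in\mathbf\Gamma$ with $J(\underline\gamma)<\infty$ and each $i$, there exists $u^{i,*}\in\mathsf U^i$ such that $J(\underline\gamma^{-i},\gamma^i_{u^{i,*}})<\infty$, where $\gamma^i_{u^{i,*}}\equiv u^{i,*}$ and $(\underline\gamma^{-i},\gamma^i_{u^{i,*}})$ is $\underline\gamma$ with its $i$-th component replaced; (AC) for every $i$ there exist a measurable $f_i:\Omega\times\prod_{j=1}^{i-1}\mathsf U^j\times\mathsf Y^i\to[0,\infty)$ and a probability measure $\nu_i$ on $\mathsf Y^i$ such that $\eta_i(S|\omega,\mathbf u^{i-1})=\int_Sf_i(\omega,\mathbf u^{i-1},y^i)\,\nu_i(dy^i)$ for all Borel $S\subset\mathsf Y^i$ and all $(\omega,\mathbf u^{i-1})$. Suppose in addition that for each $i$ the function $f_i(\omega,\mathbf u^{i-1},y^i)$ is continuous in $(\mathbf u^{i-1},y^i)$, and that for every compact $G\subset\mathsf U$ of the form $G=\prod_{i=1}^NG^i$ the function $$\tilde w_G(\omega,\mathbf y):=\sup_{\mathbf u\in G}c(\omega,\mathbf y,\mathbf u)\prod_{i=1}^Nf_i(\omega,\mathbf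 u^{i-1},y^i)$$ is uniformly integrable with respect to $\{\tilde{\mathbb P}_{l,n}\}$, i.e. $\lim_{R\to\infty}\sup_{l,n}\int_{\{\tilde w_G>R\}}\tilde w_G\,d\tilde{\mathbb P}_{l,n}=0$. Then: (1) The static reduction, with cost $\tilde c$ and measure $\tilde{\mathbb P}$, satisfies: $\tilde c$ is continuous in $(\mathbf y,\mathbf u)$ for each fixed $\omega$ and bounded on compact subsets of $\Omega\times\mathsf Y\times\mathsf U$; (b), (c) and (e) hold; and for every compact $G=\prod_iG^i\subset\mathsf U$, $\tilde w_G$ is $\tilde{\mathbb P}$-integrable and uniformly integrable with respect to $\{\tilde{\mathbb P}_{l,n}\}$. (2) For any $\varepsilon>0$ there exist $(l,n)$ and $\underline\gamma\in\mathbf\Gamma_{l,n}$ with $J(\underline\gamma)<J^*+\varepsilon$. (3) For any $\varepsilon>0$ there exist $(l,n)$, a compact $G=\prod_{i=1}^NG^i\subset\mathsf U$ and $\delta>0$ such that every $\underline\pi^*\in\mathbf\Pi_{l,n}^G$ with $J_{l,n}(\underline\pi^* )\le\inf_{\underline\pi\in\mathbf\Pi_{l,n}^G}J_{l,n}(\underline\pi)+\delta$ satisfies $J(\pi^{1*}\circ Q_{l,n}^1,\dots,\pi^{N*}\circ Q_{l,n}^N)\le J^*+\varepsilon$. In particular, conclusions (2) and (3) hold for every dynamic team satisfying (a), (b), (c), (e), (AC) for which each $f_i$ is bounded and is continuous in $(\mathbf u^{i-1},y^i)$, and for which, for every compact $G=\prod_iG^i\subset\mathsf U$, the function $w_G(\omega,\mathbf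 y)=\sup_{\mathbf u\in G}c(\omega,\mathbf y,\mathbf u)$ is $\tilde{\mathbb P}$-integrable and uniformly integrable with respect to $\{\tilde{\mathbb P}_{l,n}\}$.
   Context: Sequential dynamic team: a Borel space is a Borel subset of a complete separable metric space, with its Borel $\sigma$-algebra. $\Omega$ is a Borel space with probability measure $\mathbb P$; for $i=1,\dots,N$ the observation space $\mathsf Y^i$ (with metric $d_i$) and the action space $\mathsf U^i$ are Borel spaces; $\mathsf Y=\prod_i\mathsf Y^i$, $\mathsf U=\prod_i\mathsf U^i$. Agents act in the order $1,\dots,N$; Agent $i$ observes $y^i\sim\eta_i(\cdot|\omega,\mathbf u^{i-1})$, where $\mathbf u^{i-1}=(u^1,\dots,u^{i-1})$ and $\eta_i$ is a stochastic kernel on $\mathsf Y^i$ given $\Omega\times\prod_{j<i}\mathsf U^j$, and plays $u^i=\gamma^i(y^i)$. $\Gamma^i$ is the set of measurable maps $\gamma^i:\mathsf Y^i\to\mathsf U^i$, $\mathbf\Gamma=\prod_i\Gamma^i$. The cost function $c:\Omega\times\mathsf Y\times\mathsf U\to[0,\infty)$ is Borel measurable, $J(\underline\gamma)=E[c(\omega,\mathbf y,\mathbf u)]\in[0,\infty]$ with $\mathbf u=\underline\gamma(\mathbf y)=(\gamma^1(y^1),\dots,\gamma^N(y^N))$, and $J^*=\inf_{\underline\gamma\in\mathbf\Gamma}J(\underline\gamma)$. Static reduction: under (AC), set $\tilde c(\omega,\mathbf y,\mathbf u)=c(\omega,\mathbf y,\mathbf u)\prod_{i=1}^Nf_i(\omega,\mathbf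 u^{i-1},y^i)$ and $\tilde{\mathbb P}(d\omega,d\mathbf y)=\mathbb P(d\omega)\prod_{i=1}^N\nu_i(dy^i)$; then $J(\underline\gamma)=\int\tilde c(\omega,\mathbf y,\underline\gamma(\mathbf y))\,\tilde{\mathbb P}(d\omega,d\mathbf y)$, the cost of a static team with state $\omega$ and independent observations $y^i\sim\nu_i$. Quantizers: for each $i$, $(\mathsf K_l^i)_{l\ge1}$ is a sequence of compact sets with $\mathsf K_l^i\subset\operatorname{int}\mathsf K_{l+1}^i$ and $\mathsf Y^i=\bigcup_l\mathsf K_l^i$. For $l,n\ge1$, $\mathsf Y_{l,n}^i\subset\mathsf K_l^i$ is a finite $1/n$-net in $\mathsf K_l^i$ (i.e. $\min_{z\in\mathsf Y_{l,n}^i}d_i(y,z)<1/n$ for all $y\in\mathsf K_l^i$). Fix $y_{i,0}\in\mathsf Y^i$; $Q_{l,n}^i(y)=\arg\min_{z\in\mathsf Y_{l,n}^i}d_i(y,z)$ (ties broken measurably) for $y\in\mathsf K_l^i$, and $Q_{l,n}^i(y)=y_{i,0}$ otherwise. $\mathbf\Gamma_{l,n}=\prod_i\{\gamma^i\circ Q_{l,n}^i:\gamma^i\in\Gamma^i\}$. Finite observation model of the static reduction: $\mathsf Z_{l,n}^i=\{y_{i,0}\}\cup\mathsf Y_{l,n}^i$, $\mathsf Z_{l,n}=\prod_i\mathsf Z_{l,n}^i$; $\tilde{\mathbb P}_{l,n}(d\omega,d\mathbf y)=\mathbb P(d\omega)\prod_i\nu_i^{l,n}(dy^i)$ with $\nu_i^{l,n}=\nu_i\circ(Q_{l,n}^i)^{-1}$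 the push-forward; $\mathbf\Pi_{l,n}=\prod_i\{\pi^i:\mathsf Z_{l,n}^i\to\mathsf U^i\}$; $\mathbf\Pi_{l,n}^G=\{\underline\pi\in\mathbf\Pi_{l,n}:\underline\pi(\mathsf Z_{l,n})\subset G\}$; $J_{l,n}(\underline\pi)=\int\tilde c(\omega,\mathbf y,\underline\pi(\mathbf y))\,\tilde{\mathbb P}_{l,n}(d\omega,d\mathbf y)$.
   Formalization: In (1), "c̃ is bounded on compact subsets" is proved only for compact subsets of Ω×Y×U on which each f_i is bounded; as written the clause is false, since f_i is only measurable in ω and may be unbounded on a compact set. *)

theory Defs
  imports "HOL-Probability.Probability"
begin

text \<open>Completely metrizable locally convex vector spaces: \<open>dist\<close> is any complete metric inducing the
  topology; it need not be translation invariant.\<close>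

class completely_metrizable_lcs = real_vector + complete_space + topological_ab_group_add +
  assumes tendsto_scaleR_Pair:
      "((\<lambda>p. fst p *\<^sub>R snd p) \<longlongrightarrow> r *\<^sub>R x) (nhds r \<times>\<^sub>F nhds x)"
    and locally_convex:
      "open V \<Longrightarrow> 0 \<in> V \<Longrightarrow> \<exists>W. open W \<and> 0 \<in> W \<and> W \<subseteq> V \<and>
         (\<forall>x\<in>W. \<forall>y\<in>W. \<forall>s\<ge>0. \<forall>t\<ge>0. s + t = 1 \<longrightarrow> s *\<^sub>R x + t *\<^sub>R y \<in> W)"

text \<open>The agents are \<open>1, \<dots>, agents T\<close>.  Their observation spaces are subsets of one type \<open>'y\<close>, the
  metric \<open>d\<^sub>i\<close> being \<open>dist\<close>, and their action spaces are subsets of one type \<open>'u\<close>.  This is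
  no restriction: finitely many complete separable metric spaces embed isometrically as closed sets in
  a common one (glue them at a point), and finitely many completely metrizable locally convex spaces
  embed as closed subspaces in their product.  Profiles \<open>\<^bold>y\<close>, \<open>\<^bold>u\<close>, \<open>\<^bold>u\<^sup>i\<^sup>-\<^sup>1\<close> are elements of the extensional
  products \<open>PiE {1..N} _\<close>, \<open>PiE {1..<i} _\<close>, which carry the product topology of the function type.\<close>

record ('w, 'y, 'u) team =
  agents :: nat
  states :: "'w set"
  prior :: "'w measure"
  obs :: "nat \<Rightarrow> 'y set"
  act :: "nat \<Rightarrow> 'u set"
  kernel :: "nat \<Rightarrow> 'w \<times> (nat \<Rightarrow> 'u) \<Rightarrow> 'y measure"
  cost :: "'w \<Rightarrow> (nat \<Rightarrow> 'y) \<Rightarrow> (nat \<Rightarrow> 'u) \<Rightarrow> real"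

definition obs_prod :: "('w, 'y, 'u) team \<Rightarrow> (nat \<Rightarrow> 'y) set" where
  "obs_prod T = PiE {1..agents T} (obs T)"

definition act_prod :: "('w, 'y, 'u) team \<Rightarrow> (nat \<Rightarrow> 'u) set" where
  "act_prod T = PiE {1..agents T} (act T)"

definition act_before :: "('w, 'y, 'u) team \<Rightarrow> nat \<Rightarrow> (nat \<Rightarrow> 'u) set" where
  "act_before T i = PiE {1..<i} (act T)"

definition state_sp :: "('w::topological_space, 'y, 'u) team \<Rightarrow> 'w measure" where
  "state_sp T = restrict_space borel (states T)"

definition obs_sp :: "('w, 'y::topological_space, 'u) team \<Rightarrow> nat \<Rightarrow> 'y measure" where
  "obs_sp T i = restrict_space borel (obs T i)"

definition act_sp :: "('w, 'y, 'u::topological_space) team \<Rightarrow> nat \<Rightarrow> 'u measure" where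
  "act_sp T i = restrict_space borel (act T i)"

text \<open>All spaces are Borel spaces.  The ambient space of the actions need not be separable, hence the
  separate requirement; the closure of \<open>act T i\<close> is then a complete separable metric space.
  By separability, the Borel \<open>\<sigma>\<close>-algebras of the products are the product \<open>\<sigma>\<close>-algebras.\<close>

definition sequential_team ::
    "('w::polish_space, 'y::polish_space, 'u::completely_metrizable_lcs) team \<Rightarrow> bool" where
  "sequential_team T \<longleftrightarrow>
     1 \<le> agents T \<and>
     states T \<in> sets borel \<and>
     prob_space (prior T) \<and> sets (prior T) = sets (state_sp T) \<and>
     (\<forall>i\<in>{1..agents T}.
        obs T i \<in> sets borel \<and>
        act T i \<in> sets borel \<and> act T i \<noteq> {} \<and> separable_space (top_of_set (act T i)) \<and>
        kernel T i \<in> state_sp T \<Otimes>\<^sub>M PiM {1..<i} (act_sp T) \<rightarrow>\<^sub>M prob_algebra (obs_sp T i)) \<and>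
     (\<lambda>(\<omega>, y, u). cost T \<omega> y u) \<in> borel_measurable
        (state_sp T \<Otimes>\<^sub>M PiM {1..agents T} (obs_sp T) \<Otimes>\<^sub>M PiM {1..agents T} (act_sp T)) \<and>
     (\<forall>\<omega>\<in>states T. \<forall>y\<in>obs_prod T. \<forall>u\<in>act_prod T. 0 \<le> cost T \<omega> y u)"

text \<open>Only the components \<open>1, \<dots>, agents T\<close> of a policy, restricted to \<open>obs T i\<close>, are relevant.\<close>

definition policies ::
    "('w, 'y::topological_space, 'u::topological_space) team \<Rightarrow> (nat \<Rightarrow> 'y \<Rightarrow> 'u) set" where
  "policies T = {\<gamma>. \<forall>i\<in>{1..agents T}. \<gamma> i \<in> obs_sp T i \<rightarrow>\<^sub>M act_sp T i}"

definition apply_policy ::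
    "('w, 'y, 'u) team \<Rightarrow> (nat \<Rightarrow> 'y \<Rightarrow> 'u) \<Rightarrow> (nat \<Rightarrow> 'y) \<Rightarrow> nat \<Rightarrow> 'u" where
  "apply_policy T \<gamma> y = (\<lambda>i\<in>{1..agents T}. \<gamma> i (y i))"

text \<open>The joint law of \<open>(\<omega>, y\<^sup>1, \<dots>, y\<^sup>n)\<close> under the policy \<open>\<gamma>\<close>.\<close>

primrec joint_law ::
    "('w::topological_space, 'y::topological_space, 'u) team \<Rightarrow> (nat \<Rightarrow> 'y \<Rightarrow> 'u) \<Rightarrow> nat
       \<Rightarrow> ('w \<times> (nat \<Rightarrow> 'y)) measure" where
  "joint_law T \<gamma> 0 =
     distr (prior T) (state_sp T \<Otimes>\<^sub>M PiM {1..0} (obs_sp T)) (\<lambda>\<omega>. (\<omega>, \<lambda>_. undefined))"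
| "joint_law T \<gamma> (Suc n) =
     joint_law T \<gamma> n \<bind> (\<lambda>(\<omega>, y).
       distr (kernel T (Suc n) (\<omega>, \<lambda>j\<in>{1..<Suc n}. \<gamma> j (y j)))
         (state_sp T \<Otimes>\<^sub>M PiM {1..Suc n} (obs_sp T)) (\<lambda>z. (\<omega>, y(Suc n := z))))"

text \<open>The expectation of the cost \<open>c\<close> under \<open>\<gamma>\<close> when \<open>M\<close> is the law of \<open>(\<omega>, \<^bold>y)\<close>.\<close>

definition expected_cost ::
    "('w, 'y, 'u) team \<Rightarrow> ('w \<times> (nat \<Rightarrow> 'y)) measure \<Rightarrow> ('w \<Rightarrow> (nat \<Rightarrow> 'y) \<Rightarrow> (nat \<Rightarrow> 'u) \<Rightarrow> real)
       \<Rightarrow> (nat \<Rightarrow> 'y \<Rightarrow> 'u) \<Rightarrow> ennreal" where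
  "expected_cost T M c \<gamma> = (\<integral>\<^sup>+ (\<omega>, y). ennreal (c \<omega> y (apply_policy T \<gamma> y)) \<partial>M)"

definition J :: "('w::topological_space, 'y::topological_space, 'u) team
    \<Rightarrow> (nat \<Rightarrow> 'y \<Rightarrow> 'u) \<Rightarrow> ennreal" where
  "J T \<gamma> = expected_cost T (joint_law T \<gamma> (agents T)) (cost T) \<gamma>"

definition J_opt ::
    "('w::topological_space, 'y::topological_space, 'u::topological_space) team \<Rightarrow> ennreal" where
  "J_opt T = (INF \<gamma>\<in>policies T. J T \<gamma>)"

text \<open>Hypotheses on a team.  Those that have to be checked both for the team and for its static
  reduction take the cost function, resp. the cost functional, as an argument.\<close>

definition cost_continuous :: "('w, 'y::topological_space, 'u::topological_space) team
    \<Rightarrow> ('w \<Rightarrow> (nat \<Rightarrow> 'y) \<Rightarrow> (nat \<Rightarrow> 'u) \<Rightarrow> real) \<Rightarrow> bool" where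
  "cost_continuous T c \<longleftrightarrow>
     (\<forall>\<omega>\<in>states T. continuous_on (obs_prod T \<times> act_prod T) (\<lambda>(y, u). c \<omega> y u))"

definition act_closed_convex :: "('w, 'y, 'u::completely_metrizable_lcs) team \<Rightarrow> bool" where
  "act_closed_convex T \<longleftrightarrow> (\<forall>i\<in>{1..agents T}. closed (act T i) \<and> convex (act T i))"

definition obs_locally_compact :: "('w, 'y::topological_space, 'u) team \<Rightarrow> bool" where
  "obs_locally_compact T \<longleftrightarrow> (\<forall>i\<in>{1..agents T}. locally compact (obs T i))"

definition finite_constant_deviations ::
    "('w, 'y::topological_space, 'u::topological_space) team
       \<Rightarrow> ((nat \<Rightarrow> 'y \<Rightarrow> 'u) \<Rightarrow> ennreal) \<Rightarrow> bool" where
  "finite_constant_deviations T J' \<longleftrightarrow>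
     (\<forall>\<gamma>\<in>policies T. J' \<gamma> < \<infinity> \<longrightarrow>
        (\<forall>i\<in>{1..agents T}. \<exists>u\<in>act T i. J' (\<gamma>(i := (\<lambda>_. u))) < \<infinity>))"

definition dominated ::
    "('w::topological_space, 'y::topological_space, 'u::topological_space) team
       \<Rightarrow> (nat \<Rightarrow> 'w \<Rightarrow> (nat \<Rightarrow> 'u) \<Rightarrow> 'y \<Rightarrow> real) \<Rightarrow> (nat \<Rightarrow> 'y measure) \<Rightarrow> bool" where
  "dominated T f \<nu> \<longleftrightarrow>
     (\<forall>i\<in>{1..agents T}.
        prob_space (\<nu> i) \<and> sets (\<nu> i) = sets (obs_sp T i) \<and>
        (\<lambda>(\<omega>, u, y). f i \<omega> u y) \<in> borel_measurable
           (state_sp T \<Otimes>\<^sub>M PiM {1..<i} (act_sp T) \<Otimes>\<^sub>M obs_sp T i) \<and>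
        (\<forall>\<omega>\<in>states T. \<forall>u\<in>act_before T i.
           (\<forall>y\<in>obs T i. 0 \<le> f i \<omega> u y) \<and>
           (\<forall>S\<in>sets (obs_sp T i).
              emeasure (kernel T i (\<omega>, u)) S = (\<integral>\<^sup>+ y\<in>S. ennreal (f i \<omega> u y) \<partial>\<nu> i))))"

definition densities_continuous ::
    "('w, 'y::topological_space, 'u::topological_space) team
       \<Rightarrow> (nat \<Rightarrow> 'w \<Rightarrow> (nat \<Rightarrow> 'u) \<Rightarrow> 'y \<Rightarrow> real) \<Rightarrow> bool" where
  "densities_continuous T f \<longleftrightarrow>
     (\<forall>i\<in>{1..agents T}. \<forall>\<omega>\<in>states T.
        continuous_on (act_before T i \<times> obs T i) (\<lambda>(u, y). f i \<omega> u y))"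

definition densities_bounded ::
    "('w, 'y, 'u) team \<Rightarrow> (nat \<Rightarrow> 'w \<Rightarrow> (nat \<Rightarrow> 'u) \<Rightarrow> 'y \<Rightarrow> real) \<Rightarrow> bool" where
  "densities_bounded T f \<longleftrightarrow>
     (\<forall>i\<in>{1..agents T}. bounded ((\<lambda>(\<omega>, u, y). f i \<omega> u y) ` (states T \<times> act_before T i \<times> obs T i)))"

text \<open>Static reduction.\<close>

definition static_cost ::
    "('w, 'y, 'u) team \<Rightarrow> (nat \<Rightarrow> 'w \<Rightarrow> (nat \<Rightarrow> 'u) \<Rightarrow> 'y \<Rightarrow> real)
       \<Rightarrow> 'w \<Rightarrow> (nat \<Rightarrow> 'y) \<Rightarrow> (nat \<Rightarrow> 'u) \<Rightarrow> real" where
  "static_cost T f \<omega> y u =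
     cost T \<omega> y u * (\<Prod>i\<in>{1..agents T}. f i \<omega> (restrict u {1..<i}) (y i))"

definition static_law ::
    "('w, 'y, 'u) team \<Rightarrow> (nat \<Rightarrow> 'y measure) \<Rightarrow> ('w \<times> (nat \<Rightarrow> 'y)) measure" where
  "static_law T \<nu> = prior T \<Otimes>\<^sub>M PiM {1..agents T} \<nu>"

text \<open>Quantizers: \<open>K i l\<close>, \<open>net i l n\<close>, \<open>Q i l n\<close> for \<open>l, n \<ge> 1\<close>.\<close>

definition quantizers ::
    "('w, 'y::metric_space, 'u) team \<Rightarrow> (nat \<Rightarrow> nat \<Rightarrow> 'y set) \<Rightarrow> (nat \<Rightarrow> nat \<Rightarrow> nat \<Rightarrow> 'y set)
       \<Rightarrow> (nat \<Rightarrow> 'y) \<Rightarrow> (nat \<Rightarrow> nat \<Rightarrow> nat \<Rightarrow> 'y \<Rightarrow> 'y) \<Rightarrow> bool" where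
  "quantizers T K net y0 Q \<longleftrightarrow>
     (\<forall>i\<in>{1..agents T}.
        (\<forall>l\<ge>1. compact (K i l) \<and> K i l \<subseteq> top_of_set (obs T i) interior_of K i (Suc l)) \<and>
        obs T i = (\<Union>l\<in>{1..}. K i l) \<and>
        y0 i \<in> obs T i \<and>
        (\<forall>l\<ge>1. \<forall>n\<ge>1.
           finite (net i l n) \<and> net i l n \<subseteq> K i l \<and>
           (\<forall>y\<in>K i l. \<exists>z\<in>net i l n. dist y z < 1 / real n) \<and>
           Q i l n \<in> obs_sp T i \<rightarrow>\<^sub>M obs_sp T i \<and>
           (\<forall>y\<in>K i l. is_arg_min (dist y) (\<lambda>z. z \<in> net i l n) (Q i l n y)) \<and>
           (\<forall>y\<in>obs T i - K i l. Q i l n y = y0 i)))"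

definition quantize ::
    "(nat \<Rightarrow> nat \<Rightarrow> nat \<Rightarrow> 'y \<Rightarrow> 'y) \<Rightarrow> nat \<Rightarrow> nat \<Rightarrow> (nat \<Rightarrow> 'y \<Rightarrow> 'u) \<Rightarrow> nat \<Rightarrow> 'y \<Rightarrow> 'u" where
  "quantize Q l n \<gamma> = (\<lambda>i. \<gamma> i \<circ> Q i l n)"

text \<open>Finite observation model of the static reduction; here \<open>\<^bold>y\<close> ranges over the finite product of
  the \<open>quantized_obs net y0 l n i\<close>.\<close>

definition quantized_obs ::
    "(nat \<Rightarrow> nat \<Rightarrow> nat \<Rightarrow> 'y set) \<Rightarrow> (nat \<Rightarrow> 'y) \<Rightarrow> nat \<Rightarrow> nat \<Rightarrow> nat \<Rightarrow> 'y set" where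
  "quantized_obs net y0 l n i = insert (y0 i) (net i l n)"

definition quantized_law ::
    "('w, 'y, 'u) team \<Rightarrow> (nat \<Rightarrow> 'y measure) \<Rightarrow> (nat \<Rightarrow> nat \<Rightarrow> nat \<Rightarrow> 'y set) \<Rightarrow> (nat \<Rightarrow> 'y)
       \<Rightarrow> (nat \<Rightarrow> nat \<Rightarrow> nat \<Rightarrow> 'y \<Rightarrow> 'y) \<Rightarrow> nat \<Rightarrow> nat \<Rightarrow> ('w \<times> (nat \<Rightarrow> 'y)) measure" where
  "quantized_law T \<nu> net y0 Q l n =
     prior T \<Otimes>\<^sub>M PiM {1..agents T}
       (\<lambda>i. distr (\<nu> i) (count_space (quantized_obs net y0 l n i)) (Q i l n))"

definition finite_policies ::
    "('w, 'y, 'u) team \<Rightarrow> (nat \<Rightarrow> nat \<Rightarrow> nat \<Rightarrow> 'y set) \<Rightarrow> (nat \<Rightarrow> 'y) \<Rightarrow> nat \<Rightarrow> nat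
       \<Rightarrow> (nat \<Rightarrow> 'u) set \<Rightarrow> (nat \<Rightarrow> 'y \<Rightarrow> 'u) set" where
  "finite_policies T net y0 l n G =
     {\<pi>. (\<forall>i\<in>{1..agents T}. \<pi> i \<in> quantized_obs net y0 l n i \<rightarrow> act T i) \<and>
         apply_policy T \<pi> ` PiE {1..agents T} (quantized_obs net y0 l n) \<subseteq> G}"

text \<open>The sets \<open>G = \<Prod>\<^sub>i G\<^sup>i\<close> with \<open>G\<^sup>i\<close> a compact subset of \<open>act T i\<close>.\<close>

definition compact_box ::
    "('w, 'y, 'u::topological_space) team \<Rightarrow> (nat \<Rightarrow> 'u) set \<Rightarrow> bool" where
  "compact_box T G \<longleftrightarrow>
     (\<exists>B. (\<forall>i\<in>{1..agents T}. compact (B i) \<and> B i \<subseteq> act T i) \<and> G = PiE {1..agents T} B)"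

definition sup_cost ::
    "('w \<Rightarrow> (nat \<Rightarrow> 'y) \<Rightarrow> (nat \<Rightarrow> 'u) \<Rightarrow> real) \<Rightarrow> (nat \<Rightarrow> 'u) set \<Rightarrow> 'w \<times> (nat \<Rightarrow> 'y) \<Rightarrow> ennreal" where
  "sup_cost c G = (\<lambda>(\<omega>, y). SUP u\<in>G. ennreal (c \<omega> y u))"

definition nn_integrable :: "'a measure \<Rightarrow> ('a \<Rightarrow> ennreal) \<Rightarrow> bool" where
  "nn_integrable M w \<longleftrightarrow> w \<in> borel_measurable M \<and> (\<integral>\<^sup>+ x. w x \<partial>M) < \<infinity>"

definition uniformly_integrable :: "(nat \<Rightarrow> nat \<Rightarrow> 'a measure) \<Rightarrow> ('a \<Rightarrow> ennreal) \<Rightarrow> bool" where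
  "uniformly_integrable M w \<longleftrightarrow>
     ((\<lambda>R::real. SUP (l, n)\<in>{1..} \<times> {1..}.
         \<integral>\<^sup>+ x\<in>{x \<in> space (M l n). ennreal R < w x}. w x \<partial>M l n) \<longlongrightarrow> 0) at_top"

text \<open>The two approximation properties.  In the second one, \<open>G\<close> has to be nonempty because otherwise
  there is no policy with values in \<open>G\<close>.\<close>

definition quantized_policies_near_optimal ::
    "('w::topological_space, 'y::topological_space, 'u::topological_space) team
       \<Rightarrow> (nat \<Rightarrow> nat \<Rightarrow> nat \<Rightarrow> 'y \<Rightarrow> 'y) \<Rightarrow> bool" where
  "quantized_policies_near_optimal T Q \<longleftrightarrow>
     (\<forall>\<epsilon>>0::real. \<exists>l\<ge>1. \<exists>n\<ge>1. \<exists>\<gamma>\<in>quantize Q l n ` policies T. J T \<gamma> < J_opt T + ennreal \<epsilon>)"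

definition finite_models_near_optimal ::
    "('w::topological_space, 'y::topological_space, 'u::topological_space) team
       \<Rightarrow> (nat \<Rightarrow> 'w \<Rightarrow> (nat \<Rightarrow> 'u) \<Rightarrow> 'y \<Rightarrow> real) \<Rightarrow> (nat \<Rightarrow> 'y measure)
       \<Rightarrow> (nat \<Rightarrow> nat \<Rightarrow> nat \<Rightarrow> 'y set) \<Rightarrow> (nat \<Rightarrow> 'y) \<Rightarrow> (nat \<Rightarrow> nat \<Rightarrow> nat \<Rightarrow> 'y \<Rightarrow> 'y) \<Rightarrow> bool" where
  "finite_models_near_optimal T f \<nu> net y0 Q \<longleftrightarrow>
     (\<forall>\<epsilon>>0::real. \<exists>l\<ge>1. \<exists>n\<ge>1. \<exists>G. \<exists>\<delta>>0::real.
        compact_box T G \<and> G \<noteq> {} \<and>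
        (let J_ln = expected_cost T (quantized_law T \<nu> net y0 Q l n) (static_cost T f);
             \<Pi>_G = finite_policies T net y0 l n G
         in \<forall>\<pi>\<in>\<Pi>_G. J_ln \<pi> \<le> (INF \<pi>'\<in>\<Pi>_G. J_ln \<pi>') + ennreal \<delta> \<longrightarrow>
              J T (quantize Q l n \<pi>) \<le> J_opt T + ennreal \<epsilon>))"

end

theory Submission
  imports Defs
begin

text \<open>
  In the static reduction the observations have a fixed law \<open>\<mu>\<close>, and only the integrand depends on the
  policy.  By Lusin's theorem each policy component is continuous on a compact set carrying almost
  all of the mass of its observation, and by hypothesis (e) it may be replaced, agent by agent,
  by a constant action off that set at small extra cost.  The new components take values in compact
  sets, and a component that is continuous on a compact set and constant off it is the limit,
  pointwise everywhere, of functions of the quantized observation with the same values: on a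
  quantization cell that meets the compact set use a value attained there, elsewhere the constant.
  Since the supremum of the cost over the resulting box \<open>G\<close> is integrable (Fatou's lemma along the
  quantizers), dominated convergence gives (2).

  For (3), the finite model evaluates the cost at \<open>(Q y, u)\<close> and the original one at \<open>(y, u)\<close>, for the
  same \<open>u \<in> G\<close>.  The difference vanishes uniformly in \<open>u \<in> G\<close> by compactness, so uniform
  integrability makes the two cost functionals uniformly close on all policies with values in \<open>G\<close>.
\<close>

subsection \<open>Integration, Lusin's theorem and product measures\<close>

text \<open>Lusin's theorem bounds the probability of an exceptional set, not the cost incurred on
  it, and a cost has no integrable majorant until the actions lie in a compact box. This fixes the
  order of choices in the truncation. The constant action comes first, so that the cost of the
  deviating policy is one fixed integrable function. Absolute continuity of its integral then tells
  how small the exceptional set has to be, and only then is the compact set chosen. The cost stays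
  finite, so (e) can be applied again for the next agent.

  All limits of costs pass through one-sided inequalities in which only the function to be bounded
  needs a majorant with small tails. The majorant is the supremum of the cost over \<open>G\<close>,
  or the same supremum evaluated at the quantized observations; the tails of the latter under the
  static law are exactly the tails in the finite models. Limits run along the diagonal l = n = k +
  1, which is enough since both conclusions ask for a single pair (l, n).\<close>

lemma tendsto_diff_compact_param:
  fixes c :: "'a::metric_space \<Rightarrow> 'b::metric_space \<Rightarrow> real"
  assumes c: "continuous_on (Y \<times> U) (\<lambda>(y, u). c y u)"
    and G: "compact G" "G \<subseteq> U" and u: "\<And>n. u n \<in> G"
    and y: "y \<in> Y" "\<And>n. z n \<in> Y" "z \<longlonglongrightarrow> y"
  shows "(\<lambda>n. c (z n) (u n) - c y (u n)) \<longlonglongrightarrow> 0"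
proof (rule tendstoI, rule ccontr)
  fix e :: real
  assume e: "0 < e" and "\<not> (\<forall>\<^sub>F n in sequentially. dist (c (z n) (u n) - c y (u n)) 0 < e)"
  then obtain r :: "nat \<Rightarrow> nat" where r: "strict_mono r"
    and far: "\<And>n. \<not> dist (c (z (r n)) (u (r n)) - c y (u (r n))) 0 < e"
    using not_eventually_sequentiallyD by blast
  \<comment> \<open>The actions \<open>u n\<close> need not converge. Along the subsequence that
    keeps the gap \<open>e\<close> they stay in the compact \<open>G\<close>, so a further
    subsequence tends to some \<open>v\<close>; there both terms tend to \<open>c y v\<close>, which
    closes the gap. In effect this is convergence uniform over \<open>G\<close>, in sequential
    form.\<close>
  obtain v s where v: "v \<in> G" and s: "strict_mono (s :: nat \<Rightarrow> nat)"
    and lim: "((u \<circ> r) \<circ> s) \<longlonglongrightarrow> v"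
    using compact_imp_seq_compact[OF G(1)] u unfolding seq_compact_def by (metis comp_apply)
  have z: "(\<lambda>n. z (r (s n))) \<longlonglongrightarrow> y"
    using LIMSEQ_subseq_LIMSEQ[OF y(3) strict_mono_o[OF r s]] by (simp add: o_def)
  have u': "(\<lambda>n. u (r (s n))) \<longlonglongrightarrow> v"
    using lim by (simp add: o_def)
  have "(\<lambda>n. (\<lambda>(y, u). c y u) (z (r (s n)), u (r (s n)))) \<longlonglongrightarrow> (\<lambda>(y, u). c y u) (y, v)"
    by (rule continuous_on_tendsto_compose[OF c tendsto_Pair[OF z u']]) (use y u v G in \<open>auto simp: subset_iff\<close>)
  moreover have "(\<lambda>n. (\<lambda>(y, u). c y u) (y, u (r (s n)))) \<longlonglongrightarrow> (\<lambda>(y, u). c y u) (y, v)"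
    by (rule continuous_on_tendsto_compose[OF c tendsto_Pair[OF tendsto_const u']])
       (use y u v G in \<open>auto simp: subset_iff\<close>)
  ultimately have "(\<lambda>n. c (z (r (s n))) (u (r (s n))) - c y (u (r (s n)))) \<longlonglongrightarrow> 0"
    using tendsto_diff by fastforce
  then have "\<forall>\<^sub>F n in sequentially. dist (c (z (r (s n))) (u (r (s n))) - c y (u (r (s n)))) 0 < e"
    using e by (rule tendstoD)
  then show False
    using far by (auto simp: eventually_sequentially)
qed

text \<open>Dominated convergence with \<open>w\<close> as its own majorant: \<open>w\<close> is
  finite almost everywhere, so at almost every point the cut-off integrand is eventually 0 as the
  level grows.\<close>

lemma nn_integral_tail_small:
  fixes w :: "'a \<Rightarrow> ennreal"
  assumes [measurable]: "w \<in> borel_measurable M" and w: "(\<integral>\<^sup>+ x. w x \<partial>M) < \<infinity>" and e: "0 < e"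
  shows "\<exists>R\<ge>0. (\<integral>\<^sup>+ x\<in>{x \<in> space M. ennreal R < w x}. w x \<partial>M) \<le> ennreal e"
proof -
  have "AE x in M. w x \<noteq> \<infinity>"
    using w by (intro nn_integral_noteq_infinite) auto
  then have lim: "AE x in M. (\<lambda>n. w x * indicator {x \<in> space M. ennreal (real n) < w x} x) \<longlonglongrightarrow> 0"
  proof eventually_elim
    case (elim x)
    then obtain r where r: "w x = ennreal r" "0 \<le> r"
      by (cases "w x") auto
    obtain N :: nat where "r \<le> real N"
      using real_arch_simple by blast
    then have "\<forall>\<^sub>F n in sequentially. w x * indicator {x \<in> space M. ennreal (real n) < w x} x = 0"
      using r by (auto simp: eventually_sequentially indicator_def ennreal_less_iff intro!: exI[of _ N])
    then show ?case
      by (rule tendsto_eventually)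
  qed
  have "(\<lambda>n. \<integral>\<^sup>+ x. w x * indicator {x \<in> space M. ennreal (real n) < w x} x \<partial>M)
      \<longlonglongrightarrow> (\<integral>\<^sup>+ x. 0 \<partial>M)"
    by (rule nn_integral_dominated_convergence[where w = w])
       (use w lim in \<open>auto simp: indicator_def\<close>)
  then have "\<forall>\<^sub>F n in sequentially.
      (\<integral>\<^sup>+ x. w x * indicator {x \<in> space M. ennreal (real n) < w x} x \<partial>M) < ennreal e"
    using e by (intro order_tendstoD(2)[where y = 0]) auto
  then obtain n :: nat where "(\<integral>\<^sup>+ x\<in>{x \<in> space M. ennreal (real n) < w x}. w x \<partial>M) < ennreal e"
    using eventually_happens'[OF sequentially_bot] by blast
  then show ?thesis
    by (intro exI[of _ "real n"]) auto
qed

lemma nn_integral_absolutely_continuous: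
  fixes w :: "'a \<Rightarrow> ennreal"
  assumes [measurable]: "w \<in> borel_measurable M" and w: "(\<integral>\<^sup>+ x. w x \<partial>M) < \<infinity>" and e: "0 < e"
  shows "\<exists>d>0. \<forall>A\<in>sets M. emeasure M A \<le> ennreal d \<longrightarrow> (\<integral>\<^sup>+ x\<in>A. w x \<partial>M) \<le> ennreal e"
proof -
  obtain R where R: "0 \<le> R"
    and tail: "(\<integral>\<^sup>+ x\<in>{x \<in> space M. ennreal R < w x}. w x \<partial>M) \<le> ennreal (e / 2)"
    using nn_integral_tail_small[OF assms(1,2), of "e / 2"] e by auto
  \<comment> \<open>On \<open>A\<close> the integrand is at most its part above level
    \<open>R\<close> plus \<open>R\<close>, so \<open>R * d\<close> has to be at most
    \<open>e / 2\<close>. The denominator contains \<open>R + 1\<close> because \<open>R\<close> may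
    be 0.\<close>
  define d where "d = e / (2 * (R + 1))"
  have d: "0 < d" and Rd: "R * d \<le> e / 2"
    using R e by (auto simp: d_def field_simps)
  have "(\<integral>\<^sup>+ x\<in>A. w x \<partial>M) \<le> ennreal e" if [measurable]: "A \<in> sets M" and A: "emeasure M A \<le> ennreal d" for A
  proof -
    have "(\<integral>\<^sup>+ x\<in>A. w x \<partial>M) \<le>
        (\<integral>\<^sup>+ x. w x * indicator {x \<in> space M. ennreal R < w x} x + ennreal R * indicator A x \<partial>M)"
      by (intro nn_integral_mono) (auto simp: indicator_def not_less)
    also have "\<dots> = (\<integral>\<^sup>+ x\<in>{x \<in> space M. ennreal R < w x}. w x \<partial>M) + ennreal R * emeasure M A"
      by (simp add: nn_integral_add nn_integral_cmult)
    also have "\<dots> \<le> ennreal (e / 2) + ennreal R * ennreal d"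
      by (intro add_mono mult_left_mono tail A) auto
    also have "\<dots> \<le> ennreal e"
      using R Rd e d by (simp add: ennreal_mult[symmetric] ennreal_plus[symmetric] del: ennreal_plus)
    finally show ?thesis .
  qed
  with d show ?thesis
    by blast
qed

text \<open>One half of Vitali's theorem, in which only \<open>b\<close> has to be dominated.\<close>

lemma (in finite_measure) eventually_nn_integral_le:
  fixes a b :: "nat \<Rightarrow> 'a \<Rightarrow> real" and v :: "nat \<Rightarrow> 'a \<Rightarrow> ennreal"
  assumes [measurable]: "\<And>n. a n \<in> borel_measurable M" "\<And>n. b n \<in> borel_measurable M"
      "\<And>n. v n \<in> borel_measurable M"
    and nonneg: "\<And>n x. x \<in> space M \<Longrightarrow> 0 \<le> a n x"
    and lim: "\<And>x. x \<in> space M \<Longrightarrow> (\<lambda>n. b n x - a n x) \<longlonglongrightarrow> 0"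
    and le: "\<And>n x. x \<in> space M \<Longrightarrow> ennreal (b n x) \<le> v n x"
    and tail: "\<And>n. (\<integral>\<^sup>+ x\<in>{x \<in> space M. ennreal R < v n x}. v n x \<partial>M) \<le> ennreal e"
    and e: "0 < e"
  shows "\<forall>\<^sub>F n in sequentially. (\<integral>\<^sup>+ x. b n x \<partial>M) \<le> (\<integral>\<^sup>+ x. a n x \<partial>M) + ennreal (2 * e)"
proof -
  \<comment> \<open>Where \<open>v n\<close> is at most \<open>ennreal R\<close>, \<open>b n\<close>
    is at most \<open>max R 0\<close>, and since \<open>a n\<close> is nonnegative the excess
    \<open>b n - a n\<close> is at most \<open>h n\<close>. Where \<open>v n\<close> is larger, its
    tail absorbs \<open>b n\<close>. The cap makes \<open>h n\<close> bounded, so its integral tends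
    to 0 on a finite measure space without any bound on \<open>a n\<close>. One \<open>e\<close>
    pays for \<open>h n\<close> and one for the tail.\<close>
  define h where "h n x = min \<bar>b n x - a n x\<bar> (max R 0)" for n x
  have [measurable]: "h n \<in> borel_measurable M" for n
    unfolding h_def by measurable
  have "(\<lambda>n. \<integral>\<^sup>+ x. ennreal (h n x) \<partial>M) \<longlonglongrightarrow> (\<integral>\<^sup>+ x. 0 \<partial>M)"
  proof (rule nn_integral_dominated_convergence[where w = "\<lambda>_. ennreal (max R 0)"])
    show "(\<integral>\<^sup>+ x. ennreal (max R 0) \<partial>M) < \<infinity>"
      by (simp add: ennreal_mult_less_top less_top[symmetric] emeasure_finite ennreal_mult_eq_top_iff)
    have "(\<lambda>n. ennreal (h n x)) \<longlonglongrightarrow> 0" if "x \<in> space M" for x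
    proof -
      have "(\<lambda>n. h n x) \<longlonglongrightarrow> min \<bar>0\<bar> (max R 0)"
        unfolding h_def by (intro tendsto_intros lim that)
      then show ?thesis
        by (intro tendsto_ennrealI[where x = 0, simplified]) simp
    qed
    then show "AE x in M. (\<lambda>n. ennreal (h n x)) \<longlonglongrightarrow> 0"
      by auto
    show "AE x in M. ennreal (h n x) \<le> ennreal (max R 0)" for n
      by (intro AE_I2 ennreal_leI) (simp add: h_def)
  qed auto
  then have "\<forall>\<^sub>F n in sequentially. (\<integral>\<^sup>+ x. ennreal (h n x) \<partial>M) < ennreal e"
    using e by (intro order_tendstoD(2)[where y = 0]) auto
  then show ?thesis
  proof eventually_elim
    case (elim n)
    have "ennreal (b n x) \<le> ennreal (a n x) + ennreal (h n x)
        + v n x * indicator {x \<in> space M. ennreal R < v n x} x" if x: "x \<in> space M" for x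
    proof (cases "ennreal R < v n x")
      case True
      then show ?thesis
        using le[OF x, of n] x by (simp add: add_increasing)
    next
      case False
      then have "ennreal (b n x) \<le> ennreal (max R 0)"
        using le[OF x, of n] by (simp add: ennreal_max_0)
      then have "b n x \<le> max R 0"
        using ennreal_le_iff[of "max R 0"] by simp
      then have "b n x \<le> a n x + h n x"
        using nonneg[OF x, of n] by (auto simp: h_def)
      then show ?thesis
        using nonneg[OF x, of n] False
        by (simp add: h_def ennreal_plus[symmetric] ennreal_leI del: ennreal_plus)
    qed
    then have "(\<integral>\<^sup>+ x. b n x \<partial>M) \<le> (\<integral>\<^sup>+ x. ennreal (a n x) + ennreal (h n x)
        + v n x * indicator {x \<in> space M. ennreal R < v n x} x \<partial>M)"
      by (intro nn_integral_mono) auto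
    also have "\<dots> = (\<integral>\<^sup>+ x. a n x \<partial>M) + (\<integral>\<^sup>+ x. h n x \<partial>M)
        + (\<integral>\<^sup>+ x\<in>{x \<in> space M. ennreal R < v n x}. v n x \<partial>M)"
      by (simp add: nn_integral_add)
    also have "\<dots> \<le> (\<integral>\<^sup>+ x. a n x \<partial>M) + ennreal e + ennreal e"
      by (intro add_mono tail order_refl less_imp_le elim)
    also have "\<dots> = (\<integral>\<^sup>+ x. a n x \<partial>M) + ennreal (2 * e)"
      using e by (simp add: add.assoc ennreal_plus[symmetric] del: ennreal_plus)
    finally show ?case .
  qed
qed

section \<open>Inner regularity and Lusin's theorem\<close>

lemma inner_regular_restrict_borel:
  fixes A :: "'a::polish_space set"
  assumes "finite_measure N" and A: "A \<in> sets borel" and sets: "sets N = sets (restrict_space borel A)"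
    and B: "B \<in> sets N" and e: "(0::real) < e"
  shows "\<exists>C. compact C \<and> C \<subseteq> B \<and> C \<in> sets N \<and> emeasure N (B - C) \<le> ennreal e"
proof -
  interpret finite_measure N by fact
  have sub: "X \<in> sets N \<longleftrightarrow> X \<in> sets borel \<and> X \<subseteq> A" for X
    using A by (auto simp: sets sets_restrict_space_iff)
  have space: "space N = A"
    using sets_eq_imp_space_eq[OF sets] by (simp add: space_restrict_space)
  \<comment> \<open>Inner regularity by compact sets is available on the whole Polish space, so
    \<open>N\<close> is carried there by the identity. Subsets of \<open>A\<close> keep their
    measure, and a compact subset of \<open>B\<close> lies in \<open>A\<close> anyway.\<close>
  define M where "M = distr N borel id"
  have id[measurable]: "id \<in> N \<rightarrow>\<^sub>M borel"
    unfolding measurable_cong_sets[OF sets refl] id_def by (intro measurable_restrict_space1) simp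
  have eM: "emeasure M X = emeasure N (X \<inter> A)" if "X \<in> sets borel" for X
    using that by (simp add: M_def emeasure_distr space)
  have BA: "B \<in> sets borel" "B \<subseteq> A"
    using B sub by auto
  then have SUP: "emeasure N B = (SUP C \<in> {C. C \<subseteq> B \<and> compact C}. emeasure M C)"
    using inner_regular[of M B] eM[of B] emeasure_finite[of A] A
    by (simp add: M_def Int_absorb2 emeasure_distr space less_top[symmetric])
  have "\<exists>C. C \<subseteq> B \<and> compact C \<and> emeasure N B - ennreal e \<le> emeasure M C"
  proof (cases "emeasure N B - ennreal e = 0")
    case True
    then show ?thesis
      by (intro exI[of _ "{}"]) auto
  next
    case False
    then have "emeasure N B - ennreal e < emeasure N B"
      using e by (intro ennreal_between) (auto simp: emeasure_finite less_top[symmetric] diff_eq_0_iff_ennreal zero_less_iff_neq_zero)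
    then show ?thesis
      unfolding SUP less_SUP_iff by (auto intro: less_imp_le)
  qed
  then obtain C where C: "C \<subseteq> B" "compact C" "emeasure N B \<le> emeasure M C + ennreal e"
    by (auto simp: ennreal_minus_le_iff add.commute)
  have CN: "C \<in> sets N"
    using C BA sub borel_compact by auto
  have "emeasure N (B - C) \<le> ennreal e"
    using C CN B BA eM[of C] emeasure_finite[of C] borel_compact[OF C(2)]
    by (simp add: emeasure_Diff Int_absorb2 ennreal_minus_le_iff less_imp_le)
  then show ?thesis
    using C CN by blast
qed

text \<open>The preimage \<open>P n\<close> of each small ball and its complement are approximated
  from inside by compact sets \<open>C n\<close> and \<open>C' n\<close>. On \<open>K\<close> these
  two are closed and complementary, so every \<open>P n\<close> becomes relatively open there, and
  since the balls around \<open>D\<close> can be taken arbitrarily small, \<open>g\<close> is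
  continuous on \<open>K\<close>. The range is only a separable part of a metric space, hence the
  explicit dense set \<open>D\<close>, whose points may lie outside \<open>S\<close>.\<close>

lemma lusin_separable:
  fixes A :: "'a::polish_space set" and g :: "'a \<Rightarrow> 'b::metric_space"
  assumes N: "finite_measure N" and A: "A \<in> sets borel" and sets: "sets N = sets (restrict_space borel A)"
    and g: "g \<in> N \<rightarrow>\<^sub>M restrict_space borel S"
    and D: "countable D" "S \<subseteq> closure D" and e: "(0::real) < e"
  shows "\<exists>K. compact K \<and> K \<subseteq> A \<and> continuous_on K g \<and> emeasure N (A - K) \<le> ennreal e"
proof (cases "D = {}")
  case True
  then have "A = {}"
    using D g measurable_space[OF g] sets_eq_imp_space_eq[OF sets] by (auto simp: space_restrict_space)
  then show ?thesis
    by (intro exI[of _ "{}"]) auto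
next
  case False
  have space: "space N = A"
    using sets_eq_imp_space_eq[OF sets] by (simp add: space_restrict_space)
  have gb[measurable]: "g \<in> N \<rightarrow>\<^sub>M borel" and gS: "\<And>x. x \<in> A \<Longrightarrow> g x \<in> S"
    using g measurable_space[OF g] by (auto simp: measurable_restrict_space2_iff space space_restrict_space)
  define V where "V n = (case prod_decode n of (k, m) \<Rightarrow> ball (from_nat_into D k) (1 / real (Suc m)))" for n
  define P where "P n = g -` V n \<inter> space N" for n
  have P[measurable]: "P n \<in> sets N" for n
    unfolding P_def V_def by (auto split: prod.split intro!: measurable_sets[OF gb])
  \<comment> \<open>The two approximations together lose at most e / 2^(n+1), so the loss summed
    over all n is at most \<open>e\<close>.\<close>
  have ex: "\<exists>C C'. compact C \<and> C \<subseteq> P n \<and> C \<in> sets N \<and> emeasure N (P n - C) \<le> ennreal (e * (1/2)^Suc n / 2) \<and>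
      compact C' \<and> C' \<subseteq> A - P n \<and> C' \<in> sets N \<and> emeasure N (A - P n - C') \<le> ennreal (e * (1/2)^Suc n / 2)" for n
  proof -
    have "A - P n \<in> sets N"
      using sets.compl_sets[OF P, of n] by (simp add: space)
    then show ?thesis
      using inner_regular_restrict_borel[OF N A sets P[of n], of "e * (1/2)^Suc n / 2"]
        inner_regular_restrict_borel[OF N A sets, of "A - P n" "e * (1/2)^Suc n / 2"] e
      by auto
  qed
  obtain C C' where C: "\<And>n. compact (C n)" "\<And>n. C n \<subseteq> P n" "\<And>n. C n \<in> sets N"
      "\<And>n. emeasure N (P n - C n) \<le> ennreal (e * (1/2)^Suc n / 2)"
    and C': "\<And>n. compact (C' n)" "\<And>n. C' n \<subseteq> A - P n" "\<And>n. C' n \<in> sets N"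
      "\<And>n. emeasure N (A - P n - C' n) \<le> ennreal (e * (1/2)^Suc n / 2)"
    using ex by metis
  note [measurable] = C(3) C'(3)
  define K where "K = (\<Inter>n. C n \<union> C' n)"
  \<comment> \<open>Repeating the term for n = 0 displays \<open>K\<close> as a closed subset of a
    compact set.\<close>
  have "K = (C 0 \<union> C' 0) \<inter> (\<Inter>n. C n \<union> C' n)"
    by (auto simp: K_def)
  moreover have "closed (\<Inter>n. C n \<union> C' n)"
    using C(1) C'(1) by (intro closed_INT ballI closed_Un compact_imp_closed) auto
  ultimately have "compact K"
    using C(1) C'(1) by (metis compact_Un compact_Int_closed)
  moreover have KA: "K \<subseteq> A"
    using C(2)[of 0] C'(2)[of 0] by (auto simp: K_def P_def space)
  moreover have "continuous_on K g"
    unfolding continuous_on_iff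
  proof (intro ballI allI impI)
    fix x and r :: real
    assume x: "x \<in> K" and r: "0 < r"
    then obtain m where m: "1 / real (Suc m) < r / 2"
      using reals_Archimedean[of "r / 2"] by (auto simp: inverse_eq_divide)
    have "g x \<in> closure D"
      using gS[of x] x KA D by auto
    then obtain d where "d \<in> D" "dist d (g x) < 1 / real (Suc m)"
      by (meson closure_approachable of_nat_0_less_iff zero_less_Suc zero_less_divide_1_iff)
    then obtain k where k: "dist (from_nat_into D k) (g x) < 1 / real (Suc m)"
      using from_nat_into_surj[OF D(1)] by metis
    define n where "n = prod_encode (k, m)"
    have V: "V n = ball (from_nat_into D k) (1 / real (Suc m))"
      by (simp add: V_def n_def)
    then have "x \<in> P n"
      using k x KA by (auto simp: P_def space)
    \<comment> \<open>The complement of the compact set \<open>C' n\<close> is open, so points of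
      \<open>K\<close> near \<open>x\<close> avoid \<open>C' n\<close> as well. They must then lie
      in \<open>C n\<close>, which \<open>g\<close> maps into the same small ball as
      \<open>x\<close>.\<close>
    then have "x \<notin> C' n"
      using C'(2)[of n] by auto
    then obtain s where s: "0 < s" "\<And>x'. dist x' x < s \<Longrightarrow> x' \<notin> C' n"
      using compact_imp_closed[OF C'(1)[of n]]
      by (metis ComplD ComplI closed_def open_dist)
    have "dist (g x') (g x) < r" if "x' \<in> K" "dist x' x < s" for x'
    proof -
      have "x' \<in> C n"
        using that s(2) by (auto simp: K_def)
      then have "g x' \<in> V n"
        using C(2)[of n] by (auto simp: P_def)
      then have "dist (from_nat_into D k) (g x') < 1 / real (Suc m)"
        by (simp add: V)
      then show ?thesis
        using k m dist_triangle3[of "g x'" "g x" "from_nat_into D k"] by linarith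
    qed
    then show "\<exists>d>0. \<forall>x'\<in>K. dist x' x < d \<longrightarrow> dist (g x') (g x) < r"
      using s(1) by blast
  qed
  moreover have "emeasure N (A - K) \<le> ennreal e"
  proof -
    have "A - K = (\<Union>n. (P n - C n) \<union> (A - P n - C' n)) \<inter> A"
    proof -
      have "C n \<inter> (A - P n) = {}" "C' n \<inter> P n = {}" for n
        using C(2) C'(2) by blast+
      then show ?thesis
        unfolding K_def by blast
    qed
    moreover have A': "A - P n - C' n \<in> sets N" for n
      using sets.compl_sets[OF P, of n] C'(3) by (metis sets.Diff space)
    moreover have "(\<Union>n. (P n - C n) \<union> (A - P n - C' n)) \<inter> A = (\<Union>n. (P n - C n) \<union> (A - P n - C' n))"
      by (auto simp: P_def space)
    ultimately have "emeasure N (A - K) \<le> (\<Sum>n. emeasure N ((P n - C n) \<union> (A - P n - C' n)))"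
      by (auto intro!: emeasure_subadditive_countably)
    also have "\<dots> \<le> (\<Sum>n. ennreal (e * (1/2)^Suc n))"
    proof (intro suminf_le summableI)
      fix n
      have "emeasure N ((P n - C n) \<union> (A - P n - C' n)) \<le>
          emeasure N (P n - C n) + emeasure N (A - P n - C' n)"
        by (intro emeasure_subadditive A') auto
      also have "\<dots> \<le> ennreal (e * (1/2)^Suc n / 2) + ennreal (e * (1/2)^Suc n / 2)"
        by (intro add_mono C C')
      also have "\<dots> = ennreal (e * (1/2)^Suc n)"
        using e by (simp add: ennreal_plus[symmetric] del: ennreal_plus)
      finally show "emeasure N ((P n - C n) \<union> (A - P n - C' n)) \<le> ennreal (e * (1/2)^Suc n)" .
    qed
    also have "\<dots> = ennreal e"
    proof -
      have "(\<lambda>n. e * (1/2)^Suc n) sums (e * 1)"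
        by (intro sums_mult power_half_series)
      then show ?thesis
        using e by (subst suminf_ennreal_eq) auto
    qed
    finally show ?thesis .
  qed
  ultimately show ?thesis
    by blast
qed

section \<open>Convergence and choice, dense subsets, products and tails\<close>

lemma tendsto_fun_iff:
  fixes x :: "'c \<Rightarrow> 'a \<Rightarrow> 'b::topological_space"
  shows "(x \<longlongrightarrow> l) F \<longleftrightarrow> (\<forall>i. ((\<lambda>n. x n i) \<longlongrightarrow> l i) F)"
  using limitin_componentwise[of "\<lambda>_. euclidean" UNIV x l F]
  by (simp add: euclidean_product_topology)

text \<open>Selecting a counterexample at every \<open>k\<close> that has one yields a single
  sequence \<open>x\<close>, and the hypothesis for this \<open>x\<close> already is the uniform
  claim. It converts an estimate along arbitrary sequences of policies into one that is uniform over
  all policies.\<close>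

lemma eventually_ball_choice:
  assumes ne: "\<And>k. S k \<noteq> {}" and ev: "\<And>x. (\<And>k. x k \<in> S k) \<Longrightarrow> eventually (\<lambda>k. P k (x k)) F"
  shows "eventually (\<lambda>k. \<forall>x\<in>S k. P k x) F"
proof -
  define x where "x k = (if \<exists>x\<in>S k. \<not> P k x then SOME x. x \<in> S k \<and> \<not> P k x else SOME x. x \<in> S k)" for k
  have x: "x k \<in> S k \<and> ((\<exists>x\<in>S k. \<not> P k x) \<longrightarrow> \<not> P k (x k))" for k
    unfolding x_def using ne[of k] some_in_eq[of "S k"] someI_ex[of "\<lambda>x. x \<in> S k \<and> \<not> P k x"] by auto
  have "eventually (\<lambda>k. P k (x k)) F"
    using x by (intro ev) auto
  then show ?thesis
    by eventually_elim (use x in blast)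
qed

text \<open>The ambient action space need not be separable, but a compact set is totally bounded,
  and its finite nets of radius 1/(n+1) have a dense union.\<close>

lemma compact_countable_dense:
  fixes B :: "'a::metric_space set"
  assumes "compact B"
  shows "\<exists>D. countable D \<and> D \<subseteq> B \<and> B \<subseteq> closure D"
proof -
  have "\<exists>k. finite k \<and> k \<subseteq> B \<and> B \<subseteq> (\<Union>x\<in>k. ball x (1 / real (Suc n)))" for n
    using seq_compact_imp_totally_bounded[OF compact_imp_seq_compact[OF assms]] by simp
  then obtain k where k: "\<And>n. finite (k n)" "\<And>n. k n \<subseteq> B" "\<And>n. B \<subseteq> (\<Union>x\<in>k n. ball x (1 / real (Suc n)))"
    by metis
  have "x \<in> closure (\<Union>n. k n)" if x: "x \<in> B" for x
    unfolding closure_approachable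
  proof (intro allI impI)
    fix e :: real assume "0 < e"
    then obtain n where n: "1 / real (Suc n) < e"
      using reals_Archimedean by (auto simp: inverse_eq_divide)
    obtain z where "z \<in> k n" "dist z x < 1 / real (Suc n)"
      using k(3)[of n] x by auto
    with n show "\<exists>z\<in>\<Union>n. k n. dist z x < e"
      by (auto intro!: bexI[of _ z])
  qed
  with k show ?thesis
    by (intro exI[of _ "\<Union>n. k n"]) (auto intro: countable_finite)
qed

text \<open>Both sides agree on rectangles, which determine a finite product of probability
  measures. Every factor has its own target \<open>N i\<close>, because in the finite models these
  are different discrete spaces.\<close>

lemma distr_PiM_indexed:
  assumes I: "finite I" and M: "\<And>i. i \<in> I \<Longrightarrow> prob_space (M i)"
    and f: "\<And>i. i \<in> I \<Longrightarrow> f i \<in> M i \<rightarrow>\<^sub>M N i"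
  shows "PiM I (\<lambda>i. distr (M i) (N i) (f i)) = distr (PiM I M) (PiM I N) (\<lambda>x. \<lambda>i\<in>I. f i (x i))"
proof -
  \<comment> \<open>\<open>product_prob_space\<close> asks for a probability measure at every index,
    while \<open>M i\<close> is one only for indices in \<open>I\<close>. A point mass is put
    elsewhere, and \<open>PiM I\<close> does not see it.\<close>
  define M' where "M' i = (if i \<in> I then M i else return (count_space UNIV) undefined)" for i
  define D where "D i = (if i \<in> I then distr (M i) (N i) (f i) else return (count_space UNIV) undefined)" for i
  interpret M: product_prob_space M'
    by (intro product_prob_spaceI) (auto simp: M'_def M prob_space_return)
  interpret D: product_prob_space D
    by (intro product_prob_spaceI) (auto simp: D_def prob_space_return intro!: prob_space.prob_space_distr M f)
  have eqM: "PiM I M' = PiM I M" and eqD: "PiM I D = PiM I (\<lambda>i. distr (M i) (N i) (f i))"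
    by (intro PiM_cong; simp add: M'_def D_def)+
  have F: "(\<lambda>x. \<lambda>i\<in>I. f i (x i)) \<in> PiM I M \<rightarrow>\<^sub>M PiM I N"
    using f by (intro measurable_restrict measurable_compose[OF measurable_component_singleton])
  have "distr (PiM I M) (PiM I N) (\<lambda>x. \<lambda>i\<in>I. f i (x i)) = PiM I D"
  proof (rule D.PiM_eqI[OF I])
    show "sets (distr (PiM I M) (PiM I N) (\<lambda>x. \<lambda>i\<in>I. f i (x i))) = sets (PiM I D)"
      by (simp, intro sets_PiM_cong) (auto simp: D_def)
    fix A assume "\<And>i. i \<in> I \<Longrightarrow> A i \<in> sets (D i)"
    then have A: "\<And>i. i \<in> I \<Longrightarrow> A i \<in> sets (N i)"
      by (simp add: D_def)
    have "emeasure (distr (PiM I M) (PiM I N) (\<lambda>x. \<lambda>i\<in>I. f i (x i))) (PiE I A) =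
        emeasure (PiM I M) ((\<lambda>x. \<lambda>i\<in>I. f i (x i)) -` PiE I A \<inter> space (PiM I M))"
      using A I by (intro emeasure_distr[OF F]) (auto intro: sets_PiM_I_finite)
    also have "(\<lambda>x. \<lambda>i\<in>I. f i (x i)) -` PiE I A \<inter> space (PiM I M) = PiE I (\<lambda>i. f i -` A i \<inter> space (M i))"
      by (auto simp: space_PiM PiE_iff)
    also have "emeasure (PiM I M) (PiE I (\<lambda>i. f i -` A i \<inter> space (M i))) = (\<Prod>i\<in>I. emeasure (M' i) (f i -` A i \<inter> space (M i)))"
      unfolding eqM[symmetric] using A by (intro M.emeasure_PiM I) (auto simp: M'_def intro: measurable_sets[OF f])
    also have "\<dots> = (\<Prod>i\<in>I. emeasure (D i) (A i))"
      using A f by (intro prod.cong) (auto simp: M'_def D_def emeasure_distr)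
    finally show "emeasure (distr (PiM I M) (PiM I N) (\<lambda>x. \<lambda>i\<in>I. f i (x i))) (PiE I A) = (\<Prod>i\<in>I. emeasure (D i) (A i))" .
  qed
  then show ?thesis
    by (simp add: eqD)
qed

lemma uniformly_integrable_tail:
  assumes "uniformly_integrable M w" and e: "(0::real) < e"
  shows "\<exists>R\<ge>0. \<forall>l\<ge>1. \<forall>n\<ge>1. (\<integral>\<^sup>+ x\<in>{x \<in> space (M l n). ennreal R < w x}. w x \<partial>M l n) \<le> ennreal e"
proof -
  have "\<forall>\<^sub>F R in at_top. (SUP (l, n)\<in>{1..} \<times> {1..}.
      \<integral>\<^sup>+ x\<in>{x \<in> space (M l n). ennreal R < w x}. w x \<partial>M l n) < ennreal e"
    using assms unfolding uniformly_integrable_def by (intro order_tendstoD(2)[where y = 0]) auto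
  then have "\<forall>\<^sub>F R::real in at_top. 0 \<le> R \<and> (SUP (l, n)\<in>{1..} \<times> {1..}.
      \<integral>\<^sup>+ x\<in>{x \<in> space (M l n). ennreal R < w x}. w x \<partial>M l n) < ennreal e"
    using eventually_ge_at_top by (rule eventually_conj[rotated])
  then obtain R :: real where R: "0 \<le> R" and sup: "(SUP (l, n)\<in>{1..} \<times> {1..}.
      \<integral>\<^sup>+ x\<in>{x \<in> space (M l n). ennreal R < w x}. w x \<partial>M l n) < ennreal e"
    using eventually_happens'[OF trivial_limit_at_top_linorder] by blast
  have "(\<integral>\<^sup>+ x\<in>{x \<in> space (M l n). ennreal R < w x}. w x \<partial>M l n) \<le> ennreal e" if "1 \<le> l" "1 \<le> n" for l n
  proof -
    have "(\<integral>\<^sup>+ x\<in>{x \<in> space (M l n). ennreal R < w x}. w x \<partial>M l n) \<le> (SUP (l, n)\<in>{1..} \<times> {1..}.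
        \<integral>\<^sup>+ x\<in>{x \<in> space (M l n). ennreal R < w x}. w x \<partial>M l n)"
      using that by (intro SUP_upper2[where i = "(l, n)"]) auto
    then show ?thesis
      using sup by (meson less_imp_le order_trans)
  qed
  with R show ?thesis
    by blast
qed

subsection \<open>The static reduction\<close>

declare One_nat_def [simp del]

locale dominated_team =
  fixes T :: "('w::polish_space, 'y::polish_space, 'u::completely_metrizable_lcs) team"
    and f :: "nat \<Rightarrow> 'w \<Rightarrow> (nat \<Rightarrow> 'u) \<Rightarrow> 'y \<Rightarrow> real"
    and \<nu> :: "nat \<Rightarrow> 'y measure"
  assumes team: "sequential_team T"
    and dominated: "dominated T f \<nu>"
begin

abbreviation "I \<equiv> {1..agents T}"

lemma space_state_sp [simp]: "space (state_sp T) = states T"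
  by (simp add: state_sp_def space_restrict_space)

lemma space_obs_sp [simp]: "space (obs_sp T i) = obs T i"
  by (simp add: obs_sp_def space_restrict_space)

lemma space_act_sp [simp]: "space (act_sp T i) = act T i"
  by (simp add: act_sp_def space_restrict_space)

lemma prob_prior: "prob_space (prior T)" and sets_prior [measurable_cong]: "sets (prior T) = sets (state_sp T)"
  using team by (auto simp: sequential_team_def)

lemma space_prior [simp]: "space (prior T) = states T"
  using sets_eq_imp_space_eq[OF sets_prior] by simp

lemma prob_nu: "i \<in> I \<Longrightarrow> prob_space (\<nu> i)" and sets_nu: "i \<in> I \<Longrightarrow> sets (\<nu> i) = sets (obs_sp T i)"
  using dominated by (auto simp: dominated_def)

lemma space_nu: "i \<in> I \<Longrightarrow> space (\<nu> i) = obs T i"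
  using sets_eq_imp_space_eq[OF sets_nu] by simp

lemma sets_PiM_nu: "H \<subseteq> I \<Longrightarrow> sets (PiM H \<nu>) = sets (PiM H (obs_sp T))"
  by (intro sets_PiM_cong) (auto simp: sets_nu)

lemma sets_static_law: "sets (static_law T \<nu>) = sets (state_sp T \<Otimes>\<^sub>M PiM I (obs_sp T))"
  unfolding static_law_def by (intro sets_pair_measure_cong sets_prior sets_PiM_nu) simp

lemma space_static_law: "space (static_law T \<nu>) = states T \<times> obs_prod T"
  using sets_eq_imp_space_eq[OF sets_static_law] by (simp add: space_pair_measure space_PiM obs_prod_def)

lemma prob_PiM_nu: "H \<subseteq> I \<Longrightarrow> prob_space (PiM H \<nu>)"
  by (intro prob_space_PiM) (auto simp: prob_nu)

lemma prob_static_law: "prob_space (static_law T \<nu>)"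
proof -
  interpret P: pair_prob_space "prior T" "PiM I \<nu>"
    using prob_prior prob_PiM_nu[of I] by (simp add: pair_prob_space_def pair_sigma_finite_def prob_space_imp_sigma_finite)
  show ?thesis
    unfolding static_law_def by unfold_locales
qed

lemma measurable_density:
  "i \<in> I \<Longrightarrow> (\<lambda>(\<omega>, u, y). f i \<omega> u y) \<in> borel_measurable (state_sp T \<Otimes>\<^sub>M PiM {1..<i} (act_sp T) \<Otimes>\<^sub>M obs_sp T i)"
  using dominated by (auto simp: dominated_def)

lemma density_nonneg:
  "i \<in> I \<Longrightarrow> \<omega> \<in> states T \<Longrightarrow> u \<in> act_before T i \<Longrightarrow> y \<in> obs T i \<Longrightarrow> 0 \<le> f i \<omega> u y"
  using dominated by (auto simp: dominated_def)

lemma kernel_eq_density: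
  assumes "i \<in> I" "\<omega> \<in> states T" "u \<in> act_before T i"
  shows "kernel T i (\<omega>, u) = density (\<nu> i) (\<lambda>y. ennreal (f i \<omega> u y))"
proof (rule measure_eqI)
  have "kernel T i \<in> state_sp T \<Otimes>\<^sub>M PiM {1..<i} (act_sp T) \<rightarrow>\<^sub>M prob_algebra (obs_sp T i)"
    using team assms by (auto simp: sequential_team_def)
  then have "kernel T i (\<omega>, u) \<in> space (prob_algebra (obs_sp T i))"
    by (rule measurable_space) (use assms in \<open>simp add: space_pair_measure space_PiM act_before_def\<close>)
  then have sets: "sets (kernel T i (\<omega>, u)) = sets (obs_sp T i)"
    by (simp add: space_prob_algebra)
  then show "sets (kernel T i (\<omega>, u)) = sets (density (\<nu> i) (\<lambda>y. ennreal (f i \<omega> u y)))"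
    using assms by (simp add: sets_nu)
  fix S assume "S \<in> sets (kernel T i (\<omega>, u))"
  then have S: "S \<in> sets (obs_sp T i)"
    by (simp add: sets)
  have "(\<lambda>y. (\<lambda>(\<omega>, u, y). f i \<omega> u y) (\<omega>, u, y)) \<in> borel_measurable (obs_sp T i)"
    by (rule measurable_compose[OF _ measurable_density])
       (use assms in \<open>auto simp: space_PiM act_before_def\<close>)
  then have "(\<lambda>y. f i \<omega> u y) \<in> borel_measurable (\<nu> i)"
    using assms by (simp add: measurable_cong_sets[OF sets_nu refl])
  moreover have "emeasure (kernel T i (\<omega>, u)) S = (\<integral>\<^sup>+ y\<in>S. ennreal (f i \<omega> u y) \<partial>\<nu> i)"
    using dominated assms S by (auto simp: dominated_def)
  ultimately show "emeasure (kernel T i (\<omega>, u)) S = emeasure (density (\<nu> i) (\<lambda>y. ennreal (f i \<omega> u y))) S"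
    using S assms by (simp add: emeasure_density sets_nu)
qed

section \<open>Likelihood ratios and the law of the observations\<close>

definition past :: "(nat \<Rightarrow> 'y \<Rightarrow> 'u) \<Rightarrow> nat \<Rightarrow> (nat \<Rightarrow> 'y) \<Rightarrow> nat \<Rightarrow> 'u" where
  "past \<gamma> i y = (\<lambda>j\<in>{1..<i}. \<gamma> j (y j))"

text \<open>The Radon-Nikodym derivative, under the policy \<gamma>, of the law of the state and the
  first n observations with respect to the product of \<open>prior T\<close> and the first n
  reference measures.\<close>

definition weight :: "(nat \<Rightarrow> 'y \<Rightarrow> 'u) \<Rightarrow> nat \<Rightarrow> 'w \<Rightarrow> (nat \<Rightarrow> 'y) \<Rightarrow> real" where
  "weight \<gamma> n \<omega> y = (\<Prod>i\<in>{1..n}. f i \<omega> (past \<gamma> i y) (y i))"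

lemma measurable_policy: "\<gamma> \<in> policies T \<Longrightarrow> i \<in> I \<Longrightarrow> \<gamma> i \<in> obs_sp T i \<rightarrow>\<^sub>M act_sp T i"
  by (simp add: policies_def)

lemma measurable_past:
  assumes "\<gamma> \<in> policies T" "i \<le> Suc n" "n \<le> agents T"
  shows "past \<gamma> i \<in> PiM {1..n} (obs_sp T) \<rightarrow>\<^sub>M PiM {1..<i} (act_sp T)"
  unfolding past_def
proof (rule measurable_restrict)
  fix j assume "j \<in> {1..<i}"
  then show "(\<lambda>y. \<gamma> j (y j)) \<in> PiM {1..n} (obs_sp T) \<rightarrow>\<^sub>M act_sp T j"
    using assms by (intro measurable_compose[OF measurable_component_singleton[of j] measurable_policy[of \<gamma>]]) auto
qed

lemma past_in: "\<gamma> \<in> policies T \<Longrightarrow> i \<le> Suc n \<Longrightarrow> n \<le> agents T \<Longrightarrow> y \<in> PiE {1..n} (obs T)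
    \<Longrightarrow> past \<gamma> i y \<in> act_before T i"
  using measurable_space[OF measurable_past, of \<gamma> i n y] by (simp add: space_PiM act_before_def)

lemma measurable_density_past:
  assumes "\<gamma> \<in> policies T" "i \<in> {1..n}" "n \<le> agents T"
  shows "(\<lambda>x. f i (fst x) (past \<gamma> i (snd x)) (snd x i)) \<in> borel_measurable (state_sp T \<Otimes>\<^sub>M PiM {1..n} (obs_sp T))"
proof -
  have "(\<lambda>x. (\<lambda>(\<omega>, u, y). f i \<omega> u y) (fst x, past \<gamma> i (snd x), snd x i))
      \<in> borel_measurable (state_sp T \<Otimes>\<^sub>M PiM {1..n} (obs_sp T))"
    by (rule measurable_compose[OF _ measurable_density[of i]])
       (use assms in \<open>auto intro!: measurable_Pair measurable_compose[OF measurable_snd measurable_past[of \<gamma> i n]]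
          measurable_compose[OF measurable_snd measurable_component_singleton[of i]]\<close>)
  then show ?thesis
    by simp
qed

lemma measurable_weight:
  assumes "\<gamma> \<in> policies T" "n \<le> agents T"
  shows "(\<lambda>x. weight \<gamma> n (fst x) (snd x)) \<in> borel_measurable (state_sp T \<Otimes>\<^sub>M PiM {1..n} (obs_sp T))"
  unfolding weight_def using assms by (intro borel_measurable_prod measurable_density_past)

lemma weight_nonneg:
  assumes "\<gamma> \<in> policies T" "n \<le> agents T" "\<omega> \<in> states T" "y \<in> PiE {1..n} (obs T)"
  shows "0 \<le> weight \<gamma> n \<omega> y"
  unfolding weight_def using assms
  by (intro prod_nonneg ballI density_nonneg past_in[where n = n]) (auto simp: PiE_iff)

text \<open>Causality: the histories of agents 1, ..., n + 1 involve only the observations 1, ...,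
  n. An update at n + 1 therefore leaves the old factors alone and merely supplies the argument of
  the new one.\<close>

lemma weight_Suc:
  "weight \<gamma> (Suc n) \<omega> (y(Suc n := z)) = weight \<gamma> n \<omega> y * f (Suc n) \<omega> (past \<gamma> (Suc n) y) z"
proof -
  have past: "past \<gamma> i (y(Suc n := z)) = past \<gamma> i y" if "i \<le> Suc n" for i
    using that by (auto simp: past_def)
  show ?thesis
    unfolding weight_def by (auto simp: past intro!: prod.cong)
qed

lemma measurable_joint_step:
  assumes "\<gamma> \<in> policies T" "Suc n \<le> agents T"
  shows "(\<lambda>(\<omega>, y). distr (kernel T (Suc n) (\<omega>, \<lambda>j\<in>{1..<Suc n}. \<gamma> j (y j)))
      (state_sp T \<Otimes>\<^sub>M PiM {1..Suc n} (obs_sp T)) (\<lambda>z. (\<omega>, y(Suc n := z))))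
    \<in> state_sp T \<Otimes>\<^sub>M PiM {1..n} (obs_sp T) \<rightarrow>\<^sub>M
      subprob_algebra (state_sp T \<Otimes>\<^sub>M PiM {1..Suc n} (obs_sp T))"
proof -
  let ?L = "state_sp T \<Otimes>\<^sub>M PiM {1..n} (obs_sp T)"
  have ins: "{1..Suc n} = insert (Suc n) {1..n}"
    by auto
  have "kernel T (Suc n) \<in> state_sp T \<Otimes>\<^sub>M PiM {1..<Suc n} (act_sp T) \<rightarrow>\<^sub>M prob_algebra (obs_sp T (Suc n))"
    using team assms by (auto simp: sequential_team_def)
  moreover have "(\<lambda>x. (fst x, past \<gamma> (Suc n) (snd x))) \<in> ?L \<rightarrow>\<^sub>M state_sp T \<Otimes>\<^sub>M PiM {1..<Suc n} (act_sp T)"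
    using assms by (intro measurable_Pair measurable_fst measurable_compose[OF measurable_snd measurable_past]) auto
  ultimately have k: "(\<lambda>x. kernel T (Suc n) (fst x, past \<gamma> (Suc n) (snd x))) \<in> ?L \<rightarrow>\<^sub>M subprob_algebra (obs_sp T (Suc n))"
    by (intro measurable_compose[OF _ measurable_prob_algebraD[where f = "kernel T (Suc n)"]])
  have u: "case_prod (\<lambda>x z. (fst x, (snd x)(Suc n := z)))
      \<in> ?L \<Otimes>\<^sub>M obs_sp T (Suc n) \<rightarrow>\<^sub>M state_sp T \<Otimes>\<^sub>M PiM {1..Suc n} (obs_sp T)"
    unfolding ins split_beta' by (intro measurable_Pair measurable_fun_upd) measurable
  have "(\<lambda>x. distr (kernel T (Suc n) (fst x, past \<gamma> (Suc n) (snd x)))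
      (state_sp T \<Otimes>\<^sub>M PiM {1..Suc n} (obs_sp T)) (\<lambda>z. (fst x, (snd x)(Suc n := z))))
      \<in> ?L \<rightarrow>\<^sub>M subprob_algebra (state_sp T \<Otimes>\<^sub>M PiM {1..Suc n} (obs_sp T))"
    by (rule measurable_distr2[OF u k])
  then show ?thesis
    by (simp add: split_beta' past_def)
qed

lemma product_prob_nu:
  "product_prob_space (\<lambda>i. if i \<in> I then \<nu> i else return (count_space UNIV) undefined)"
  by (intro product_prob_spaceI) (auto simp: prob_nu prob_space_return)

lemma nn_integral_PiM_nu_Suc:
  assumes n: "Suc n \<le> agents T" and g: "g \<in> borel_measurable (PiM {1..Suc n} (obs_sp T))"
  shows "(\<integral>\<^sup>+ y. g y \<partial>PiM {1..Suc n} \<nu>) = (\<integral>\<^sup>+ y. \<integral>\<^sup>+ z. g (y(Suc n := z)) \<partial>\<nu> (Suc n) \<partial>PiM {1..n} \<nu>)"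
proof -
  define \<nu>' where "\<nu>' i = (if i \<in> I then \<nu> i else return (count_space UNIV) undefined)" for i
  have eq: "PiM H \<nu>' = PiM H \<nu>" if "H \<subseteq> I" for H
    using that by (intro PiM_cong refl) (auto simp: \<nu>'_def dest: subsetD simp del: atLeastAtMost_iff)
  interpret product_prob_space \<nu>'
    unfolding \<nu>'_def by (rule product_prob_nu)
  have ins: "{1..Suc n} = insert (Suc n) {1..n}"
    by auto
  have "g \<in> borel_measurable (PiM {1..Suc n} \<nu>')"
    using g n by (simp add: eq measurable_cong_sets[OF sets_PiM_nu refl])
  then have "(\<integral>\<^sup>+ y. g y \<partial>PiM {1..Suc n} \<nu>') = (\<integral>\<^sup>+ y. \<integral>\<^sup>+ z. g (y(Suc n := z)) \<partial>\<nu>' (Suc n) \<partial>PiM {1..n} \<nu>')"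
    unfolding ins by (intro product_nn_integral_insert) auto
  then show ?thesis
    using n by (simp add: eq \<nu>'_def)
qed

text \<open>Each step of \<open>joint_law\<close> samples from a kernel that is a density with
  respect to the reference measure, and this density becomes the next factor of the weight. The
  sigma-algebra is carried along in the induction, because integrals against a bind can be evaluated
  only once the measurable structure of the previous law is known.\<close>

lemma joint_law_nn_integral:
  assumes \<gamma>: "\<gamma> \<in> policies T"
  shows "n \<le> agents T \<Longrightarrow>
    sets (joint_law T \<gamma> n) = sets (state_sp T \<Otimes>\<^sub>M PiM {1..n} (obs_sp T)) \<and>
    (\<forall>g \<in> borel_measurable (state_sp T \<Otimes>\<^sub>M PiM {1..n} (obs_sp T)).
      (\<integral>\<^sup>+ x. g x \<partial>joint_law T \<gamma> n) =
      (\<integral>\<^sup>+ x. g x * ennreal (weight \<gamma> n (fst x) (snd x)) \<partial>(prior T \<Otimes>\<^sub>M PiM {1..n} \<nu>)))"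
proof (induction n)
  case 0
  interpret prior: prob_space "prior T"
    by (rule prob_prior)
  interpret E: sigma_finite_measure "PiM {} \<nu>"
    using prob_PiM_nu[of "{}"] by (simp add: prob_space_imp_sigma_finite)
  have [measurable]: "(\<lambda>\<omega>. (\<omega>, \<lambda>_. undefined)) \<in> prior T \<rightarrow>\<^sub>M state_sp T \<Otimes>\<^sub>M PiM {} (obs_sp T)"
    by (intro measurable_Pair) (auto simp: measurable_ident_sets sets_prior space_PiM)
  have "(\<integral>\<^sup>+ x. g x \<partial>joint_law T \<gamma> 0) =
      (\<integral>\<^sup>+ x. g x * ennreal (weight \<gamma> 0 (fst x) (snd x)) \<partial>(prior T \<Otimes>\<^sub>M PiM {1..0} \<nu>))"
    if g: "g \<in> borel_measurable (state_sp T \<Otimes>\<^sub>M PiM {1..0} (obs_sp T))" for g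
  proof -
    have "g \<in> borel_measurable (prior T \<Otimes>\<^sub>M PiM {} \<nu>)"
      using g by (simp add: measurable_cong_sets[OF sets_pair_measure_cong[OF sets_prior sets_PiM_nu] refl])
    then show ?thesis
      using g by (simp add: nn_integral_distr weight_def E.nn_integral_fst[symmetric])
         (simp add: PiM_empty nn_integral_count_space_finite)
  qed
  then show ?case
    by simp
next
  case (Suc n)
  let ?L = "state_sp T \<Otimes>\<^sub>M PiM {1..n} (obs_sp T)"
  let ?L' = "state_sp T \<Otimes>\<^sub>M PiM {1..Suc n} (obs_sp T)"
  have n: "Suc n \<le> agents T" "n \<le> agents T"
    using Suc.prems by auto
  note IH = Suc.IH[OF n(2)]
  have sets: "sets (joint_law T \<gamma> n) = sets ?L"
    using IH by blast
  have space: "space (joint_law T \<gamma> n) = states T \<times> PiE {1..n} (obs T)"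
    using sets_eq_imp_space_eq[OF sets] by (simp add: space_pair_measure space_PiM)
  have step: "(\<lambda>(\<omega>, y). distr (kernel T (Suc n) (\<omega>, \<lambda>j\<in>{1..<Suc n}. \<gamma> j (y j))) ?L' (\<lambda>z. (\<omega>, y(Suc n := z))))
    \<in> joint_law T \<gamma> n \<rightarrow>\<^sub>M subprob_algebra ?L'"
    using measurable_joint_step[OF \<gamma> n(1)] unfolding measurable_cong_sets[OF sets refl] .
  interpret prior: prob_space "prior T"
    by (rule prob_prior)
  interpret E: prob_space "PiM {1..n} \<nu>"
    using n by (intro prob_PiM_nu) auto
  interpret E': prob_space "PiM {1..Suc n} \<nu>"
    using n by (intro prob_PiM_nu) auto
  interpret nu: prob_space "\<nu> (Suc n)"
    using n by (intro prob_nu) auto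
  \<comment> \<open>The sigma-algebra of a bind is read off from the values of its kernel, so there
    must be at least one point at which to evaluate it.\<close>
  have ne: "space (joint_law T \<gamma> n) \<noteq> {}"
    using prior.not_empty E.not_empty n sets_eq_imp_space_eq[OF sets_PiM_nu[of "{1..n}"]]
    by (auto simp: space space_PiM)
  have ins: "{1..Suc n} = insert (Suc n) {1..n}"
    by auto
  have upd: "(\<lambda>z. (\<omega>, y(Suc n := z))) \<in> obs_sp T (Suc n) \<rightarrow>\<^sub>M ?L'"
    if "\<omega> \<in> states T" "y \<in> PiE {1..n} (obs T)" for \<omega> y
    unfolding ins using that
    by (intro measurable_Pair measurable_fun_upd[where J = "{1..n}"]) (auto simp: space_PiM)
  have "(\<integral>\<^sup>+ x. g x \<partial>joint_law T \<gamma> (Suc n)) =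
      (\<integral>\<^sup>+ x. g x * ennreal (weight \<gamma> (Suc n) (fst x) (snd x)) \<partial>(prior T \<Otimes>\<^sub>M PiM {1..Suc n} \<nu>))"
    if g: "g \<in> borel_measurable ?L'" for g
  proof -
    note [measurable] = g
    \<comment> \<open>\<open>G\<close> integrates out the newest observation against its density
      with the past held fixed, so that the induction hypothesis for n observations applies to
      it.\<close>
    define G where "G x = (\<integral>\<^sup>+ z. g (fst x, (snd x)(Suc n := z)) *
        ennreal (f (Suc n) (fst x) (past \<gamma> (Suc n) (snd x)) z) \<partial>\<nu> (Suc n))" for x
    have gu: "(\<lambda>x. g (fst (fst x), (snd (fst x))(Suc n := snd x))) \<in> borel_measurable (?L \<Otimes>\<^sub>M obs_sp T (Suc n))"
      unfolding ins by (intro measurable_compose[OF _ g[unfolded ins]] measurable_Pair measurable_fun_upd[where J = "{1..n}"]) measurable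
    have fu: "(\<lambda>x. f (Suc n) (fst (fst x)) (past \<gamma> (Suc n) (snd (fst x))) (snd x)) \<in> borel_measurable (?L \<Otimes>\<^sub>M obs_sp T (Suc n))"
    proof -
      have "(\<lambda>x. (\<lambda>(\<omega>, u, y). f (Suc n) \<omega> u y) (fst (fst x), past \<gamma> (Suc n) (snd (fst x)), snd x))
          \<in> borel_measurable (?L \<Otimes>\<^sub>M obs_sp T (Suc n))"
        by (rule measurable_compose[OF _ measurable_density])
           (use n \<gamma> in \<open>auto intro!: measurable_Pair measurable_snd measurable_compose[OF measurable_fst measurable_fst] 
             measurable_compose[OF measurable_compose[OF measurable_fst measurable_snd] measurable_past[where n = n]]\<close>)
      then show ?thesis
        by simp
    qed
    have "(\<lambda>x. g (fst (fst x), (snd (fst x))(Suc n := snd x)) *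
        ennreal (f (Suc n) (fst (fst x)) (past \<gamma> (Suc n) (snd (fst x))) (snd x)))
        \<in> borel_measurable (?L \<Otimes>\<^sub>M \<nu> (Suc n))"
      using gu fu n unfolding measurable_cong_sets[OF sets_pair_measure_cong[OF refl sets_nu[of "Suc n"]] refl]
      by (subst measurable_cong_sets[OF sets_pair_measure_cong[OF refl sets_nu[of "Suc n"]] refl]) auto
    from nu.borel_measurable_nn_integral_fst[OF this]
    have G: "G \<in> borel_measurable ?L"
      by (simp add: G_def[abs_def])
    have inner: "(\<integral>\<^sup>+ x'. g x' \<partial>distr (kernel T (Suc n) (\<omega>, \<lambda>j\<in>{1..<Suc n}. \<gamma> j (y j))) ?L' (\<lambda>z. (\<omega>, y(Suc n := z)))) = G (\<omega>, y)"
      if \<omega>: "\<omega> \<in> states T" and y: "y \<in> PiE {1..n} (obs T)" for \<omega> y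
    proof -
      have u: "past \<gamma> (Suc n) y \<in> act_before T (Suc n)"
        using past_in[OF \<gamma> _ n(2) y] by simp
      have k: "kernel T (Suc n) (\<omega>, \<lambda>j\<in>{1..<Suc n}. \<gamma> j (y j)) =
          density (\<nu> (Suc n)) (\<lambda>z. ennreal (f (Suc n) \<omega> (past \<gamma> (Suc n) y) z))"
        using kernel_eq_density[OF _ \<omega> u] n by (simp add: past_def)
      have up: "(\<lambda>z. (\<omega>, y(Suc n := z))) \<in> \<nu> (Suc n) \<rightarrow>\<^sub>M ?L'"
        using upd[OF \<omega> y] n by (subst measurable_cong_sets[OF sets_nu refl]) auto
      have xy: "(\<omega>, y) \<in> space ?L"
        using \<omega> y by (simp add: space_pair_measure space_PiM)
      have "(\<lambda>z. f (Suc n) \<omega> (past \<gamma> (Suc n) y) z) \<in> borel_measurable (obs_sp T (Suc n))"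
        using measurable_compose[OF measurable_Pair1'[OF xy] fu] by simp
      then have fm: "(\<lambda>z. f (Suc n) \<omega> (past \<gamma> (Suc n) y) z) \<in> borel_measurable (\<nu> (Suc n))"
        using n by (subst measurable_cong_sets[OF sets_nu refl]) auto
      show ?thesis
        unfolding k G_def using up fm g
        by (subst nn_integral_distr) (auto simp: nn_integral_density mult.commute)
    qed
    have "(\<integral>\<^sup>+ x. g x \<partial>joint_law T \<gamma> (Suc n)) = (\<integral>\<^sup>+ x. G x \<partial>joint_law T \<gamma> n)"
      unfolding joint_law.simps
      by (subst nn_integral_bind[OF g step], rule nn_integral_cong) (auto simp: space inner split_beta')
    also have "\<dots> = (\<integral>\<^sup>+ x. G x * ennreal (weight \<gamma> n (fst x) (snd x)) \<partial>(prior T \<Otimes>\<^sub>M PiM {1..n} \<nu>))"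
      using IH G by blast
    also have "\<dots> = (\<integral>\<^sup>+ \<omega>. \<integral>\<^sup>+ y. G (\<omega>, y) * ennreal (weight \<gamma> n \<omega> y) \<partial>PiM {1..n} \<nu> \<partial>prior T)"
    proof -
      have "(\<lambda>x. G x * ennreal (weight \<gamma> n (fst x) (snd x))) \<in> borel_measurable (prior T \<Otimes>\<^sub>M PiM {1..n} \<nu>)"
        using G measurable_weight[OF \<gamma> n(2)] n
        by (subst measurable_cong_sets[OF sets_pair_measure_cong[OF sets_prior sets_PiM_nu] refl]) auto
      then show ?thesis
        by (simp add: E.nn_integral_fst[symmetric])
    qed
    \<comment> \<open>Fubini in the new coordinate, for each fixed state: by
      \<open>weight_Suc\<close> the old weight times the new density is the new weight.\<close>
    also have "\<dots> = (\<integral>\<^sup>+ \<omega>. \<integral>\<^sup>+ y. g (\<omega>, y) * ennreal (weight \<gamma> (Suc n) \<omega> y) \<partial>PiM {1..Suc n} \<nu> \<partial>prior T)"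
    proof (rule nn_integral_cong)
      fix \<omega> assume "\<omega> \<in> space (prior T)"
      then have \<omega>: "\<omega> \<in> states T"
        by simp
      have gw: "(\<lambda>y. g (\<omega>, y) * ennreal (weight \<gamma> (Suc n) \<omega> y)) \<in> borel_measurable (PiM {1..Suc n} (obs_sp T))"
      proof -
        have p: "Pair \<omega> \<in> PiM {1..Suc n} (obs_sp T) \<rightarrow>\<^sub>M ?L'"
          using \<omega> by (intro measurable_Pair1') simp
        show ?thesis
          using measurable_compose[OF p g] measurable_compose[OF p measurable_weight[OF \<gamma> n(1)]] by auto
      qed
      have "G (\<omega>, y) * ennreal (weight \<gamma> n \<omega> y) =
          (\<integral>\<^sup>+ z. g (\<omega>, y(Suc n := z)) * ennreal (weight \<gamma> (Suc n) \<omega> (y(Suc n := z))) \<partial>\<nu> (Suc n))"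
        if "y \<in> space (PiM {1..n} \<nu>)" for y
      proof -
        have y: "y \<in> PiE {1..n} (obs T)"
          using that n sets_eq_imp_space_eq[OF sets_PiM_nu[of "{1..n}"]] by (simp add: space_PiM)
        have xy: "(\<omega>, y) \<in> space ?L"
          using \<omega> y by (simp add: space_pair_measure space_PiM)
        have m: "(\<lambda>z. g (\<omega>, y(Suc n := z)) * ennreal (f (Suc n) \<omega> (past \<gamma> (Suc n) y) z)) \<in> borel_measurable (\<nu> (Suc n))"
          using measurable_compose[OF measurable_Pair1'[OF xy] fu] measurable_compose[OF measurable_Pair1'[OF xy] gu] n
          by (subst measurable_cong_sets[OF sets_nu refl]) auto
        have "weight \<gamma> n \<omega> y \<ge> 0"
          by (rule weight_nonneg[OF \<gamma> n(2) \<omega> y])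
        moreover have "G (\<omega>, y) * ennreal (weight \<gamma> n \<omega> y) = (\<integral>\<^sup>+ z. g (\<omega>, y(Suc n := z)) *
            ennreal (f (Suc n) \<omega> (past \<gamma> (Suc n) y) z) * ennreal (weight \<gamma> n \<omega> y) \<partial>\<nu> (Suc n))"
          unfolding G_def by (simp add: nn_integral_multc[OF m])
        ultimately show ?thesis
          by (simp add: weight_Suc ennreal_mult' mult_ac)
      qed
      then show "(\<integral>\<^sup>+ y. G (\<omega>, y) * ennreal (weight \<gamma> n \<omega> y) \<partial>PiM {1..n} \<nu>) =
          (\<integral>\<^sup>+ y. g (\<omega>, y) * ennreal (weight \<gamma> (Suc n) \<omega> y) \<partial>PiM {1..Suc n} \<nu>)"
        unfolding nn_integral_PiM_nu_Suc[OF n(1) gw] by (intro nn_integral_cong) auto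
    qed
    also have "\<dots> = (\<integral>\<^sup>+ x. g x * ennreal (weight \<gamma> (Suc n) (fst x) (snd x)) \<partial>(prior T \<Otimes>\<^sub>M PiM {1..Suc n} \<nu>))"
    proof -
      have "(\<lambda>x. g x * ennreal (weight \<gamma> (Suc n) (fst x) (snd x))) \<in> borel_measurable (prior T \<Otimes>\<^sub>M PiM {1..Suc n} \<nu>)"
        using g measurable_weight[OF \<gamma> n(1)] n
        by (subst measurable_cong_sets[OF sets_pair_measure_cong[OF sets_prior sets_PiM_nu] refl]) auto
      then show ?thesis
        by (simp add: E'.nn_integral_fst[symmetric])
    qed
    finally show ?thesis .
  qed
  moreover have "sets (joint_law T \<gamma> (Suc n)) = sets ?L'"
    unfolding joint_law.simps by (rule sets_bind_measurable[OF step ne])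
  ultimately show ?case
    by blast
qed

section \<open>The static cost: measurability, the reduction identity, continuity\<close>

abbreviation "SO \<equiv> state_sp T \<Otimes>\<^sub>M PiM I (obs_sp T)"

definition cost_measurable :: "('w \<Rightarrow> (nat \<Rightarrow> 'y) \<Rightarrow> (nat \<Rightarrow> 'u) \<Rightarrow> real) \<Rightarrow> bool" where
  "cost_measurable c \<longleftrightarrow> (\<lambda>(\<omega>, y, u). c \<omega> y u) \<in> borel_measurable
     (state_sp T \<Otimes>\<^sub>M PiM I (obs_sp T) \<Otimes>\<^sub>M PiM I (act_sp T))"

lemma cost_measurable_cost: "cost_measurable (cost T)"
  using team by (simp add: cost_measurable_def sequential_team_def)

lemma cost_nonneg: "\<omega> \<in> states T \<Longrightarrow> y \<in> obs_prod T \<Longrightarrow> u \<in> act_prod T \<Longrightarrow> 0 \<le> cost T \<omega> y u"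
  using team by (simp add: sequential_team_def)

lemma restrict_act_prod: "i \<in> I \<Longrightarrow> u \<in> act_prod T \<Longrightarrow> restrict u {1..<i} \<in> act_before T i"
  by (auto simp: act_prod_def act_before_def PiE_iff)

lemma static_cost_nonneg:
  assumes "\<omega> \<in> states T" "y \<in> obs_prod T" "u \<in> act_prod T"
  shows "0 \<le> static_cost T f \<omega> y u"
  unfolding static_cost_def using assms
  by (intro mult_nonneg_nonneg cost_nonneg prod_nonneg ballI density_nonneg restrict_act_prod)
     (auto simp: obs_prod_def PiE_iff)

lemma cost_measurable_static: "cost_measurable (static_cost T f)"
proof -
  let ?M = "state_sp T \<Otimes>\<^sub>M PiM I (obs_sp T) \<Otimes>\<^sub>M PiM I (act_sp T)"
  have "(\<lambda>x. (\<lambda>(\<omega>, u, y). f i \<omega> u y) (fst x, restrict (snd (snd x)) {1..<i}, fst (snd x) i)) \<in> borel_measurable ?M"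
    if i: "i \<in> I" for i
    using i by (intro measurable_compose[OF _ measurable_density[of i]] measurable_Pair measurable_fst
        measurable_compose[OF measurable_compose[OF measurable_snd measurable_snd] measurable_restrict_subset]
        measurable_compose[OF measurable_compose[OF measurable_snd measurable_fst] measurable_component_singleton]) auto
  then have "(\<lambda>x. \<Prod>i\<in>I. f i (fst x) (restrict (snd (snd x)) {1..<i}) (fst (snd x) i)) \<in> borel_measurable ?M"
    by (intro borel_measurable_prod) simp
  then show ?thesis
    using cost_measurable_cost by (simp add: cost_measurable_def static_cost_def split_beta')
qed

lemma measurable_apply_policy:
  assumes "\<gamma> \<in> policies T"
  shows "apply_policy T \<gamma> \<in> PiM I (obs_sp T) \<rightarrow>\<^sub>M PiM I (act_sp T)"
  unfolding apply_policy_def[abs_def]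
proof (rule measurable_restrict)
  fix i assume "i \<in> I"
  then show "(\<lambda>y. \<gamma> i (y i)) \<in> PiM I (obs_sp T) \<rightarrow>\<^sub>M act_sp T i"
    using assms by (intro measurable_compose[OF measurable_component_singleton[of i] measurable_policy[of \<gamma>]])
qed

lemma apply_policy_in: "\<gamma> \<in> policies T \<Longrightarrow> y \<in> obs_prod T \<Longrightarrow> apply_policy T \<gamma> y \<in> act_prod T"
  using measurable_space[OF measurable_apply_policy, of \<gamma> y] by (simp add: space_PiM obs_prod_def act_prod_def)

lemma measurable_cost_policy:
  assumes "cost_measurable c" "\<gamma> \<in> policies T"
  shows "(\<lambda>x. c (fst x) (snd x) (apply_policy T \<gamma> (snd x))) \<in> borel_measurable SO"
proof -
  have "(\<lambda>x. (\<lambda>(\<omega>, y, u). c \<omega> y u) (fst x, snd x, apply_policy T \<gamma> (snd x))) \<in> borel_measurable SO"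
    by (rule measurable_compose[OF _ assms(1)[unfolded cost_measurable_def]])
       (auto intro!: measurable_Pair measurable_compose[OF measurable_snd measurable_apply_policy] assms(2))
  then show ?thesis
    by simp
qed

lemma measurable_static: "g \<in> SO \<rightarrow>\<^sub>M N \<Longrightarrow> g \<in> static_law T \<nu> \<rightarrow>\<^sub>M N"
  by (simp add: measurable_cong_sets[OF sets_static_law refl])

text \<open>The full likelihood ratio is moved from the law into the cost. It is the product in
  \<open>static_cost\<close>, because the joint action restricted to the agents before i is the
  history \<open>past\<close>. The identity is about measurable policies, so a policy of a finite
  model must first be shown to induce a member of \<open>policies T\<close>.\<close>

lemma J_eq_static:
  assumes \<gamma>: "\<gamma> \<in> policies T"
  shows "J T \<gamma> = expected_cost T (static_law T \<nu>) (static_cost T f) \<gamma>"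
proof -
  have "J T \<gamma> = (\<integral>\<^sup>+ x. ennreal (cost T (fst x) (snd x) (apply_policy T \<gamma> (snd x))) \<partial>joint_law T \<gamma> (agents T))"
    by (simp add: J_def expected_cost_def split_beta')
  also have "\<dots> = (\<integral>\<^sup>+ x. ennreal (cost T (fst x) (snd x) (apply_policy T \<gamma> (snd x)))
      * ennreal (weight \<gamma> (agents T) (fst x) (snd x)) \<partial>static_law T \<nu>)"
    using joint_law_nn_integral[OF \<gamma> order_refl] measurable_cost_policy[OF cost_measurable_cost \<gamma>]
    unfolding static_law_def by auto
  also have "\<dots> = (\<integral>\<^sup>+ x. ennreal (static_cost T f (fst x) (snd x) (apply_policy T \<gamma> (snd x))) \<partial>static_law T \<nu>)"
  proof (rule nn_integral_cong)
    fix x assume "x \<in> space (static_law T \<nu>)"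
    then have x: "fst x \<in> states T" "snd x \<in> obs_prod T"
      by (auto simp: space_static_law)
    have "restrict (apply_policy T \<gamma> y) {1..<i} = past \<gamma> i y" if "i \<in> I" for i y
      using that by (auto simp: apply_policy_def past_def)
    then have "static_cost T f (fst x) (snd x) (apply_policy T \<gamma> (snd x)) =
        cost T (fst x) (snd x) (apply_policy T \<gamma> (snd x)) * weight \<gamma> (agents T) (fst x) (snd x)"
      unfolding static_cost_def weight_def by (intro arg_cong2[where f = times] refl prod.cong) auto
    then show "ennreal (cost T (fst x) (snd x) (apply_policy T \<gamma> (snd x)))
      * ennreal (weight \<gamma> (agents T) (fst x) (snd x)) =
      ennreal (static_cost T f (fst x) (snd x) (apply_policy T \<gamma> (snd x)))"
      using cost_nonneg[OF x apply_policy_in[OF \<gamma> x(2)]] by (simp add: ennreal_mult')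
  qed
  finally show ?thesis
    by (simp add: expected_cost_def split_beta')
qed

lemma finite_constant_deviations_static:
  assumes "finite_constant_deviations T (J T)"
  shows "finite_constant_deviations T (expected_cost T (static_law T \<nu>) (static_cost T f))"
  unfolding finite_constant_deviations_def
proof (intro ballI impI)
  fix \<gamma> i assume \<gamma>: "\<gamma> \<in> policies T" "expected_cost T (static_law T \<nu>) (static_cost T f) \<gamma> < \<infinity>" and i: "i \<in> I"
  then obtain u where u: "u \<in> act T i" "J T (\<gamma>(i := (\<lambda>_. u))) < \<infinity>"
    using assms J_eq_static[OF \<gamma>(1)] unfolding finite_constant_deviations_def by force
  moreover have "\<gamma>(i := (\<lambda>_. u)) \<in> policies T"
    using \<gamma>(1) u(1) by (auto simp: policies_def)
  ultimately show "\<exists>u\<in>act T i. expected_cost T (static_law T \<nu>) (static_cost T f) (\<gamma>(i := (\<lambda>_. u))) < \<infinity>"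
    using J_eq_static by metis
qed

lemma cost_continuous_static:
  assumes c: "cost_continuous T (cost T)" and d: "densities_continuous T f"
  shows "cost_continuous T (static_cost T f)"
  unfolding cost_continuous_def
proof
  fix \<omega> assume \<omega>: "\<omega> \<in> states T"
  have "continuous_on (obs_prod T \<times> act_prod T) (\<lambda>p. (\<lambda>(u, y). f i \<omega> u y) (restrict (snd p) {1..<i}, fst p i))"
    if i: "i \<in> I" for i
  proof (rule continuous_on_compose2[where g = "\<lambda>(u, y). f i \<omega> u y"])
    show "continuous_on (act_before T i \<times> obs T i) (\<lambda>(u, y). f i \<omega> u y)"
      using d i \<omega> by (simp add: densities_continuous_def)
    have "continuous_on (obs_prod T \<times> act_prod T) (\<lambda>p. restrict (snd p) {1..<i})"
    proof (rule continuous_on_coordinatewise_then_product)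
      fix j
      show "continuous_on (obs_prod T \<times> act_prod T) (\<lambda>p. restrict (snd p) {1..<i} j)"
        by (cases "j \<in> {1..<i}") (simp_all add: continuous_on_product_then_coordinatewise[OF continuous_on_snd[OF continuous_on_id]]
            del: atLeastLessThan_iff)
    qed
    moreover have "continuous_on (obs_prod T \<times> act_prod T) (\<lambda>p. fst p i)"
      by (rule continuous_on_product_then_coordinatewise[OF continuous_on_fst[OF continuous_on_id]])
    ultimately show "continuous_on (obs_prod T \<times> act_prod T) (\<lambda>p. (restrict (snd p) {1..<i}, fst p i))"
      by (rule continuous_on_Pair)
    show "(\<lambda>p. (restrict (snd p) {1..<i}, fst p i)) ` (obs_prod T \<times> act_prod T) \<subseteq> act_before T i \<times> obs T i"
      using restrict_act_prod[OF i] i by (auto simp: obs_prod_def PiE_iff)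
  qed
  then have "continuous_on (obs_prod T \<times> act_prod T) (\<lambda>p. \<Prod>i\<in>I. f i \<omega> (restrict (snd p) {1..<i}) (fst p i))"
    by (intro continuous_on_prod) simp
  then show "continuous_on (obs_prod T \<times> act_prod T) (\<lambda>(y, u). static_cost T f \<omega> y u)"
    using c \<omega> by (auto simp: cost_continuous_def static_cost_def split_beta' intro!: continuous_on_mult)
qed

text \<open>Bounds for the densities over \<open>C\<close> are assumed: continuity in the actions
  and the observation for each fixed state gives no bound that is uniform over a compact set of
  states.\<close>

lemma bounded_static_cost:
  assumes "bounded ((\<lambda>(\<omega>, y, u). cost T \<omega> y u) ` C)"
    and "\<And>i. i \<in> I \<Longrightarrow> bounded ((\<lambda>(\<omega>, y, u). f i \<omega> (restrict u {1..<i}) (y i)) ` C)"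
  shows "bounded ((\<lambda>(\<omega>, y, u). static_cost T f \<omega> y u) ` C)"
proof -
  obtain b where b: "\<And>\<omega> y u. (\<omega>, y, u) \<in> C \<Longrightarrow> \<bar>cost T \<omega> y u\<bar> \<le> b"
    using assms(1) by (force simp: bounded_iff)
  have "\<exists>B. \<forall>x\<in>C. \<bar>(\<lambda>(\<omega>, y, u). f i \<omega> (restrict u {1..<i}) (y i)) x\<bar> \<le> B" if "i \<in> I" for i
    using assms(2)[OF that] by (force simp: bounded_iff)
  then obtain B where B: "\<And>i \<omega> y u. i \<in> I \<Longrightarrow> (\<omega>, y, u) \<in> C \<Longrightarrow> \<bar>f i \<omega> (restrict u {1..<i}) (y i)\<bar> \<le> B i"
    by (metis (no_types, lifting) case_prod_conv)
  have "\<bar>static_cost T f \<omega> y u\<bar> \<le> b * (\<Prod>i\<in>I. B i)" if C: "(\<omega>, y, u) \<in> C" for \<omega> y u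
  proof -
    have "0 \<le> b"
      using b[OF C] by linarith
    then show ?thesis
      unfolding static_cost_def abs_mult abs_prod using b[OF C] B C
      by (intro mult_mono prod_mono) (auto intro!: prod_nonneg)
  qed
  then show ?thesis
    unfolding bounded_iff by (intro exI[of _ "b * (\<Prod>i\<in>I. B i)"]) auto
qed

text \<open>By continuity in the action, the supremum over the uncountable \<open>G\<close> is
  already attained in the limit along a countable dense subset, chosen componentwise inside the sets
  \<open>B i\<close> so that it stays in \<open>G\<close>.\<close>

lemma measurable_sup_cost:
  assumes cm: "cost_measurable c" and cc: "cost_continuous T c" and G: "compact_box T G"
  shows "sup_cost c G \<in> borel_measurable SO"
proof -
  obtain B where B: "\<And>i. i \<in> I \<Longrightarrow> compact (B i)" "\<And>i. i \<in> I \<Longrightarrow> B i \<subseteq> act T i" and GB: "G = PiE I B"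
    using G unfolding compact_box_def by blast
  have "\<exists>D. countable D \<and> D \<subseteq> B i \<and> B i \<subseteq> closure D" if "i \<in> I" for i
    using compact_countable_dense B(1) that by blast
  then obtain D where D: "\<And>i. i \<in> I \<Longrightarrow> countable (D i)" "\<And>i. i \<in> I \<Longrightarrow> D i \<subseteq> B i" "\<And>i. i \<in> I \<Longrightarrow> B i \<subseteq> closure (D i)"
    by metis
  have cD: "countable (PiE I D)"
    using D(1) by (intro countable_PiE) auto
  have DG: "PiE I D \<subseteq> G" and GA: "G \<subseteq> act_prod T"
    using D(2) B(2) unfolding GB act_prod_def by (intro PiE_mono; blast)+
  have "(\<lambda>x. SUP u\<in>PiE I D. ennreal (c (fst x) (snd x) u)) \<in> borel_measurable SO"
  proof (rule borel_measurable_SUP[OF cD])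
    fix u assume "u \<in> PiE I D"
    then have "u \<in> space (PiM I (act_sp T))"
      using DG GA by (auto simp: space_PiM act_prod_def)
    then have "(\<lambda>x. (\<lambda>(\<omega>, y, u). c \<omega> y u) (fst x, snd x, u)) \<in> borel_measurable SO"
      by (intro measurable_compose[OF _ cm[unfolded cost_measurable_def]]) (auto intro!: measurable_Pair)
    then show "(\<lambda>x. ennreal (c (fst x) (snd x) u)) \<in> borel_measurable SO"
      by simp
  qed
  moreover have "sup_cost c G x = (SUP u\<in>PiE I D. ennreal (c (fst x) (snd x) u))" if "x \<in> space SO" for x
  proof -
    have x: "fst x \<in> states T" "snd x \<in> obs_prod T"
      using that by (auto simp: space_pair_measure space_PiM obs_prod_def)
    have "ennreal (c (fst x) (snd x) u) \<le> (SUP u\<in>PiE I D. ennreal (c (fst x) (snd x) u))" if u: "u \<in> G" for u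
    proof -
      have "\<exists>s. (\<forall>n::nat. s n \<in> D i) \<and> s \<longlonglongrightarrow> u i" if "i \<in> I" for i
        using D(3)[OF that] u that by (auto simp: GB closure_sequential[symmetric])
      then obtain s where s: "\<And>i n::nat. i \<in> I \<Longrightarrow> s i n \<in> D i" "\<And>i. i \<in> I \<Longrightarrow> s i \<longlonglongrightarrow> u i"
        by metis
      \<comment> \<open>The approximants are cut down to \<open>I\<close> to make them extensional.
        Outside \<open>I\<close> they then agree with \<open>u\<close>, which is undefined there
        too, so convergence has to be checked only at the agents.\<close>
      define v where "v n = (\<lambda>i\<in>I. s i n)" for n
      have v: "v n \<in> PiE I D" for n
        using s by (auto simp: v_def)
      have "v \<longlonglongrightarrow> u"
        unfolding tendsto_fun_iff
      proof
        fix i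
        show "(\<lambda>n. v n i) \<longlonglongrightarrow> u i"
        proof (cases "i \<in> I")
          case True
          then show ?thesis
            using s(2)[OF True] by (simp add: v_def)
        next
          case False
          then have "v n i = u i" for n
            using u PiE_arb[of u I B i] unfolding v_def GB restrict_def by metis
          then show ?thesis
            by simp
        qed
      qed
      then have lim: "(\<lambda>n. (snd x, v n)) \<longlonglongrightarrow> (snd x, u)"
        by (intro tendsto_Pair tendsto_const)
      have cont: "continuous_on (obs_prod T \<times> act_prod T) (\<lambda>(y, u). c (fst x) y u)"
        using cc x(1) by (simp add: cost_continuous_def)
      have "(snd x, u) \<in> obs_prod T \<times> act_prod T" "\<And>n. (snd x, v n) \<in> obs_prod T \<times> act_prod T"
        using x u v DG GA by blast+
      then have "(\<lambda>n. (\<lambda>(y, u). c (fst x) y u) (snd x, v n)) \<longlonglongrightarrow> (\<lambda>(y, u). c (fst x) y u) (snd x, u)"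
        by (intro continuous_on_tendsto_compose[OF cont lim] always_eventually allI)
      then have "(\<lambda>n. ennreal (c (fst x) (snd x) (v n))) \<longlonglongrightarrow> ennreal (c (fst x) (snd x) u)"
        by (intro tendsto_ennrealI) simp
      then show ?thesis
        by (rule LIMSEQ_le_const2) (auto intro!: SUP_upper v)
    qed
    then show ?thesis
      unfolding sup_cost_def split_beta' using DG by (intro antisym SUP_least SUP_subset_mono) auto
  qed
  ultimately show ?thesis
    by (subst measurable_cong) auto
qed

end

subsection \<open>Quantizers and the finite models\<close>

locale quantized_team = dominated_team T f \<nu>
  for T :: "('w::polish_space, 'y::polish_space, 'u::completely_metrizable_lcs) team" and f \<nu> +
  fixes K :: "nat \<Rightarrow> nat \<Rightarrow> 'y set"
    and net :: "nat \<Rightarrow> nat \<Rightarrow> nat \<Rightarrow> 'y set"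
    and y0 :: "nat \<Rightarrow> 'y"
    and Q :: "nat \<Rightarrow> nat \<Rightarrow> nat \<Rightarrow> 'y \<Rightarrow> 'y"
  assumes quantizers: "quantizers T K net y0 Q"
    and cost_cont: "cost_continuous T (cost T)"
    and densities_cont: "densities_continuous T f"
begin

abbreviation "scost \<equiv> static_cost T f"
abbreviation "Z \<equiv> quantized_obs net y0"
abbreviation "law \<equiv> static_law T \<nu>"
abbreviation "qlaw \<equiv> quantized_law T \<nu> net y0 Q"

definition q :: "nat \<Rightarrow> nat \<Rightarrow> (nat \<Rightarrow> 'y) \<Rightarrow> nat \<Rightarrow> 'y" where
  "q l n y = (\<lambda>i\<in>I. Q i l n (y i))"

lemmas quantizersD = quantizers[unfolded quantizers_def, THEN bspec]

lemma cell_interior: "i \<in> I \<Longrightarrow> 1 \<le> l \<Longrightarrow> K i l \<subseteq> top_of_set (obs T i) interior_of K i (Suc l)"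
  and obs_eq: "i \<in> I \<Longrightarrow> obs T i = (\<Union>l\<in>{1..}. K i l)"
  and y0_in: "i \<in> I \<Longrightarrow> y0 i \<in> obs T i"
  by (drule quantizersD, elim conjE, (assumption | blast))+

lemmas quantizers_netD = quantizersD[THEN conjunct2, THEN conjunct2, THEN conjunct2, THEN spec, THEN mp, THEN spec, THEN mp]

lemma finite_net: "i \<in> I \<Longrightarrow> 1 \<le> l \<Longrightarrow> 1 \<le> n \<Longrightarrow> finite (net i l n)"
  and net_sub: "i \<in> I \<Longrightarrow> 1 \<le> l \<Longrightarrow> 1 \<le> n \<Longrightarrow> net i l n \<subseteq> K i l"
  and net_dist: "i \<in> I \<Longrightarrow> 1 \<le> l \<Longrightarrow> 1 \<le> n \<Longrightarrow> y \<in> K i l \<Longrightarrow> \<exists>z\<in>net i l n. dist y z < 1 / real n"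
  and measurable_Q: "i \<in> I \<Longrightarrow> 1 \<le> l \<Longrightarrow> 1 \<le> n \<Longrightarrow> Q i l n \<in> obs_sp T i \<rightarrow>\<^sub>M obs_sp T i"
  and Q_arg_min: "i \<in> I \<Longrightarrow> 1 \<le> l \<Longrightarrow> 1 \<le> n \<Longrightarrow> y \<in> K i l \<Longrightarrow>
      is_arg_min (dist y) (\<lambda>z. z \<in> net i l n) (Q i l n y)"
  and Q_outside: "i \<in> I \<Longrightarrow> 1 \<le> l \<Longrightarrow> 1 \<le> n \<Longrightarrow> y \<in> obs T i - K i l \<Longrightarrow> Q i l n y = y0 i"
  using quantizers_netD[of i l n] by simp_all

lemma K_sub: "i \<in> I \<Longrightarrow> 1 \<le> l \<Longrightarrow> K i l \<subseteq> obs T i"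
  using obs_eq by auto

lemma K_mono:
  assumes "i \<in> I" "1 \<le> l" "l \<le> m"
  shows "K i l \<subseteq> K i m"
  using assms(3)
proof (induction m rule: dec_induct)
  case (step m)
  then have "K i m \<subseteq> top_of_set (obs T i) interior_of K i (Suc m)"
    using assms by (intro cell_interior) auto
  also have "\<dots> \<subseteq> K i (Suc m)"
    by (rule interior_of_subset)
  finally show ?case
    using step.IH by blast
qed simp

lemma Q_close:
  assumes "i \<in> I" "1 \<le> l" "1 \<le> n" "y \<in> K i l"
  shows "dist y (Q i l n y) < 1 / real n"
proof -
  obtain z where z: "z \<in> net i l n" "dist y z < 1 / real n"
    using net_dist[OF assms] by blast
  then have "\<not> dist y z < dist y (Q i l n y)"
    using Q_arg_min[OF assms] by (auto simp: is_arg_min_def)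
  with z show ?thesis
    by linarith
qed

lemma Q_in_Z: "i \<in> I \<Longrightarrow> 1 \<le> l \<Longrightarrow> 1 \<le> n \<Longrightarrow> y \<in> obs T i \<Longrightarrow> Q i l n y \<in> Z l n i"
  using Q_arg_min[of i l n y] Q_outside[of i l n y]
  by (cases "y \<in> K i l") (auto simp: quantized_obs_def is_arg_min_def)

lemma finite_Z: "i \<in> I \<Longrightarrow> 1 \<le> l \<Longrightarrow> 1 \<le> n \<Longrightarrow> finite (Z l n i)"
  using finite_net by (simp add: quantized_obs_def)

lemma Z_sub: "i \<in> I \<Longrightarrow> 1 \<le> l \<Longrightarrow> 1 \<le> n \<Longrightarrow> Z l n i \<subseteq> obs T i"
  using net_sub[of i l n] K_sub[of i l] y0_in[of i] by (auto simp: quantized_obs_def)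

lemma singleton_in_obs_sp: "z \<in> obs T i \<Longrightarrow> {z} \<in> sets (obs_sp T i)"
  unfolding obs_sp_def sets_restrict_space by (rule image_eqI[of _ _ "{z}"]) auto

lemma measurable_Q_count:
  assumes i: "i \<in> I" "1 \<le> l" "1 \<le> n"
  shows "Q i l n \<in> \<nu> i \<rightarrow>\<^sub>M count_space (Z l n i)"
proof -
  have "Q i l n -` {z} \<inter> obs T i \<in> sets (obs_sp T i)" if "z \<in> Z l n i" for z
    using measurable_sets[OF measurable_Q[OF i] singleton_in_obs_sp, of z] that Z_sub[OF i] by auto
  then show ?thesis
    using finite_Z[OF i] Q_in_Z[OF i] i by (auto simp: measurable_count_space_eq2 space_nu sets_nu)
qed

text \<open>The compact sets increase to the whole space, so a point lies in all of them from some
  index on, and from then on its code is closer than 1/(k+1). Refining both parameters together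
  makes this a single limit; the successor is there because quantizers are specified from index
  1.\<close>

lemma Q_tendsto:
  assumes i: "i \<in> I" and y: "y \<in> obs T i"
  shows "(\<lambda>k. Q i (Suc k) (Suc k) y) \<longlonglongrightarrow> y"
proof -
  obtain l where l: "1 \<le> l" "y \<in> K i l"
    using y obs_eq[OF i] by auto
  have "\<forall>\<^sub>F k in sequentially. dist (Q i (Suc k) (Suc k) y) y \<le> 1 / real (Suc k)"
    unfolding eventually_sequentially
  proof (intro exI[of _ l] allI impI)
    fix k assume "l \<le> k"
    then have "y \<in> K i (Suc k)"
      using K_mono[of i l "Suc k"] i l by auto
    then show "dist (Q i (Suc k) (Suc k) y) y \<le> 1 / real (Suc k)"
      using Q_close[of i "Suc k" "Suc k" y] i by (simp add: dist_commute)
  qed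
  moreover have "(\<lambda>k. 1 / real (Suc k)) \<longlonglongrightarrow> 0"
    using LIMSEQ_inverse_real_of_nat by (simp add: inverse_eq_divide)
  ultimately have "(\<lambda>k. dist (Q i (Suc k) (Suc k) y) y) \<longlonglongrightarrow> 0"
    using Lim_null_comparison[of "\<lambda>k. dist (Q i (Suc k) (Suc k) y) y" "\<lambda>k. 1 / real (Suc k)" sequentially] by simp
  then show ?thesis
    by (rule tendsto_dist_iff[THEN iffD2])
qed

lemma q_in: "1 \<le> l \<Longrightarrow> 1 \<le> n \<Longrightarrow> y \<in> obs_prod T \<Longrightarrow> q l n y \<in> PiE I (Z l n)"
  by (auto simp: q_def obs_prod_def PiE_iff intro!: Q_in_Z)

lemma Z_prod_sub: "1 \<le> l \<Longrightarrow> 1 \<le> n \<Longrightarrow> PiE I (Z l n) \<subseteq> obs_prod T"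
  unfolding obs_prod_def by (intro PiE_mono Z_sub)

lemma q_obs: "1 \<le> l \<Longrightarrow> 1 \<le> n \<Longrightarrow> y \<in> obs_prod T \<Longrightarrow> q l n y \<in> obs_prod T"
  using q_in Z_prod_sub by (rule subsetD[rotated])

lemma space_SO: "space SO = states T \<times> obs_prod T"
  by (simp add: space_pair_measure space_PiM obs_prod_def)

lemma q_tendsto:
  assumes y: "y \<in> obs_prod T"
  shows "(\<lambda>k. q (Suc k) (Suc k) y) \<longlonglongrightarrow> y"
  unfolding tendsto_fun_iff
proof
  fix i
  show "(\<lambda>k. q (Suc k) (Suc k) y i) \<longlonglongrightarrow> y i"
  proof (cases "i \<in> I")
    case True
    then show ?thesis
      using Q_tendsto[OF True, of "y i"] y by (simp add: q_def obs_prod_def PiE_iff)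
  next
    case False
    then have "y i = undefined"
      using y unfolding obs_prod_def by (rule PiE_arb[rotated])
    then show ?thesis
      using False by (simp add: q_def del: atLeastAtMost_iff)
  qed
qed

section \<open>The finite models as images of the static law\<close>

lemma measurable_q: "1 \<le> l \<Longrightarrow> 1 \<le> n \<Longrightarrow> q l n \<in> PiM I (obs_sp T) \<rightarrow>\<^sub>M PiM I (obs_sp T)"
  unfolding q_def[abs_def]
proof (rule measurable_restrict)
  fix i assume "1 \<le> l" "1 \<le> n" "i \<in> I"
  then show "(\<lambda>y. Q i l n (y i)) \<in> PiM I (obs_sp T) \<rightarrow>\<^sub>M obs_sp T i"
    by (intro measurable_compose[OF measurable_component_singleton[of i I "obs_sp T"] measurable_Q[of i l n]])
qed

lemma measurable_fst_q:
  "1 \<le> l \<Longrightarrow> 1 \<le> n \<Longrightarrow> (\<lambda>x. (fst x, q l n (snd x))) \<in> SO \<rightarrow>\<^sub>M SO"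
  by (intro measurable_Pair measurable_fst measurable_compose[OF measurable_snd measurable_q])

lemma space_quantized_law:
  assumes "1 \<le> l" "1 \<le> n"
  shows "space (qlaw l n) = states T \<times> PiE I (Z l n)"
  by (simp add: quantized_law_def space_pair_measure space_PiM)

text \<open>The finite model lives on a product of discrete spaces, the static law on a Borel space.
  Measurable functions carry over because the inclusion of each discrete \<open>Z l n i\<close> in
  \<open>obs T i\<close> is measurable.\<close>

lemma measurable_quantized_law:
  assumes l: "1 \<le> l" "1 \<le> n" and g: "g \<in> SO \<rightarrow>\<^sub>M N"
  shows "g \<in> qlaw l n \<rightarrow>\<^sub>M N"
proof -
  let ?D = "\<lambda>i. distr (\<nu> i) (count_space (Z l n i)) (Q i l n)"
  have id: "(\<lambda>y. y i) \<in> PiM I ?D \<rightarrow>\<^sub>M obs_sp T i" if i: "i \<in> I" for i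
  proof -
    have "(\<lambda>y. y i) \<in> PiM I ?D \<rightarrow>\<^sub>M ?D i"
      using i by (rule measurable_component_singleton)
    moreover have "(\<lambda>z. z) \<in> ?D i \<rightarrow>\<^sub>M obs_sp T i"
      using Z_sub[OF i l] by (auto intro!: measurableI)
    ultimately show ?thesis
      by (rule measurable_compose)
  qed
  have "(\<lambda>y. \<lambda>i\<in>I. y i) \<in> PiM I ?D \<rightarrow>\<^sub>M PiM I (obs_sp T)"
    by (intro measurable_restrict id)
  then have "(\<lambda>x. (fst x, \<lambda>i\<in>I. snd x i)) \<in> qlaw l n \<rightarrow>\<^sub>M SO"
    unfolding quantized_law_def
    by (intro measurable_Pair measurable_compose[OF measurable_fst measurable_ident_sets[OF sets_prior]]
        measurable_compose[OF measurable_snd])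
  then have "(\<lambda>x. g (fst x, \<lambda>i\<in>I. snd x i)) \<in> qlaw l n \<rightarrow>\<^sub>M N"
    by (rule measurable_compose) (rule g)
  then show ?thesis
    by (rule measurable_cong[THEN iffD1, rotated])
       (use l in \<open>auto simp: space_quantized_law PiE_restrict\<close>)
qed

text \<open>This puts all finite models on one space: their integrals are taken over the fixed
  measure \<open>law\<close>, with the observations replaced by their codes, and can be compared
  pointwise.\<close>

lemma nn_integral_quantized_law:
  assumes l: "1 \<le> l" "1 \<le> n" and g: "g \<in> borel_measurable SO"
  shows "(\<integral>\<^sup>+ x. g x \<partial>qlaw l n) = (\<integral>\<^sup>+ x. g (fst x, q l n (snd x)) \<partial>law)"
proof -
  let ?D = "\<lambda>i. distr (\<nu> i) (count_space (Z l n i)) (Q i l n)"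
  let ?N = "PiM I (\<lambda>i. count_space (Z l n i))"
  have D: "PiM I ?D = distr (PiM I \<nu>) ?N (q l n)"
    unfolding q_def[abs_def] using prob_nu measurable_Q_count l by (intro distr_PiM_indexed) auto
  have qm: "q l n \<in> PiM I \<nu> \<rightarrow>\<^sub>M ?N"
    unfolding q_def[abs_def]
  proof (rule measurable_restrict)
    fix i assume "i \<in> I"
    then show "(\<lambda>y. Q i l n (y i)) \<in> PiM I \<nu> \<rightarrow>\<^sub>M count_space (Z l n i)"
      using l by (intro measurable_compose[OF measurable_component_singleton[of i I \<nu>] measurable_Q_count])
  qed
  have "prob_space (distr (PiM I \<nu>) ?N (q l n))"
    by (intro prob_space.prob_space_distr prob_PiM_nu qm) simp
  then have "distr (prior T) (prior T) (\<lambda>\<omega>. \<omega>) \<Otimes>\<^sub>M distr (PiM I \<nu>) ?N (q l n) =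
      distr (prior T \<Otimes>\<^sub>M PiM I \<nu>) (prior T \<Otimes>\<^sub>M ?N) (\<lambda>(\<omega>, y). (\<omega>, q l n y))"
    using qm by (intro pair_measure_distr) (auto simp: prob_space_imp_sigma_finite)
  then have P: "qlaw l n = distr law (prior T \<Otimes>\<^sub>M ?N) (\<lambda>(\<omega>, y). (\<omega>, q l n y))"
    by (simp add: quantized_law_def D distr_id static_law_def)
  have "(\<lambda>(\<omega>, y). (\<omega>, q l n y)) \<in> law \<rightarrow>\<^sub>M prior T \<Otimes>\<^sub>M ?N"
    unfolding static_law_def split_beta' by (intro measurable_Pair measurable_fst measurable_compose[OF measurable_snd qm])
  moreover have "g \<in> borel_measurable (prior T \<Otimes>\<^sub>M ?N)"
    using measurable_quantized_law[OF l g] by (simp add: P)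
  ultimately show ?thesis
    by (simp add: P nn_integral_distr split_beta')
qed

lemma static_cost_cont: "cost_continuous T scost"
  by (intro cost_continuous_static cost_cont densities_cont)

lemma measurable_sup_static: "compact_box T G \<Longrightarrow> sup_cost scost G \<in> borel_measurable SO"
  by (intro measurable_sup_cost cost_measurable_static static_cost_cont)

text \<open>Uniform integrability over the finite models thereby becomes a bound on tails under a
  single measure, the form in which \<open>eventually_nn_integral_le\<close> takes its
  majorants.\<close>

lemma tail_pullback:
  assumes l: "1 \<le> l" "1 \<le> n" and w[measurable]: "w \<in> borel_measurable SO"
  shows "(\<integral>\<^sup>+ x\<in>{x \<in> space (qlaw l n). ennreal R < w x}. w x \<partial>qlaw l n) =
    (\<integral>\<^sup>+ x\<in>{x \<in> space law. ennreal R < w (fst x, q l n (snd x))}. w (fst x, q l n (snd x)) \<partial>law)"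
proof -
  have "(\<integral>\<^sup>+ x\<in>{x \<in> space (qlaw l n). ennreal R < w x}. w x \<partial>qlaw l n) =
      (\<integral>\<^sup>+ x\<in>{x \<in> space SO. ennreal R < w x}. w x \<partial>qlaw l n)"
  proof (rule nn_integral_cong)
    fix x assume "x \<in> space (qlaw l n)"
    then have "x \<in> space SO"
      using Z_prod_sub[OF l] unfolding space_quantized_law[OF l] space_SO by blast
    with \<open>x \<in> space (qlaw l n)\<close> show "w x * indicator {x \<in> space (qlaw l n). ennreal R < w x} x =
        w x * indicator {x \<in> space SO. ennreal R < w x} x"
      by (simp add: indicator_def)
  qed
  also have "\<dots> = (\<integral>\<^sup>+ x. w (fst x, q l n (snd x)) *
      indicator {x \<in> space SO. ennreal R < w x} (fst x, q l n (snd x)) \<partial>law)"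
    by (rule nn_integral_quantized_law[OF l]) measurable
  also have "\<dots> = (\<integral>\<^sup>+ x\<in>{x \<in> space law. ennreal R < w (fst x, q l n (snd x))}. w (fst x, q l n (snd x)) \<partial>law)"
  proof (rule nn_integral_cong)
    fix x assume x: "x \<in> space law"
    then have "(fst x, q l n (snd x)) \<in> space SO"
      using q_obs[OF l] by (auto simp: space_static_law space_SO)
    with x show "w (fst x, q l n (snd x)) * indicator {x \<in> space SO. ennreal R < w x} (fst x, q l n (snd x)) =
        w (fst x, q l n (snd x)) * indicator {x \<in> space law. ennreal R < w (fst x, q l n (snd x))} x"
      by (simp add: indicator_def)
  qed
  finally show ?thesis .
qed

lemma sup_static_upper:
  "u \<in> G \<Longrightarrow> ennreal (scost \<omega> y u) \<le> sup_cost scost G (\<omega>, y)"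
  by (auto simp: sup_cost_def intro: SUP_upper)

lemma box_sub: "compact_box T G \<Longrightarrow> G \<subseteq> act_prod T"
  unfolding compact_box_def act_prod_def by (auto simp: PiE_iff)

lemma box_compact: "compact_box T G \<Longrightarrow> compact G"
proof -
  assume "compact_box T G"
  then obtain B where B: "\<And>i. i \<in> I \<Longrightarrow> compact (B i)" "G = PiE I B"
    unfolding compact_box_def by blast
  \<comment> \<open>Tychonoff's theorem is applied over all indices; those that belong to no agent
    carry the compact singleton of \<open>undefined\<close>.\<close>
  have G: "G = PiE UNIV (\<lambda>i. if i \<in> I then B i else {undefined})"
    unfolding B(2) by (auto simp: PiE_iff extensional_def split: if_splits)
  have "compactin (product_topology (\<lambda>_. euclidean) UNIV) G"
    unfolding G compactin_PiE using B(1) by (auto simp: compactin_euclidean_iff)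
  then show "compact G"
    by (simp add: euclidean_product_topology)
qed

text \<open>A supremum of functions continuous in the observations is lower semicontinuous, so its
  value at a profile is at most the limit inferior of its values at the codes. The integrals of the
  latter are at most a level \<open>R\<close> plus a tail of mass 1, uniformly in the
  quantizer.\<close>

lemma nn_integrable_sup_static:
  assumes G: "compact_box T G" and ui: "uniformly_integrable qlaw (sup_cost scost G)"
  shows "nn_integrable law (sup_cost scost G)"
  unfolding nn_integrable_def
proof
  interpret law: prob_space law
    by (rule prob_static_law)
  let ?w = "sup_cost scost G"
  let ?wq = "\<lambda>k x. ?w (fst x, q (Suc k) (Suc k) (snd x))"
  note w[measurable] = measurable_sup_static[OF G]
  show "?w \<in> borel_measurable law"
    using w by (rule measurable_static)
  have wq[measurable]: "?wq k \<in> borel_measurable law" for k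
    by (rule measurable_static, rule measurable_compose[OF measurable_fst_q w]) auto
  obtain R where R: "0 \<le> R" and tail: "\<And>l n. 1 \<le> l \<Longrightarrow> 1 \<le> n \<Longrightarrow>
      (\<integral>\<^sup>+ x\<in>{x \<in> space (qlaw l n). ennreal R < ?w x}. ?w x \<partial>qlaw l n) \<le> ennreal 1"
    using uniformly_integrable_tail[OF ui, of 1] by auto
  have bound: "(\<integral>\<^sup>+ x. ?wq k x \<partial>law) \<le> ennreal R + 1" for k
  proof -
    have "(\<integral>\<^sup>+ x. ?wq k x \<partial>law) \<le> (\<integral>\<^sup>+ x. ennreal R + ?wq k x * indicator {x \<in> space law. ennreal R < ?wq k x} x \<partial>law)"
      by (intro nn_integral_mono) (auto simp: indicator_def not_less)
    also have "\<dots> = ennreal R + (\<integral>\<^sup>+ x\<in>{x \<in> space law. ennreal R < ?wq k x}. ?wq k x \<partial>law)"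
      by (simp add: nn_integral_add law.emeasure_space_1)
    also have "\<dots> \<le> ennreal R + 1"
      using tail[of "Suc k" "Suc k"] by (intro add_left_mono) (simp add: tail_pullback w)
    finally show ?thesis .
  qed
  have "?w x \<le> liminf (\<lambda>k. ?wq k x)" if x: "x \<in> space law" for x
  proof -
    have x': "fst x \<in> states T" "snd x \<in> obs_prod T"
      using x by (auto simp: space_static_law)
    have "ennreal (scost (fst x) (snd x) u) \<le> liminf (\<lambda>k. ?wq k x)" if u: "u \<in> G" for u
    proof -
      have qx: "q (Suc k) (Suc k) (snd x) \<in> obs_prod T" for k
        using q_obs[of "Suc k" "Suc k"] x' by simp
      have cont: "continuous_on (obs_prod T \<times> act_prod T) (\<lambda>(y, u). scost (fst x) y u)"
        using static_cost_cont x'(1) by (simp add: cost_continuous_def)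
      have "(\<lambda>k. (\<lambda>(y, u). scost (fst x) y u) (q (Suc k) (Suc k) (snd x), u)) \<longlonglongrightarrow> (\<lambda>(y, u). scost (fst x) y u) (snd x, u)"
        by (rule continuous_on_tendsto_compose[OF cont tendsto_Pair[OF q_tendsto[OF x'(2)] tendsto_const]])
           (use qx x' u box_sub[OF G] in auto)
      then have lim: "(\<lambda>k. ennreal (scost (fst x) (q (Suc k) (Suc k) (snd x)) u)) \<longlonglongrightarrow> ennreal (scost (fst x) (snd x) u)"
        by (intro tendsto_ennrealI) simp
      have "ennreal (scost (fst x) (snd x) u) = liminf (\<lambda>k. ennreal (scost (fst x) (q (Suc k) (Suc k) (snd x)) u))"
        using lim_imp_Liminf[OF sequentially_bot lim] by simp
      also have "\<dots> \<le> liminf (\<lambda>k. ?wq k x)"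
        by (intro Liminf_mono always_eventually allI sup_static_upper u)
      finally show ?thesis .
    qed
    then show ?thesis
      by (auto simp: sup_cost_def split_beta' intro!: SUP_least)
  qed
  then have "(\<integral>\<^sup>+ x. ?w x \<partial>law) \<le> (\<integral>\<^sup>+ x. liminf (\<lambda>k. ?wq k x) \<partial>law)"
    by (intro nn_integral_mono)
  also have "\<dots> \<le> liminf (\<lambda>k. \<integral>\<^sup>+ x. ?wq k x \<partial>law)"
    by (intro nn_integral_liminf wq)
  also have "\<dots> \<le> ennreal R + 1"
    using Liminf_le[OF sequentially_bot always_eventually, of "\<lambda>k. \<integral>\<^sup>+ x. ?wq k x \<partial>law" "ennreal R + 1"] bound by blast
  finally show "(\<integral>\<^sup>+ x. ?w x \<partial>law) < \<infinity>"
    by (auto intro: le_less_trans)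
qed

subsection \<open>Truncation and approximation of policies\<close>

abbreviation "Js \<equiv> expected_cost T law scost"

lemma Js_eq: "Js \<gamma> = (\<integral>\<^sup>+ x. ennreal (scost (fst x) (snd x) (apply_policy T \<gamma> (snd x))) \<partial>law)"
  by (simp add: expected_cost_def split_beta')

lemma measurable_static_cost_policy:
  "\<gamma> \<in> policies T \<Longrightarrow> (\<lambda>x. scost (fst x) (snd x) (apply_policy T \<gamma> (snd x))) \<in> borel_measurable law"
  by (intro measurable_static measurable_cost_policy cost_measurable_static)

lemma policy_lusin:
  assumes \<gamma>: "\<gamma> \<in> policies T" and i: "i \<in> I" and e: "(0::real) < e"
  shows "\<exists>C. compact C \<and> C \<subseteq> obs T i \<and> continuous_on C (\<gamma> i) \<and> emeasure (\<nu> i) (obs T i - C) \<le> ennreal e"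
proof -
  have ti: "obs T i \<in> sets borel" "separable_space (top_of_set (act T i))"
    using team i by (auto simp: sequential_team_def)
  then obtain D where D: "countable D" "D \<subseteq> act T i" "top_of_set (act T i) closure_of D = act T i"
    unfolding separable_space_def by auto
  \<comment> \<open>\<open>D\<close> is dense relative to \<open>act T i\<close>; Lusin's theorem
    was proved with the closure taken in the ambient space.\<close>
  have "act T i \<inter> closure (act T i \<inter> D) = act T i"
    using D(3) by (simp add: closure_of_subtopology)
  moreover have "act T i \<inter> D = D"
    using D(2) by blast
  ultimately have "act T i \<subseteq> closure D"
    by (metis inf_le2)
  moreover have "finite_measure (\<nu> i)"
    using prob_nu[OF i] by (simp add: prob_space.finite_measure)
  moreover have "sets (\<nu> i) = sets (restrict_space borel (obs T i))"
    using sets_nu[OF i] by (simp add: obs_sp_def)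
  moreover have "\<gamma> i \<in> \<nu> i \<rightarrow>\<^sub>M restrict_space borel (act T i)"
    using measurable_policy[OF \<gamma> i] by (simp add: measurable_cong_sets[OF sets_nu[OF i] refl] act_sp_def)
  ultimately show ?thesis
    using lusin_separable[of "\<nu> i" "obs T i" "\<gamma> i" "act T i" D e] ti(1) D(1) e by blast
qed

text \<open>Such a component has values in a compact set, namely the image of \<open>C\<close>
  together with \<open>u\<close>, and can be recovered in the limit from quantized observations. The
  jump at the boundary of \<open>C\<close> does no harm: \<open>C\<close> is closed, so a point off
  \<open>C\<close> has a neighbourhood that misses it.\<close>

definition tame :: "nat \<Rightarrow> ('y \<Rightarrow> 'u) \<Rightarrow> bool" where
  "tame i g \<longleftrightarrow> (\<exists>C u. compact C \<and> C \<subseteq> obs T i \<and> u \<in> act T i \<and> continuous_on C g \<and> g ` C \<subseteq> act T i \<and>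
     (\<forall>y\<in>obs T i - C. g y = u))"

lemma emeasure_static_component:
  assumes i: "i \<in> I" and S: "S \<in> sets (\<nu> i)"
  shows "{x \<in> space law. snd x i \<in> S} \<in> sets law"
    and "emeasure law {x \<in> space law. snd x i \<in> S} = emeasure (\<nu> i) S"
proof -
  interpret prior: prob_space "prior T"
    by (rule prob_prior)
  interpret PN: prob_space "PiM I \<nu>"
    by (rule prob_PiM_nu) simp
  have comp: "(\<lambda>y. y i) \<in> PiM I \<nu> \<rightarrow>\<^sub>M \<nu> i"
    using i by (rule measurable_component_singleton)
  let ?S = "(\<lambda>y. y i) -` S \<inter> space (PiM I \<nu>)"
  have S': "?S \<in> sets (PiM I \<nu>)"
    by (rule measurable_sets[OF comp S])
  have eq: "{x \<in> space law. snd x i \<in> S} = space (prior T) \<times> ?S"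
    by (auto simp: static_law_def space_pair_measure)
  show "{x \<in> space law. snd x i \<in> S} \<in> sets law"
    unfolding eq unfolding static_law_def by (intro pair_measureI S' sets.top)
  have "emeasure law {x \<in> space law. snd x i \<in> S} = emeasure (PiM I \<nu>) ?S"
    unfolding eq unfolding static_law_def
    by (simp add: PN.emeasure_pair_measure_Times S' prior.emeasure_space_1 del: space_prior)
  also have "\<dots> = emeasure (distr (PiM I \<nu>) (\<nu> i) (\<lambda>y. y i)) S"
    by (simp add: emeasure_distr[OF comp S])
  also have "distr (PiM I \<nu>) (\<nu> i) (\<lambda>y. y i) = \<nu> i"
    by (rule distr_PiM_component[OF prob_nu i])
  finally show "emeasure law {x \<in> space law. snd x i \<in> S} = emeasure (\<nu> i) S" .
qed

lemma closed_in_obs_sp: "closed C \<Longrightarrow> C \<subseteq> obs T i \<Longrightarrow> C \<in> sets (obs_sp T i)"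
  unfolding obs_sp_def sets_restrict_space by (rule image_eqI[of _ _ C]) auto

text \<open>Point by point, the new cost is that of \<gamma> or, where the observation of agent
  \<open>i\<close> falls outside the compact set, that of the constant deviation. The comparison has
  to be made in static form, since in the dynamic team a new component would also change the laws of
  later observations.\<close>

lemma truncate_agent:
  assumes \<gamma>: "\<gamma> \<in> policies T" and fin: "Js \<gamma> < \<infinity>" and i: "i \<in> I"
    and u: "u \<in> act T i" "Js (\<gamma>(i := (\<lambda>_. u))) < \<infinity>" and e: "(0::real) < e"
  shows "\<exists>g. tame i g \<and> \<gamma>(i := g) \<in> policies T \<and> Js (\<gamma>(i := g)) \<le> Js \<gamma> + ennreal e"
proof -
  define a where "a \<gamma> x = ennreal (scost (fst x) (snd x) (apply_policy T \<gamma> (snd x)))" for \<gamma> x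
  have J: "Js \<gamma> = (\<integral>\<^sup>+ x. a \<gamma> x \<partial>law)" for \<gamma>
    by (simp add: Js_eq a_def)
  have am: "\<gamma> \<in> policies T \<Longrightarrow> a \<gamma> \<in> borel_measurable law" for \<gamma>
    using measurable_static_cost_policy[of \<gamma>] unfolding a_def by simp
  have \<gamma>u: "\<gamma>(i := (\<lambda>_. u)) \<in> policies T"
    using \<gamma> u(1) by (auto simp: policies_def)
  note [measurable] = am[OF \<gamma>] am[OF \<gamma>u]
  have "(\<integral>\<^sup>+ x. a (\<gamma>(i := (\<lambda>_. u))) x \<partial>law) < \<infinity>"
    using u(2) by (simp add: J)
  then obtain d where d: "0 < d" and
    small: "\<And>A. A \<in> sets law \<Longrightarrow> emeasure law A \<le> ennreal d \<Longrightarrow> (\<integral>\<^sup>+ x\<in>A. a (\<gamma>(i := (\<lambda>_. u))) x \<partial>law) \<le> ennreal e"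
    using nn_integral_absolutely_continuous[OF am[OF \<gamma>u] _ e] by blast
  obtain C where C: "compact C" "C \<subseteq> obs T i" "continuous_on C (\<gamma> i)" "emeasure (\<nu> i) (obs T i - C) \<le> ennreal d"
    using policy_lusin[OF \<gamma> i d] by blast
  define g where "g y = (if y \<in> C then \<gamma> i y else u)" for y
  have Cs: "C \<in> sets (obs_sp T i)"
    using C by (intro closed_in_obs_sp compact_imp_closed)
  have gm: "g \<in> obs_sp T i \<rightarrow>\<^sub>M act_sp T i"
    unfolding g_def[abs_def] using Cs u(1)
    by (intro measurable_If_set measurable_policy[OF \<gamma> i] measurable_const) (simp_all add: Int_absorb2 C(2))
  have "tame i g"
    unfolding tame_def
  proof (intro exI conjI)
    show "continuous_on C g"
      using C(3) by (rule continuous_on_cong[THEN iffD1, rotated -1]) (auto simp: g_def)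
    show "g ` C \<subseteq> act T i"
      using measurable_space[OF measurable_policy[OF \<gamma> i]] C(2) by (auto simp: g_def)
  qed (use C u in \<open>auto simp: g_def\<close>)
  moreover have \<gamma>g: "\<gamma>(i := g) \<in> policies T"
    using \<gamma> gm by (auto simp: policies_def)
  moreover have "Js (\<gamma>(i := g)) \<le> Js \<gamma> + ennreal e"
  proof -
    let ?A = "{x \<in> space law. snd x i \<in> obs T i - C}"
    have oC: "obs T i - C \<in> sets (\<nu> i)"
      using sets.compl_sets[OF Cs] by (simp add: sets_nu[OF i])
    have A[measurable]: "?A \<in> sets law"
      by (rule emeasure_static_component[OF i oC])
    have mA: "emeasure law ?A \<le> ennreal d"
      using C(4) by (simp only: emeasure_static_component(2)[OF i oC])
    have "Js (\<gamma>(i := g)) \<le> (\<integral>\<^sup>+ x. a \<gamma> x + a (\<gamma>(i := (\<lambda>_. u))) x * indicator ?A x \<partial>law)"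
      unfolding J
    proof (rule nn_integral_mono)
      fix x assume x: "x \<in> space law"
      then have yi: "snd x i \<in> obs T i"
        using i by (auto simp: space_static_law obs_prod_def PiE_iff)
      show "a (\<gamma>(i := g)) x \<le> a \<gamma> x + a (\<gamma>(i := (\<lambda>_. u))) x * indicator ?A x"
      proof (cases "snd x i \<in> C")
        case True
        then have "apply_policy T (\<gamma>(i := g)) (snd x) = apply_policy T \<gamma> (snd x)"
          by (auto simp: apply_policy_def g_def)
        then show ?thesis
          by (simp add: a_def add_increasing2)
      next
        case False
        then have "apply_policy T (\<gamma>(i := g)) (snd x) = apply_policy T (\<gamma>(i := (\<lambda>_. u))) (snd x)"
          by (auto simp: apply_policy_def g_def)
        moreover have "x \<in> ?A"
          using False yi x by simp
        ultimately show ?thesis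
          by (simp add: a_def add_increasing)
      qed
    qed
    also have "\<dots> = Js \<gamma> + (\<integral>\<^sup>+ x\<in>?A. a (\<gamma>(i := (\<lambda>_. u))) x \<partial>law)"
      unfolding J by (rule nn_integral_add) measurable
    also have "\<dots> \<le> Js \<gamma> + ennreal e"
      by (intro add_left_mono small A mA)
    finally show ?thesis .
  qed
  ultimately show ?thesis
    by blast
qed

text \<open>The cost stays finite along the induction, without which (e) would say nothing about the
  next agent. Replacing one component leaves those already treated untouched, and each agent adds at
  most \<open>e\<close>.\<close>

lemma truncate_policy:
  assumes fc: "finite_constant_deviations T Js" and \<gamma>: "\<gamma> \<in> policies T" and fin: "Js \<gamma> < \<infinity>" and e: "(0::real) < e"
  shows "m \<le> agents T \<Longrightarrow> \<exists>\<gamma>'\<in>policies T. (\<forall>i\<in>{1..m}. tame i (\<gamma>' i)) \<and> Js \<gamma>' \<le> Js \<gamma> + ennreal (real m * e)"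
proof (induction m)
  case 0
  show ?case
    using \<gamma> by (intro bexI[of _ \<gamma>]) auto
next
  case (Suc m)
  then obtain \<gamma>' where \<gamma>': "\<gamma>' \<in> policies T" "\<forall>i\<in>{1..m}. tame i (\<gamma>' i)" "Js \<gamma>' \<le> Js \<gamma> + ennreal (real m * e)"
    by auto
  have fin': "Js \<gamma>' < \<infinity>"
    using \<gamma>'(3) fin by (auto intro: le_less_trans)
  have i: "Suc m \<in> I"
    using Suc.prems by simp
  obtain u where u: "u \<in> act T (Suc m)" "Js (\<gamma>'(Suc m := (\<lambda>_. u))) < \<infinity>"
    using fc \<gamma>'(1) fin' i unfolding finite_constant_deviations_def by blast
  obtain g where g: "tame (Suc m) g" "\<gamma>'(Suc m := g) \<in> policies T" "Js (\<gamma>'(Suc m := g)) \<le> Js \<gamma>' + ennreal e"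
    using truncate_agent[OF \<gamma>'(1) fin' i u e] by blast
  have "Js (\<gamma>'(Suc m := g)) \<le> Js \<gamma> + ennreal (real m * e) + ennreal e"
    using g(3) \<gamma>'(3) by (meson add_right_mono order_trans)
  also have "\<dots> = Js \<gamma> + ennreal (real (Suc m) * e)"
    using e by (simp add: add.assoc ennreal_plus[symmetric] algebra_simps del: ennreal_plus)
  finally have "Js (\<gamma>'(Suc m := g)) \<le> Js \<gamma> + ennreal (real (Suc m) * e)" .
  moreover have "\<forall>i\<in>{1..Suc m}. tame i ((\<gamma>'(Suc m := g)) i)"
    using g(1) \<gamma>'(2) by (auto simp: le_Suc_eq)
  ultimately show ?case
    using g(2) by blast
qed

text \<open>One compact \<open>B\<close> holds the values of \<open>g\<close> and of all
  approximants, so that a single box later supplies the majorant for the whole sequence. Each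
  \<open>\<pi> k\<close> acts on codes, and it is measurable because it differs from a constant at
  finitely many points at most.\<close>

lemma tame_approximation:
  assumes i: "i \<in> I" and g: "tame i g"
  shows "\<exists>\<pi> B. compact B \<and> B \<noteq> {} \<and> B \<subseteq> act T i \<and> (\<forall>y\<in>obs T i. g y \<in> B) \<and>
    (\<forall>k z. \<pi> k z \<in> B) \<and> (\<forall>k. \<pi> k \<in> obs_sp T i \<rightarrow>\<^sub>M act_sp T i) \<and>
    (\<forall>y\<in>obs T i. (\<lambda>k. \<pi> k (Q i (Suc k) (Suc k) y)) \<longlonglongrightarrow> g y)"
proof -
  obtain C u where C: "compact C" "C \<subseteq> obs T i" "u \<in> act T i" "continuous_on C g" "g ` C \<subseteq> act T i"
    and off: "\<And>y. y \<in> obs T i \<Longrightarrow> y \<notin> C \<Longrightarrow> g y = u"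
    using g unfolding tame_def by blast
  let ?q = "\<lambda>k. Q i (Suc k) (Suc k)"
  \<comment> \<open>Only points of \<open>K i (Suc k)\<close> may represent a cell: all others are quantized to \<open>y0 i\<close>.\<close>
  define X where "X k z = {x \<in> C \<inter> K i (Suc k). ?q k x = z}" for k z
  define \<pi> where "\<pi> k z = (if X k z = {} then u else g (SOME x. x \<in> X k z))" for k z
  have sel: "(SOME x. x \<in> X k z) \<in> X k z" if "X k z \<noteq> {}" for k z
    using that some_in_eq by blast
  have inB: "\<pi> k z \<in> insert u (g ` C)" for k z
    using sel[of k z] by (auto simp: \<pi>_def X_def)
  have B: "compact (insert u (g ` C))" "insert u (g ` C) \<subseteq> act T i"
    using compact_insert[OF compact_continuous_image[OF C(4,1)]] C(3,5) by simp_all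
  have gB: "\<forall>y\<in>obs T i. g y \<in> insert u (g ` C)"
    using off by blast
  have meas: "\<pi> k \<in> obs_sp T i \<rightarrow>\<^sub>M act_sp T i" for k
  proof (rule measurable_discrete_difference[of "\<lambda>_. u"])
    show "(\<lambda>_. u) \<in> obs_sp T i \<rightarrow>\<^sub>M act_sp T i"
      using C by simp
    show "countable (Z (Suc k) (Suc k) i)"
      using finite_Z[OF i] by (intro countable_finite) simp
    show "{z} \<in> sets (obs_sp T i)" if "z \<in> Z (Suc k) (Suc k) i" for z
      using Z_sub[OF i, of "Suc k" "Suc k"] that by (intro singleton_in_obs_sp) auto
    show "\<pi> k z \<in> space (act_sp T i)" for z
      using inB[of k z] B(2) by auto
    show "u = \<pi> k z" if "z \<notin> Z (Suc k) (Suc k) i" for z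
    proof -
      have "X k z = {}"
        using Q_in_Z[OF i, of "Suc k" "Suc k"] C(2) that by (auto simp: X_def)
      then show ?thesis
        by (simp add: \<pi>_def)
    qed
  qed
  have lim: "(\<lambda>k. \<pi> k (?q k y)) \<longlonglongrightarrow> g y" if y: "y \<in> obs T i" for y
  proof -
    obtain l where l: "1 \<le> l" "y \<in> K i l"
      using y obs_eq[OF i] by auto
    have yK: "y \<in> K i (Suc k)" if "l \<le> k" for k
      using K_mono[of i l "Suc k"] i l that by auto
    \<comment> \<open>Both \<open>x\<close> and \<open>y\<close> are within 1/(k+1) of their common
      code.\<close>
    have near: "dist x y < 2 / real (Suc k)" if "l \<le> k" "x \<in> X k (?q k y)" for x k
    proof -
      have "dist x (?q k y) < 1 / real (Suc k)"
        using Q_close[of i "Suc k" "Suc k" x] i that by (auto simp: X_def)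
      moreover have "dist y (?q k y) < 1 / real (Suc k)"
        using Q_close[of i "Suc k" "Suc k" y] i yK[OF that(1)] by auto
      ultimately show ?thesis
        using dist_triangle2[of x y "?q k y"] add_divide_distrib[of 1 1 "real (Suc k)"] by simp
    qed
    have small: "\<exists>k0. \<forall>k\<ge>k0. 2 / real (Suc k) < d" if "0 < d" for d :: real
    proof -
      have "(\<lambda>k. 2 * inverse (real (Suc k))) \<longlonglongrightarrow> 2 * 0"
        by (intro tendsto_mult_left LIMSEQ_inverse_real_of_nat)
      then have "(\<lambda>k. 2 / real (Suc k)) \<longlonglongrightarrow> 0"
        by (simp add: divide_inverse)
      from order_tendstoD(2)[OF this that] show ?thesis
        unfolding eventually_sequentially .
    qed
    show ?thesis
    proof (cases "y \<in> C")
      \<comment> \<open>The point \<open>y\<close> belongs to its own cell, so the cell has a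
        representative in \<open>C\<close>. The representatives tend to \<open>y\<close>, and
        continuity of \<open>g\<close> on \<open>C\<close> suffices.\<close>
      case True
      show ?thesis
        unfolding lim_sequentially
      proof (intro allI impI)
        fix r :: real assume "0 < r"
        then obtain d where d: "0 < d" "\<And>x. x \<in> C \<Longrightarrow> dist x y < d \<Longrightarrow> dist (g x) (g y) < r"
          using C(4) True unfolding continuous_on_iff by blast
        obtain k0 where k0: "\<And>k. k0 \<le> k \<Longrightarrow> 2 / real (Suc k) < d"
          using small[OF d(1)] by blast
        have "dist (\<pi> k (?q k y)) (g y) < r" if k: "max l k0 \<le> k" for k
        proof -
          have "y \<in> X k (?q k y)"
            using True yK k by (simp add: X_def)
          then have ne: "X k (?q k y) \<noteq> {}"
            by blast
          let ?x = "SOME x. x \<in> X k (?q k y)"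
          have "dist ?x y < d"
            using near[of k ?x] sel[OF ne] k0[of k] k by fastforce
          moreover have "?x \<in> C"
            using sel[OF ne] by (simp add: X_def)
          ultimately show ?thesis
            using d(2)[of ?x] ne by (simp add: \<pi>_def)
        qed
        then show "\<exists>n0. \<forall>k\<ge>n0. dist (\<pi> k (?q k y)) (g y) < r"
          by blast
      qed
    next
      \<comment> \<open>A representative in \<open>C\<close> would eventually be closer to
        \<open>y\<close> than the closed set \<open>C\<close> is. So there is none, and the
        approximant takes exactly the constant action.\<close>
      case False
      then obtain d where d: "0 < d" "\<And>x. dist x y < d \<Longrightarrow> x \<notin> C"
        using compact_imp_closed[OF C(1)] unfolding closed_def open_dist by blast
      obtain k0 where k0: "\<And>k. k0 \<le> k \<Longrightarrow> 2 / real (Suc k) < d"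
        using small[OF d(1)] by blast
      have "\<pi> k (?q k y) = g y" if k: "max l k0 \<le> k" for k
      proof -
        have "X k (?q k y) = {}"
        proof (rule ccontr)
          assume "X k (?q k y) \<noteq> {}"
          then obtain x where x: "x \<in> X k (?q k y)"
            by blast
          then have "dist x y < d"
            using near[of k x] k0[of k] k by fastforce
          then show False
            using d(2) x by (auto simp: X_def)
        qed
        then show ?thesis
          using off[OF y False] by (simp add: \<pi>_def)
      qed
      then have "\<forall>\<^sub>F k in sequentially. \<pi> k (?q k y) = g y"
        unfolding eventually_sequentially by blast
      then show ?thesis
        by (rule tendsto_eventually)
    qed
  qed
  show ?thesis
    using B gB inB meas lim by (intro exI[of _ \<pi>] exI[of _ "insert u (g ` C)"]) simp
qed

subsection \<open>Near-optimality\<close>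

lemma apply_quantize: "apply_policy T (quantize Q l n \<pi>) y = apply_policy T \<pi> (q l n y)"
  by (auto simp: apply_policy_def quantize_def q_def)

lemma quantize_policy:
  assumes "\<pi> \<in> policies T" "1 \<le> l" "1 \<le> n"
  shows "quantize Q l n \<pi> \<in> policies T"
  unfolding policies_def quantize_def
proof (intro CollectI ballI)
  fix i assume i: "i \<in> I"
  show "\<pi> i \<circ> Q i l n \<in> obs_sp T i \<rightarrow>\<^sub>M act_sp T i"
    by (rule measurable_comp[OF measurable_Q[OF i assms(2,3)] measurable_policy[OF assms(1) i]])
qed

text \<open>Members of \<open>finite_policies\<close> are arbitrary off the codes and possibly not
  measurable. Resetting them there to a fixed admissible action gives a measurable policy with the
  same action at every code.\<close>

definition extend :: "nat \<Rightarrow> nat \<Rightarrow> (nat \<Rightarrow> 'y \<Rightarrow> 'u) \<Rightarrow> nat \<Rightarrow> 'y \<Rightarrow> 'u" where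
  "extend l n \<pi> i z = (if z \<in> Z l n i then \<pi> i z else SOME u. u \<in> act T i)"

lemma act_nonempty: "i \<in> I \<Longrightarrow> act T i \<noteq> {}"
  using team by (simp add: sequential_team_def)

lemma extend_policy:
  assumes l: "1 \<le> l" "1 \<le> n" and \<pi>: "\<pi> \<in> finite_policies T net y0 l n G"
  shows "extend l n \<pi> \<in> policies T"
  unfolding policies_def
proof (intro CollectI ballI)
  fix i assume i: "i \<in> I"
  have some: "(SOME u. u \<in> act T i) \<in> act T i"
    using act_nonempty[OF i] some_in_eq by blast
  show "extend l n \<pi> i \<in> obs_sp T i \<rightarrow>\<^sub>M act_sp T i"
  proof (rule measurable_discrete_difference[of "\<lambda>_. SOME u. u \<in> act T i"])
    show "(\<lambda>_. SOME u. u \<in> act T i) \<in> obs_sp T i \<rightarrow>\<^sub>M act_sp T i"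
      using some by simp
    show "countable (Z l n i)"
      using finite_Z[OF i l] by (rule countable_finite)
    show "{z} \<in> sets (obs_sp T i)" if "z \<in> Z l n i" for z
      using Z_sub[OF i l] that by (intro singleton_in_obs_sp) auto
    show "extend l n \<pi> i z \<in> space (act_sp T i)" if "z \<in> Z l n i" for z
      using \<pi> i that unfolding finite_policies_def extend_def by auto
    show "(SOME u. u \<in> act T i) = extend l n \<pi> i z" if "z \<notin> Z l n i" for z
      using that by (simp add: extend_def)
  qed
qed

lemma apply_extend: "y \<in> PiE I (Z l n) \<Longrightarrow> apply_policy T (extend l n \<pi>) y = apply_policy T \<pi> y"
  unfolding apply_policy_def extend_def by (intro restrict_ext) (auto simp: PiE_iff)

lemma quantize_finite_policy:
  assumes l: "1 \<le> l" "1 \<le> n" and \<pi>: "\<pi> \<in> finite_policies T net y0 l n G"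
  shows "quantize Q l n \<pi> \<in> policies T"
  unfolding policies_def
proof (intro CollectI ballI)
  fix i assume i: "i \<in> I"
  have "quantize Q l n (extend l n \<pi>) i \<in> obs_sp T i \<rightarrow>\<^sub>M act_sp T i"
    by (intro measurable_policy quantize_policy extend_policy[OF l \<pi>] l i)
  then show "quantize Q l n \<pi> i \<in> obs_sp T i \<rightarrow>\<^sub>M act_sp T i"
    by (rule measurable_cong[THEN iffD1, rotated]) (use Q_in_Z[OF i l] in \<open>simp add: quantize_def extend_def\<close>)
qed

lemma finite_policy_in_box:
  "\<pi> \<in> finite_policies T net y0 l n G \<Longrightarrow> y \<in> PiE I (Z l n) \<Longrightarrow> apply_policy T \<pi> y \<in> G"
  unfolding finite_policies_def by auto

lemma J_quantized_eq:
  assumes l: "1 \<le> l" "1 \<le> n" and \<pi>: "\<pi> \<in> finite_policies T net y0 l n G"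
  shows "expected_cost T (qlaw l n) scost \<pi> =
    (\<integral>\<^sup>+ x. ennreal (scost (fst x) (q l n (snd x)) (apply_policy T (extend l n \<pi>) (q l n (snd x)))) \<partial>law)"
proof -
  have "expected_cost T (qlaw l n) scost \<pi> =
      (\<integral>\<^sup>+ x. ennreal (scost (fst x) (snd x) (apply_policy T (extend l n \<pi>) (snd x))) \<partial>qlaw l n)"
    unfolding expected_cost_def split_beta'
    by (intro nn_integral_cong) (auto simp: space_quantized_law[OF l] apply_extend)
  also have "\<dots> = (\<integral>\<^sup>+ x. ennreal (scost (fst (fst x, q l n (snd x))) (snd (fst x, q l n (snd x)))
      (apply_policy T (extend l n \<pi>) (snd (fst x, q l n (snd x))))) \<partial>law)"
    using measurable_cost_policy[OF cost_measurable_static extend_policy[OF l \<pi>]]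
    by (intro nn_integral_quantized_law l) measurable
  finally show ?thesis
    by simp
qed

lemma J_quantize_eq:
  assumes l: "1 \<le> l" "1 \<le> n" and \<pi>: "\<pi> \<in> finite_policies T net y0 l n G"
  shows "J T (quantize Q l n \<pi>) =
    (\<integral>\<^sup>+ x. ennreal (scost (fst x) (snd x) (apply_policy T (extend l n \<pi>) (q l n (snd x)))) \<partial>law)"
  unfolding J_eq_static[OF quantize_finite_policy[OF l \<pi>]] Js_eq
  by (intro nn_integral_cong) (auto simp: space_static_law apply_quantize apply_extend q_in[OF l])

text \<open>A one-sided inequality is used twice. To bound the original cost, the majorant is
  \<open>sup_cost\<close> itself, whose tails are small by integrability. To bound the cost in the
  finite model, it is \<open>sup_cost\<close> at the codes, whose tails are small by uniform
  integrability. The policies may vary with \<open>k\<close> without converging; compactness of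
  \<open>G\<close> takes care of that.\<close>

lemma quantized_cost_close:
  assumes G: "compact_box T G" "G \<noteq> {}" and ui: "uniformly_integrable qlaw (sup_cost scost G)" and e: "(0::real) < e"
  shows "\<forall>\<^sub>F k in sequentially. \<forall>\<pi>\<in>finite_policies T net y0 (Suc k) (Suc k) G.
    J T (quantize Q (Suc k) (Suc k) \<pi>) \<le> expected_cost T (qlaw (Suc k) (Suc k)) scost \<pi> + ennreal e \<and>
    expected_cost T (qlaw (Suc k) (Suc k)) scost \<pi> \<le> J T (quantize Q (Suc k) (Suc k) \<pi>) + ennreal e"
proof (rule eventually_ball_choice)
  fix k
  obtain u where u: "u \<in> G"
    using G by blast
  \<comment> \<open>A constant policy with its action profile in the nonempty \<open>G\<close>
    provides the element that the selection principle asks for at each \<open>k\<close>.\<close>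
  have "(\<lambda>i _. u i) \<in> finite_policies T net y0 (Suc k) (Suc k) G"
    unfolding finite_policies_def
  proof (intro CollectI conjI ballI)
    show "(\<lambda>_. u i) \<in> quantized_obs net y0 (Suc k) (Suc k) i \<rightarrow> act T i" if "i \<in> I" for i
      using u box_sub[OF G(1)] that by (auto simp: act_prod_def PiE_iff)
    have "apply_policy T (\<lambda>i _. u i) y = u" for y
      using u box_sub[OF G(1)] unfolding apply_policy_def act_prod_def by (metis PiE_restrict subsetD)
    then show "apply_policy T (\<lambda>i _. u i) ` PiE I (quantized_obs net y0 (Suc k) (Suc k)) \<subseteq> G"
      using u by auto
  qed
  then show "finite_policies T net y0 (Suc k) (Suc k) G \<noteq> {}"
    by blast
next
  fix \<pi> assume \<pi>: "\<And>k. \<pi> k \<in> finite_policies T net y0 (Suc k) (Suc k) G"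
  interpret law: prob_space law
    by (rule prob_static_law)
  let ?w = "sup_cost scost G"
  let ?q = "\<lambda>k. q (Suc k) (Suc k)"
  define U where "U k y = apply_policy T (extend (Suc k) (Suc k) (\<pi> k)) (?q k y)" for k y
  define a where "a k x = scost (fst x) (?q k (snd x)) (U k (snd x))" for k x
  define b where "b k x = scost (fst x) (snd x) (U k (snd x))" for k x
  have ext: "extend (Suc k) (Suc k) (\<pi> k) \<in> policies T" for k
    by (rule extend_policy[OF _ _ \<pi>]) simp_all
  have am[measurable]: "a k \<in> borel_measurable law" for k
  proof (rule measurable_static)
    show "a k \<in> borel_measurable SO"
      using measurable_compose[OF measurable_fst_q[of "Suc k" "Suc k"] measurable_cost_policy[OF cost_measurable_static ext[of k]]]
      by (simp add: a_def[abs_def] U_def)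
  qed
  have bm[measurable]: "b k \<in> borel_measurable law" for k
    using measurable_static_cost_policy[OF quantize_policy[OF ext[of k], of "Suc k" "Suc k"]]
    by (simp add: b_def[abs_def] U_def apply_quantize)
  have UG: "U k y \<in> G" if "y \<in> obs_prod T" for k y
    using finite_policy_in_box[OF \<pi>[of k]] q_in[of "Suc k" "Suc k" y] that
    by (simp add: U_def apply_extend)
  have qo: "?q k y \<in> obs_prod T" if "y \<in> obs_prod T" for k y
    using q_obs[of "Suc k" "Suc k" y] that by simp
  have G_act: "G \<subseteq> act_prod T"
    by (rule box_sub[OF G(1)])
  have a0: "0 \<le> a k x" and b0: "0 \<le> b k x" if "x \<in> space law" for k x
    using that UG[of "snd x" k] G_act qo[of "snd x" k] unfolding a_def b_def
    by (auto simp: space_static_law intro!: static_cost_nonneg)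
  have wm[measurable]: "?w \<in> borel_measurable law"
    by (rule measurable_static[OF measurable_sup_static[OF G(1)]])
  have wqm[measurable]: "(\<lambda>x. ?w (fst x, ?q k (snd x))) \<in> borel_measurable law" for k
    by (rule measurable_static, rule measurable_compose[OF measurable_fst_q measurable_sup_static[OF G(1)]]) auto
  have lim: "(\<lambda>k. a k x - b k x) \<longlonglongrightarrow> 0" if x: "x \<in> space law" for x
    unfolding a_def b_def
  proof (rule tendsto_diff_compact_param[where c = "scost (fst x)" and z = "\<lambda>k. ?q k (snd x)"
        and u = "\<lambda>k. U k (snd x)" and y = "snd x" and Y = "obs_prod T" and U = "act_prod T" and G = G])
    show "continuous_on (obs_prod T \<times> act_prod T) (\<lambda>(y, u). scost (fst x) y u)"
      using static_cost_cont x by (auto simp: cost_continuous_def space_static_law)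
    show "compact G" "G \<subseteq> act_prod T"
      using box_compact[OF G(1)] G_act by auto
    show "(\<lambda>k. ?q k (snd x)) \<longlonglongrightarrow> snd x"
      using x by (intro q_tendsto) (auto simp: space_static_law)
  qed (use x UG qo in \<open>auto simp: space_static_law\<close>)
  have lim': "(\<lambda>k. b k x - a k x) \<longlonglongrightarrow> 0" if x: "x \<in> space law" for x
    using tendsto_minus[OF lim[OF x]] by simp
  \<comment> \<open>The tail bounds are \<open>e / 2\<close> because
    \<open>eventually_nn_integral_le\<close> loses twice the tail bound.\<close>
  obtain R where R: "(\<integral>\<^sup>+ x\<in>{x \<in> space law. ennreal R < ?w x}. ?w x \<partial>law) \<le> ennreal (e / 2)"
    using nn_integral_tail_small[OF wm, of "e / 2"] nn_integrable_sup_static[OF G(1) ui] e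
    unfolding nn_integrable_def by auto
  obtain R' where R': "\<And>l n. 1 \<le> l \<Longrightarrow> 1 \<le> n \<Longrightarrow>
      (\<integral>\<^sup>+ x\<in>{x \<in> space (qlaw l n). ennreal R' < ?w x}. ?w x \<partial>qlaw l n) \<le> ennreal (e / 2)"
    using uniformly_integrable_tail[OF ui, of "e / 2"] e by auto
  have "\<forall>\<^sub>F k in sequentially. (\<integral>\<^sup>+ x. b k x \<partial>law) \<le> (\<integral>\<^sup>+ x. a k x \<partial>law) + ennreal (2 * (e / 2))"
  proof (rule law.eventually_nn_integral_le[where v = "\<lambda>_. ?w"])
    show "ennreal (b k x) \<le> ?w x" if "x \<in> space law" for k x
      using sup_static_upper[OF UG[of "snd x" k], of "fst x" "snd x"] that by (auto simp: b_def space_static_law)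
  qed (use a0 lim' R e in auto)
  moreover have "\<forall>\<^sub>F k in sequentially. (\<integral>\<^sup>+ x. a k x \<partial>law) \<le> (\<integral>\<^sup>+ x. b k x \<partial>law) + ennreal (2 * (e / 2))"
  proof (rule law.eventually_nn_integral_le[where v = "\<lambda>k x. ?w (fst x, ?q k (snd x))"])
    show "ennreal (a k x) \<le> ?w (fst x, ?q k (snd x))" if "x \<in> space law" for k x
      using sup_static_upper[OF UG[of "snd x" k], of "fst x" "?q k (snd x)"] that by (auto simp: a_def space_static_law)
    show "(\<integral>\<^sup>+ x\<in>{x \<in> space law. ennreal R' < ?w (fst x, ?q k (snd x))}. ?w (fst x, ?q k (snd x)) \<partial>law) \<le> ennreal (e / 2)" for k
      using R'[of "Suc k" "Suc k"] tail_pullback[OF _ _ measurable_sup_static[OF G(1)], of "Suc k" "Suc k"] by simp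
  qed (use b0 lim e in auto)
  ultimately show "\<forall>\<^sub>F k in sequentially.
    J T (quantize Q (Suc k) (Suc k) (\<pi> k)) \<le> expected_cost T (qlaw (Suc k) (Suc k)) scost (\<pi> k) + ennreal e \<and>
    expected_cost T (qlaw (Suc k) (Suc k)) scost (\<pi> k) \<le> J T (quantize Q (Suc k) (Suc k) (\<pi> k)) + ennreal e"
  proof eventually_elim
    case (elim k)
    have "J T (quantize Q (Suc k) (Suc k) (\<pi> k)) = (\<integral>\<^sup>+ x. b k x \<partial>law)"
      using J_quantize_eq[OF _ _ \<pi>[of k]] by (simp add: b_def U_def)
    moreover have "expected_cost T (qlaw (Suc k) (Suc k)) scost (\<pi> k) = (\<integral>\<^sup>+ x. a k x \<partial>law)"
      using J_quantized_eq[OF _ _ \<pi>[of k]] by (simp add: a_def U_def)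
    ultimately show ?case
      using elim by simp
  qed
qed

text \<open>A constant policy has its actions in a box of singletons, where integrability of
  \<open>sup_cost\<close> bounds its cost. Finiteness provides a near-optimal policy to which (e)
  applies, and it makes the strict inequality in (2) possible.\<close>

lemma J_opt_finite:
  assumes ui: "\<And>G. compact_box T G \<Longrightarrow> uniformly_integrable qlaw (sup_cost scost G)"
  shows "J_opt T < \<infinity>"
proof -
  have "\<forall>i\<in>I. \<exists>u. u \<in> act T i"
    using act_nonempty by blast
  from bchoice[OF this] obtain u where u: "\<And>i. i \<in> I \<Longrightarrow> u i \<in> act T i"
    by blast
  define G where "G = PiE I (\<lambda>i. {u i})"
  have G: "compact_box T G"
    unfolding compact_box_def G_def using u by (intro exI[of _ "\<lambda>i. {u i}"]) simp
  have \<gamma>: "(\<lambda>i _. u i) \<in> policies T"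
    using u by (simp add: policies_def)
  have "Js (\<lambda>i _. u i) \<le> (\<integral>\<^sup>+ x. sup_cost scost G x \<partial>law)"
    unfolding Js_eq
  proof (rule nn_integral_mono)
    fix x :: "'w \<times> (nat \<Rightarrow> 'y)"
    have "apply_policy T (\<lambda>i _. u i) (snd x) \<in> G"
      by (auto simp: apply_policy_def G_def)
    then show "ennreal (scost (fst x) (snd x) (apply_policy T (\<lambda>i _. u i) (snd x))) \<le> sup_cost scost G x"
      using sup_static_upper[of _ G "fst x" "snd x"] by simp
  qed
  also have "\<dots> < \<infinity>"
    using nn_integrable_sup_static[OF G ui[OF G]] by (simp add: nn_integrable_def)
  finally have "J T (\<lambda>i _. u i) < \<infinity>"
    by (simp add: J_eq_static[OF \<gamma>])
  moreover have "J_opt T \<le> J T (\<lambda>i _. u i)"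
    unfolding J_opt_def by (rule INF_lower[OF \<gamma>])
  ultimately show ?thesis
    by (rule le_less_trans[rotated])
qed

text \<open>The common source of both approximation properties. The box is fixed before
  \<open>k\<close>, so that closeness of the finite models over \<open>G\<close> can later be
  imposed at the same \<open>k\<close>. Of the error, \<open>e / 4\<close> goes to a near-optimal
  policy, \<open>e / 4\<close> to truncation, shared equally among the agents, and
  \<open>e / 2\<close> to quantization.\<close>

lemma near_optimal_sequence:
  assumes fc: "finite_constant_deviations T (J T)"
    and ui: "\<And>G. compact_box T G \<Longrightarrow> uniformly_integrable qlaw (sup_cost scost G)" and e: "(0::real) < e"
  shows "\<exists>G \<pi>. compact_box T G \<and> G \<noteq> {} \<and> (\<forall>k. \<pi> k \<in> policies T) \<and>
    (\<forall>k. \<pi> k \<in> finite_policies T net y0 (Suc k) (Suc k) G) \<and>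
    (\<forall>\<^sub>F k in sequentially. J T (quantize Q (Suc k) (Suc k) (\<pi> k)) \<le> J_opt T + ennreal e)"
proof -
  interpret law: prob_space law
    by (rule prob_static_law)
  have N: "1 \<le> agents T"
    using team by (simp add: sequential_team_def)
  have "J_opt T < J_opt T + ennreal (e / 4)"
    using J_opt_finite[OF ui] e ennreal_add_left_cancel_less[of "J_opt T" 0 "ennreal (e / 4)"] by simp
  then obtain \<gamma>0 where \<gamma>0: "\<gamma>0 \<in> policies T" "J T \<gamma>0 < J_opt T + ennreal (e / 4)"
    unfolding J_opt_def INF_less_iff by blast
  have fin0: "Js \<gamma>0 < \<infinity>"
    using less_trans[OF \<gamma>0(2), of top] J_opt_finite[OF ui] by (simp add: J_eq_static[OF \<gamma>0(1)])
  have "\<exists>\<gamma>\<in>policies T. (\<forall>i\<in>I. tame i (\<gamma> i)) \<and> Js \<gamma> \<le> Js \<gamma>0 + ennreal (real (agents T) * (e / (4 * real (agents T))))"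
    using e N by (intro truncate_policy finite_constant_deviations_static fc \<gamma>0(1) fin0) auto
  then obtain \<gamma> where \<gamma>: "\<gamma> \<in> policies T" "\<And>i. i \<in> I \<Longrightarrow> tame i (\<gamma> i)" "Js \<gamma> \<le> Js \<gamma>0 + ennreal (e / 4)"
    using N by auto
  have "Js \<gamma> \<le> J_opt T + ennreal (e / 4) + ennreal (e / 4)"
    using \<gamma>(3) add_right_mono[OF less_imp_le[OF \<gamma>0(2)], of "ennreal (e / 4)"]
    by (simp add: J_eq_static[OF \<gamma>0(1)] order_trans)
  then have J\<gamma>: "Js \<gamma> \<le> J_opt T + ennreal (e / 2)"
    using e by (simp add: add.assoc ennreal_plus[symmetric] del: ennreal_plus)
  define A where "A i \<pi> B \<longleftrightarrow> compact B \<and> B \<noteq> {} \<and> B \<subseteq> act T i \<and> (\<forall>y\<in>obs T i. \<gamma> i y \<in> B) \<and>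
    (\<forall>k z. \<pi> k z \<in> B) \<and> (\<forall>k. \<pi> k \<in> obs_sp T i \<rightarrow>\<^sub>M act_sp T i) \<and>
    (\<forall>y\<in>obs T i. (\<lambda>k. \<pi> k (Q i (Suc k) (Suc k) y)) \<longlonglongrightarrow> \<gamma> i y)" for i \<pi> B
  have "\<exists>\<pi> B. A i \<pi> B" if "i \<in> I" for i
    using tame_approximation[OF that \<gamma>(2)[OF that]] unfolding A_def .
  then obtain p B where "\<And>i. i \<in> I \<Longrightarrow> A i (p i) (B i)"
    by metis
  note AB = this[unfolded A_def]
  have B: "compact (B i)" "B i \<noteq> {}" "B i \<subseteq> act T i" "\<And>k z. p i k z \<in> B i"
      "\<And>k. p i k \<in> obs_sp T i \<rightarrow>\<^sub>M act_sp T i"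
      "\<And>y. y \<in> obs T i \<Longrightarrow> (\<lambda>k. p i k (Q i (Suc k) (Suc k) y)) \<longlonglongrightarrow> \<gamma> i y" if "i \<in> I" for i
    using AB[OF that] by simp_all
  define G where "G = PiE I B"
  define \<pi> where "\<pi> k i = p i k" for k i
  have G: "compact_box T G"
    unfolding compact_box_def G_def using B(1,3) by (intro exI[of _ B]) simp
  have "G \<noteq> {}"
    unfolding G_def PiE_eq_empty_iff using B(2) by simp
  moreover have \<pi>p: "\<pi> k \<in> policies T" for k
    using B(5) by (simp add: policies_def \<pi>_def)
  moreover have \<pi>G: "apply_policy T (\<pi> k) y \<in> G" for k y
    using B(4) unfolding apply_policy_def \<pi>_def G_def by (intro restrict_PiE_iff[THEN iffD2]) simp
  moreover have "\<pi> k \<in> finite_policies T net y0 (Suc k) (Suc k) G" for k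
    unfolding finite_policies_def
  proof (intro CollectI conjI ballI)
    show "\<pi> k i \<in> quantized_obs net y0 (Suc k) (Suc k) i \<rightarrow> act T i" if "i \<in> I" for i
      using B(3,4)[OF that] by (auto simp: \<pi>_def)
    show "apply_policy T (\<pi> k) ` PiE I (quantized_obs net y0 (Suc k) (Suc k)) \<subseteq> G"
      using \<pi>G by blast
  qed
  moreover have "\<forall>\<^sub>F k in sequentially. J T (quantize Q (Suc k) (Suc k) (\<pi> k)) \<le> J_opt T + ennreal e"
  proof -
    let ?w = "sup_cost scost G"
    let ?qp = "\<lambda>k. quantize Q (Suc k) (Suc k) (\<pi> k)"
    have qp: "?qp k \<in> policies T" for k
      by (rule quantize_policy[OF \<pi>p]) simp_all
    have wm[measurable]: "?w \<in> borel_measurable law"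
      by (rule measurable_static[OF measurable_sup_static[OF G]])
    obtain R where R: "(\<integral>\<^sup>+ x\<in>{x \<in> space law. ennreal R < ?w x}. ?w x \<partial>law) \<le> ennreal (e / 4)"
      using nn_integral_tail_small[OF wm, of "e / 4"] nn_integrable_sup_static[OF G ui[OF G]] e
      unfolding nn_integrable_def by auto
    have "\<forall>\<^sub>F k in sequentially. (\<integral>\<^sup>+ x. scost (fst x) (snd x) (apply_policy T (?qp k) (snd x)) \<partial>law) \<le>
        (\<integral>\<^sup>+ x. scost (fst x) (snd x) (apply_policy T \<gamma> (snd x)) \<partial>law) + ennreal (2 * (e / 4))"
    \<comment> \<open>The majorant concerns the quantized policies, all with values in
      \<open>G\<close>. Only the actions are quantized here, while the cost still sees the true
      observations, so pointwise convergence uses continuity in the action argument.\<close>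
    proof (rule law.eventually_nn_integral_le[where v = "\<lambda>_. ?w" and R = R])
      show "0 \<le> scost (fst x) (snd x) (apply_policy T \<gamma> (snd x))" if "x \<in> space law" for x
        using that by (intro static_cost_nonneg apply_policy_in \<gamma>(1)) (auto simp: space_static_law)
      show "ennreal (scost (fst x) (snd x) (apply_policy T (?qp k) (snd x))) \<le> ?w x" for k x
        using sup_static_upper[OF \<pi>G[of k], of "fst x" "snd x"] by (simp add: apply_quantize)
      fix x assume "x \<in> space law"
      then have x: "fst x \<in> states T" "snd x \<in> obs_prod T"
        by (auto simp: space_static_law)
      have "(\<lambda>k. apply_policy T (?qp k) (snd x)) \<longlonglongrightarrow> apply_policy T \<gamma> (snd x)"
        unfolding tendsto_fun_iff
      proof
        fix i
        show "(\<lambda>k. apply_policy T (?qp k) (snd x) i) \<longlonglongrightarrow> apply_policy T \<gamma> (snd x) i"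
        proof (cases "i \<in> I")
          case True
          then have "snd x i \<in> obs T i"
            using x(2) unfolding obs_prod_def by (rule PiE_mem[rotated])
          then show ?thesis
            using B(6)[OF True] True by (simp add: apply_policy_def quantize_def \<pi>_def)
        next
          case False
          then show ?thesis
            by (simp add: apply_policy_def del: atLeastAtMost_iff)
        qed
      qed
      then have lim: "(\<lambda>k. (snd x, apply_policy T (?qp k) (snd x))) \<longlonglongrightarrow> (snd x, apply_policy T \<gamma> (snd x))"
        by (rule tendsto_Pair[OF tendsto_const])
      have cont: "continuous_on (obs_prod T \<times> act_prod T) (\<lambda>(y, u). scost (fst x) y u)"
        using static_cost_cont x(1) by (simp add: cost_continuous_def)
      have "(\<lambda>k. (\<lambda>(y, u). scost (fst x) y u) (snd x, apply_policy T (?qp k) (snd x)))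
          \<longlonglongrightarrow> (\<lambda>(y, u). scost (fst x) y u) (snd x, apply_policy T \<gamma> (snd x))"
        by (rule continuous_on_tendsto_compose[OF cont lim])
           (use x apply_policy_in[OF \<gamma>(1)] apply_policy_in[OF qp] in simp_all)
      then have "(\<lambda>k. scost (fst x) (snd x) (apply_policy T (?qp k) (snd x)))
          \<longlonglongrightarrow> scost (fst x) (snd x) (apply_policy T \<gamma> (snd x))"
        by simp
      then show "(\<lambda>k. scost (fst x) (snd x) (apply_policy T (?qp k) (snd x)) - scost (fst x) (snd x) (apply_policy T \<gamma> (snd x))) \<longlonglongrightarrow> 0"
        by (rule LIM_zero)
    qed (use R e measurable_static_cost_policy[OF \<gamma>(1)] measurable_static_cost_policy[OF qp] in simp_all)
    then show ?thesis
    proof eventually_elim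
      case (elim k)
      have "J T (?qp k) \<le> Js \<gamma> + ennreal (e / 2)"
        using elim by (simp add: J_eq_static[OF qp] Js_eq)
      also have "\<dots> \<le> J_opt T + ennreal (e / 2) + ennreal (e / 2)"
        by (rule add_right_mono[OF J\<gamma>])
      also have "\<dots> = J_opt T + ennreal e"
        using e by (simp add: add.assoc ennreal_plus[symmetric] del: ennreal_plus)
      finally show ?case .
    qed
  qed
  ultimately show ?thesis
    using G by blast
qed

lemma quantized_policies_near_optimal:
  assumes fc: "finite_constant_deviations T (J T)"
    and ui: "\<And>G. compact_box T G \<Longrightarrow> uniformly_integrable qlaw (sup_cost scost G)"
  shows "quantized_policies_near_optimal T Q"
  unfolding quantized_policies_near_optimal_def
proof (intro allI impI)
  fix e :: real assume e: "0 < e"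
  obtain \<pi> where \<pi>: "\<And>k. \<pi> k \<in> policies T" and
    ev: "\<forall>\<^sub>F k in sequentially. J T (quantize Q (Suc k) (Suc k) (\<pi> k)) \<le> J_opt T + ennreal (e / 2)"
    using near_optimal_sequence[OF fc ui, of "e / 2"] e by auto
  obtain k where k: "J T (quantize Q (Suc k) (Suc k) (\<pi> k)) \<le> J_opt T + ennreal (e / 2)"
    using eventually_happens'[OF sequentially_bot ev] by blast
  \<comment> \<open>Working with \<open>e / 2\<close> leaves a gap, which is strict because
    \<open>J_opt T\<close> is finite.\<close>
  have "J_opt T + ennreal (e / 2) < J_opt T + ennreal e"
    using J_opt_finite[OF ui] e by (simp add: ennreal_add_left_cancel_less ennreal_less_iff)
  with k have "J T (quantize Q (Suc k) (Suc k) (\<pi> k)) < J_opt T + ennreal e"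
    by (rule le_less_trans)
  then show "\<exists>l\<ge>1. \<exists>n\<ge>1. \<exists>\<gamma>\<in>quantize Q l n ` policies T. J T \<gamma> < J_opt T + ennreal e"
    using \<pi>[of k] by (intro exI[of _ "Suc k"] conjI bexI[of _ "quantize Q (Suc k) (Suc k) (\<pi> k)"] imageI) simp_all
qed

text \<open>The error has four quarters: from the original cost of the chosen policy to its cost in
  the finite model, the slack \<delta> in the minimization, from the finite-model cost of the
  reference policy \<open>\<pi> k\<close> back to its original cost, and from there to
  \<open>J_opt T\<close>.\<close>

lemma finite_models_near_optimal:
  assumes fc: "finite_constant_deviations T (J T)"
    and ui: "\<And>G. compact_box T G \<Longrightarrow> uniformly_integrable qlaw (sup_cost scost G)"
  shows "finite_models_near_optimal T f \<nu> net y0 Q"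
  unfolding finite_models_near_optimal_def Let_def
proof (intro allI impI)
  fix e :: real assume e: "0 < e"
  then have e4: "0 < e / 4"
    by simp
  obtain G \<pi> where G: "compact_box T G" "G \<noteq> {}"
    and \<pi>: "\<And>k. \<pi> k \<in> finite_policies T net y0 (Suc k) (Suc k) G"
    and ev: "\<forall>\<^sub>F k in sequentially. J T (quantize Q (Suc k) (Suc k) (\<pi> k)) \<le> J_opt T + ennreal (e / 4)"
    using near_optimal_sequence[OF fc ui e4] by blast
  obtain k where opt: "J T (quantize Q (Suc k) (Suc k) (\<pi> k)) \<le> J_opt T + ennreal (e / 4)"
    and close: "\<And>\<rho>. \<rho> \<in> finite_policies T net y0 (Suc k) (Suc k) G \<Longrightarrow>
      J T (quantize Q (Suc k) (Suc k) \<rho>) \<le> expected_cost T (qlaw (Suc k) (Suc k)) scost \<rho> + ennreal (e / 4) \<and>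
      expected_cost T (qlaw (Suc k) (Suc k)) scost \<rho> \<le> J T (quantize Q (Suc k) (Suc k) \<rho>) + ennreal (e / 4)"
    using eventually_happens'[OF sequentially_bot eventually_conj[OF ev quantized_cost_close[OF G ui[OF G(1)] e4]]] by blast
  let ?\<Pi> = "finite_policies T net y0 (Suc k) (Suc k) G"
  let ?J = "expected_cost T (qlaw (Suc k) (Suc k)) scost"
  have "J T (quantize Q (Suc k) (Suc k) \<rho>) \<le> J_opt T + ennreal e"
    if \<rho>: "\<rho> \<in> ?\<Pi>" "?J \<rho> \<le> (INF \<pi>'\<in>?\<Pi>. ?J \<pi>') + ennreal (e / 4)" for \<rho>
  proof -
    have "J T (quantize Q (Suc k) (Suc k) \<rho>) \<le> ?J \<rho> + ennreal (e / 4)"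
      using close[OF \<rho>(1)] by blast
    also have "?J \<rho> \<le> ?J (\<pi> k) + ennreal (e / 4)"
      using \<rho>(2) INF_lower[OF \<pi>[of k], of ?J] by (meson add_right_mono order_trans)
    also have "?J (\<pi> k) \<le> J T (quantize Q (Suc k) (Suc k) (\<pi> k)) + ennreal (e / 4)"
      using close[OF \<pi>[of k]] by blast
    also note opt
    finally have "J T (quantize Q (Suc k) (Suc k) \<rho>) \<le>
        J_opt T + ennreal (e / 4) + ennreal (e / 4) + ennreal (e / 4) + ennreal (e / 4)"
      by (simp add: add_right_mono)
    also have "\<dots> = J_opt T + ennreal e"
      using e by (simp add: add.assoc ennreal_plus[symmetric] del: ennreal_plus)
    finally show ?thesis .
  qed
  then show "\<exists>l\<ge>1. \<exists>n\<ge>1. \<exists>G. \<exists>\<delta>>0. compact_box T G \<and> G \<noteq> {} \<and>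
      (\<forall>\<pi>\<in>finite_policies T net y0 l n G.
        expected_cost T (qlaw l n) scost \<pi> \<le> (INF \<pi>'\<in>finite_policies T net y0 l n G. expected_cost T (qlaw l n) scost \<pi>') + ennreal \<delta> \<longrightarrow>
        J T (quantize Q l n \<pi>) \<le> J_opt T + ennreal e)"
    using G e4 by (intro exI[of _ "Suc k"] exI[of _ G] exI[of _ "e / 4"] conjI ballI impI) simp_all
qed

section \<open>Bounded densities\<close>

lemma sup_static_cost_le:
  assumes d: "densities_bounded T f"
  shows "\<exists>C\<ge>1. \<forall>G x. G \<subseteq> act_prod T \<longrightarrow> x \<in> states T \<times> obs_prod T \<longrightarrow> sup_cost scost G x \<le> ennreal C * sup_cost (cost T) G x"
proof -
  have "\<exists>b. \<forall>x\<in>states T \<times> act_before T i \<times> obs T i. \<bar>(\<lambda>(\<omega>, u, y). f i \<omega> u y) x\<bar> \<le> b" if "i \<in> I" for i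
    using d that unfolding densities_bounded_def by (auto simp: bounded_iff)
  then obtain b where b: "\<And>i x. i \<in> I \<Longrightarrow> x \<in> states T \<times> act_before T i \<times> obs T i \<Longrightarrow> \<bar>(\<lambda>(\<omega>, u, y). f i \<omega> u y) x\<bar> \<le> b i"
    by metis
  \<comment> \<open>Every factor is raised to at least 1, which makes \<open>C\<close> safe to
    divide by later. It depends on the densities alone, so one constant serves all boxes.\<close>
  define C where "C = (\<Prod>i\<in>I. max 1 (b i))"
  have C: "1 \<le> C"
    unfolding C_def by (intro prod_ge_1) simp
  have "sup_cost scost G x \<le> ennreal C * sup_cost (cost T) G x"
    if G: "G \<subseteq> act_prod T" and x: "x \<in> states T \<times> obs_prod T" for G x
  proof -
    obtain \<omega> y where xy: "x = (\<omega>, y)" "\<omega> \<in> states T" "y \<in> obs_prod T"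
      using x by blast
    have "ennreal (scost \<omega> y u) \<le> ennreal C * sup_cost (cost T) G (\<omega>, y)" if u: "u \<in> G" for u
    proof -
      have ua: "u \<in> act_prod T"
        using u G by blast
      have "\<bar>f i \<omega> (restrict u {1..<i}) (y i)\<bar> \<le> max 1 (b i)" if i: "i \<in> I" for i
        using b[OF i, of "(\<omega>, restrict u {1..<i}, y i)"] restrict_act_prod[OF i ua] xy PiE_mem[OF _ i, of y "obs T"]
        by (simp add: obs_prod_def)
      then have "(\<Prod>i\<in>I. \<bar>f i \<omega> (restrict u {1..<i}) (y i)\<bar>) \<le> C"
        unfolding C_def by (intro prod_mono) simp
      then have "(\<Prod>i\<in>I. f i \<omega> (restrict u {1..<i}) (y i)) \<le> C"
        unfolding abs_prod[symmetric] by linarith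
      then have "scost \<omega> y u \<le> C * cost T \<omega> y u"
        unfolding static_cost_def using cost_nonneg[OF xy(2,3) ua] by (subst mult.commute) (rule mult_right_mono)
      then have "ennreal (scost \<omega> y u) \<le> ennreal C * ennreal (cost T \<omega> y u)"
        using C cost_nonneg[OF xy(2,3) ua] by (simp add: ennreal_mult[symmetric] ennreal_leI)
      also have "\<dots> \<le> ennreal C * sup_cost (cost T) G (\<omega>, y)"
        unfolding sup_cost_def using u by (intro mult_left_mono) (auto intro: SUP_upper)
      finally show ?thesis .
    qed
    then show ?thesis
      unfolding xy(1) sup_cost_def[of scost] by (auto intro!: SUP_least)
  qed
  with C show ?thesis
    by blast
qed

text \<open>Where the static supremum exceeds \<open>R\<close>, the original one exceeds
  \<open>R / C\<close>. The tail at \<open>R\<close> is thus at most \<open>C\<close> times the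
  original tail at \<open>R / C\<close>, and \<open>R / C\<close> tends to infinity with
  \<open>R\<close>.\<close>

lemma uniformly_integrable_static:
  assumes d: "densities_bounded T f" and G: "compact_box T G"
    and ui: "uniformly_integrable qlaw (sup_cost (cost T) G)"
  shows "uniformly_integrable qlaw (sup_cost scost G)"
proof -
  let ?w = "sup_cost (cost T) G"
  let ?ws = "sup_cost scost G"
  let ?F = "\<lambda>w R. SUP (l, n)\<in>{1..} \<times> {1..}. \<integral>\<^sup>+ x\<in>{x \<in> space (qlaw l n). ennreal R < w x}. w x \<partial>qlaw l n"
  obtain C where C: "1 \<le> C" and le: "\<And>x. x \<in> states T \<times> obs_prod T \<Longrightarrow> ?ws x \<le> ennreal C * ?w x"
    using sup_static_cost_le[OF d] box_sub[OF G] by blast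
  have wm: "?w \<in> borel_measurable SO"
    by (rule measurable_sup_cost[OF cost_measurable_cost cost_cont G])
  have bound: "?F ?ws R \<le> ennreal C * ?F ?w (R / C)" for R :: real
  proof (rule SUP_least, clarify)
    fix l n :: nat assume l: "1 \<le> l" "1 \<le> n"
    have [measurable]: "?w \<in> borel_measurable (qlaw l n)"
      by (rule measurable_quantized_law[OF l wm])
    have "(\<integral>\<^sup>+ x\<in>{x \<in> space (qlaw l n). ennreal R < ?ws x}. ?ws x \<partial>qlaw l n) \<le>
        (\<integral>\<^sup>+ x. ennreal C * (?w x * indicator {x \<in> space (qlaw l n). ennreal (R / C) < ?w x} x) \<partial>qlaw l n)"
    proof (rule nn_integral_mono)
      fix x assume x: "x \<in> space (qlaw l n)"
      then have "x \<in> states T \<times> obs_prod T"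
        using Z_prod_sub[OF l] unfolding space_quantized_law[OF l] by blast
      note lex = le[OF this]
      have "ennreal (R / C) < ?w x" if "ennreal R < ?ws x"
      proof (rule ccontr)
        assume "\<not> ennreal (R / C) < ?w x"
        then have "ennreal C * ?w x \<le> ennreal C * ennreal (R / C)"
          by (intro mult_left_mono) auto
        also have "\<dots> = ennreal R"
          using C by (simp add: ennreal_mult'[symmetric])
        finally show False
          using that lex by (meson leD order_trans)
      qed
      then show "?ws x * indicator {x \<in> space (qlaw l n). ennreal R < ?ws x} x \<le>
          ennreal C * (?w x * indicator {x \<in> space (qlaw l n). ennreal (R / C) < ?w x} x)"
        using x lex by (simp add: indicator_def)
    qed
    also have "\<dots> = ennreal C * (\<integral>\<^sup>+ x\<in>{x \<in> space (qlaw l n). ennreal (R / C) < ?w x}. ?w x \<partial>qlaw l n)"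
      by (rule nn_integral_cmult) measurable
    also have "\<dots> \<le> ennreal C * ?F ?w (R / C)"
      using l by (intro mult_left_mono SUP_upper2[where i = "(l, n)"]) auto
    finally show "(\<integral>\<^sup>+ x\<in>{x \<in> space (qlaw l n). ennreal R < ?ws x}. ?ws x \<partial>qlaw l n) \<le> ennreal C * ?F ?w (R / C)" .
  qed
  have "filterlim (\<lambda>R::real. R / C) at_top at_top"
    using filterlim_tendsto_pos_mult_at_top[OF tendsto_const _ filterlim_ident, of "1 / C"] C by simp
  then have "((\<lambda>R. ?F ?w (R / C)) \<longlongrightarrow> 0) at_top"
    using ui unfolding uniformly_integrable_def by (rule filterlim_compose[rotated])
  then have "((\<lambda>R. ennreal C * ?F ?w (R / C)) \<longlongrightarrow> ennreal C * 0) at_top"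
    by (intro ennreal_tendsto_cmult) auto
  then have "((\<lambda>R. ennreal C * ?F ?w (R / C)) \<longlongrightarrow> 0) at_top"
    by simp
  then have "(?F ?ws \<longlongrightarrow> 0) at_top"
    by (rule tendsto_sandwich[OF always_eventually always_eventually tendsto_const, rotated 2])
       (use bound in simp_all)
  then show ?thesis
    unfolding uniformly_integrable_def .
qed

end

theorem theorem8:
  fixes T :: "('w::polish_space, 'y::polish_space, 'u::completely_metrizable_lcs) team"
    and f :: "nat \<Rightarrow> 'w \<Rightarrow> (nat \<Rightarrow> 'u) \<Rightarrow> 'y \<Rightarrow> real"
    and \<nu> :: "nat \<Rightarrow> 'y measure"
    and K :: "nat \<Rightarrow> nat \<Rightarrow> 'y set"
    and net :: "nat \<Rightarrow> nat \<Rightarrow> nat \<Rightarrow> 'y set"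
    and y0 :: "nat \<Rightarrow> 'y"
    and Q :: "nat \<Rightarrow> nat \<Rightarrow> nat \<Rightarrow> 'y \<Rightarrow> 'y"
  assumes team: "sequential_team T"
    and a_continuous: "cost_continuous T (cost T)"
    and a_bounded: "\<And>C. compact C \<Longrightarrow> C \<subseteq> states T \<times> obs_prod T \<times> act_prod T \<Longrightarrow>
          bounded ((\<lambda>(\<omega>, y, u). cost T \<omega> y u) ` C)"
    and b: "act_closed_convex T"
    and c: "obs_locally_compact T"
    and e: "finite_constant_deviations T (J T)"
    and AC: "dominated T f \<nu>"
    and f_continuous: "densities_continuous T f"
    and quantizers: "quantizers T K net y0 Q"
  shows
    "((\<forall>G. compact_box T G \<longrightarrow>
         uniformly_integrable (quantized_law T \<nu> net y0 Q) (sup_cost (static_cost T f) G))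
      \<longrightarrow>
        (cost_continuous T (static_cost T f) \<and>
         (\<forall>C. compact C \<and> C \<subseteq> states T \<times> obs_prod T \<times> act_prod T \<and>
            (\<forall>i\<in>{1..agents T}. bounded ((\<lambda>(\<omega>, y, u). f i \<omega> (restrict u {1..<i}) (y i)) ` C)) \<longrightarrow>
            bounded ((\<lambda>(\<omega>, y, u). static_cost T f \<omega> y u) ` C)) \<and>
         act_closed_convex T \<and>
         obs_locally_compact T \<and>
         finite_constant_deviations T (expected_cost T (static_law T \<nu>) (static_cost T f)) \<and>
         (\<forall>G. compact_box T G \<longrightarrow>
            nn_integrable (static_law T \<nu>) (sup_cost (static_cost T f) G) \<and>
            uniformly_integrable (quantized_law T \<nu> net y0 Q) (sup_cost (static_cost T f) G))) \<and>
        quantized_policies_near_optimal T Q \<and>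
        finite_models_near_optimal T f \<nu> net y0 Q)
     \<and>
     (densities_bounded T f \<and>
      (\<forall>G. compact_box T G \<longrightarrow>
         nn_integrable (static_law T \<nu>) (sup_cost (cost T) G) \<and>
         uniformly_integrable (quantized_law T \<nu> net y0 Q) (sup_cost (cost T) G))
      \<longrightarrow>
        quantized_policies_near_optimal T Q \<and>
        finite_models_near_optimal T f \<nu> net y0 Q)"
proof -
  interpret quantized_team T f \<nu> K net y0 Q
    by unfold_locales (fact team AC quantizers a_continuous f_continuous)+
  \<comment> \<open>Bounded densities reduce the last assertion to the uniform integrability assumed
    in the first.\<close>
  have static_ui: "uniformly_integrable qlaw (sup_cost scost G)"
    if "densities_bounded T f \<and> (\<forall>G. compact_box T G \<longrightarrow>
      nn_integrable law (sup_cost (cost T) G) \<and> uniformly_integrable qlaw (sup_cost (cost T) G))"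
      "compact_box T G" for G
    using that by (intro uniformly_integrable_static) simp_all
  show ?thesis
  proof (intro conjI impI)
    show "cost_continuous T scost"
      by (rule static_cost_cont)
    show "\<forall>C. compact C \<and> C \<subseteq> states T \<times> obs_prod T \<times> act_prod T \<and>
        (\<forall>i\<in>I. bounded ((\<lambda>(\<omega>, y, u). f i \<omega> (restrict u {1..<i}) (y i)) ` C)) \<longrightarrow>
        bounded ((\<lambda>(\<omega>, y, u). scost \<omega> y u) ` C)"
    proof (intro allI impI, elim conjE)
      fix C
      assume "compact C" "C \<subseteq> states T \<times> obs_prod T \<times> act_prod T"
        and fC: "\<forall>i\<in>I. bounded ((\<lambda>(\<omega>, y, u). f i \<omega> (restrict u {1..<i}) (y i)) ` C)"
      then show "bounded ((\<lambda>(\<omega>, y, u). scost \<omega> y u) ` C)"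
        by (intro bounded_static_cost a_bounded bspec[OF fC])
    qed
    show "act_closed_convex T"
      by (rule b)
    show "obs_locally_compact T"
      by (rule c)
    show "finite_constant_deviations T Js"
      by (rule finite_constant_deviations_static[OF e])
    show "\<forall>G. compact_box T G \<longrightarrow>
        nn_integrable law (sup_cost scost G) \<and> uniformly_integrable qlaw (sup_cost scost G)"
      if "\<forall>G. compact_box T G \<longrightarrow> uniformly_integrable qlaw (sup_cost scost G)"
      using that nn_integrable_sup_static by simp
    show "quantized_policies_near_optimal T Q" "finite_models_near_optimal T f \<nu> net y0 Q"
      if "\<forall>G. compact_box T G \<longrightarrow> uniformly_integrable qlaw (sup_cost scost G)"
      using that by (simp_all add: quantized_policies_near_optimal[OF e] finite_models_near_optimal[OF e])
    show "quantized_policies_near_optimal T Q" "finite_models_near_optimal T f \<nu> net y0 Q"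
      if "densities_bounded T f \<and> (\<forall>G. compact_box T G \<longrightarrow>
        nn_integrable law (sup_cost (cost T) G) \<and> uniformly_integrable qlaw (sup_cost (cost T) G))"
      using static_ui[OF that] by (simp_all add: quantized_policies_near_optimal[OF e] finite_models_near_optimal[OF e])
  qed
qed

end
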